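(* The LCF coordinates $(\mathcal{L},\delta,\mathcal{G},\gamma,\mathcal{H},\zeta)$ form a set of Darboux coordinates on $\tilde V^1$; that is, they are coordinates on $\tilde V^1$ in which the symplectic form $\omega_1$ reads $$\omega_1=d\mathcal{L}\wedge d\delta+d\mathcal{G}\wedge d\gamma+d\mathcal{H}\wedge d\zeta .$$
   Context: Fix $\mu_0,M_0,f>0$. $\mathbb{H}$ is the space of quaternions, $\mathbb{IH}\cong\mathbb{R}^3$ the purely imaginary ones. $\Sigma^0=\{(z,w)\in\mathbb{H}^2\setminus\{(0,0)\}:Re\{\bar z i w\}=0\}$, $V^0=\Sigma^0/S^1$ is the quotient by $(z,w)\mapsto(e^{i\vartheta}z,e^{i\vartheta}w)$ (the regularized phase space), and $\omega_1$ is the symplectic form on $V^0$ obtained by reduction from $Re\{d\bar w\wedge dz\}=\sum_kdw_k\wedge dz_k$. The part of $V^0$ with $z\neq0$ is identified symplectically with $(T^*(\mathbb{IH}\setminus\{0\}),\ Re\{d\bar P\wedge dQ\}=\sum_k dP_k\wedge dQ_k)$ by $Q=\bar z i z$, $P=\frac{\bar z i w}{2|z|^2}$. The Kepler Hamiltonian is $T(P,Q)=\frac{\|P\|^2}{2\mu_0}-\frac{\mu_0M_0}{\|Q\|}$, and the regularized Hamiltonian is $K(z,w)=\frac{|w|^2}{8\mu_0}+f|z|^2-\mu_0M_0=\|Q\|(T(P,Q)+f)$. The orbits of $K$ project in the physical space (by $(z,w)\mapsto Q$) to ellipses with a focus at the origin, called KS-ellipses. The map $k_f:(P,Q)\mapsto(P',Q)$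 rescales the momentum by a positive factor so that the ellipse determined by $(P,Q)$ under the flow of $K$ coincides with the ellipse determined by $(P',Q)$ under the flow of $T$: explicitly $P'=\frac{\mu_0^{3/2}M_0}{\sqrt{2f}\,L}P$, where $L$ is the Delaunay element of $(P',Q)$, i.e. $L=\mu_0\sqrt{M_0}\sqrt a$ with $a$ the semi major axis of the ellipse. Delaunay elements of a state of $T$ with elliptic orbit of semi major axis $a$, eccentricity $e$, inclination $\mathrm{i}$: $L=\mu_0\sqrt{M_0}\sqrt a$, $l$ mean anomaly, $G=L\sqrt{1-e^2}$ (norm of the angular momentum), $g$ argument of pericenter, $H=G\cos \mathrm{i}$ (vertical component of the angular momentum), $h$ longitude of the ascending node; $u$ denotes the eccentric anomaly. $\tilde V^1\subset V^0$ is the open subset where the KS-ellipse is non-degenerate, non-circular and non-horizontal. The LCF coordinates on $\tilde V^1$ are $$\mathcal{L}=\frac{\sqrt{2f}L^2}{\mu_0^{3/2}M_0}\circ k_f,\quad\delta=u\circ k_f,\quad\mathcal{G}=\frac{\sqrt{2f}LG}{\mu_0^{3/2}M_0}\circ k_f,\quad\gamma=g\circ k_f,\quad\mathcal{H}=H,\quad\zeta=h,$$ where $\mathcal{H}=H$ is the vertical component of the angular momentum $Q\times P$ of $(P,Q)$ itself, and $h$ is the longitude of the ascending node of the orbital plane (the same for $(P,Q)$ and $(P',Q)$). The angles $\delta,\gamma,\zeta$ are taken modulo $2\pi$. *)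

theory Defs
  imports "HOL-Analysis.Analysis" "HOL-Library.Real_Mod"
begin

section \<open>Quaternions\<close>

text \<open>A quaternion is a pair (real part, imaginary part), so the purely imaginary quaternions are
  \<open>real^3\<close> and the product norm is the quaternion norm. The units i, j, k are the standard basis
  vectors 1, 2, 3 of \<open>real^3\<close>; the vertical direction of the physical space is the third one.\<close>

type_synonym quat = "real \<times> (real^3)"

definition qmul :: "quat \<Rightarrow> quat \<Rightarrow> quat"  (infixl "\<odot>" 70) where
  "p \<odot> q = (fst p * fst q - snd p \<bullet> snd q,
            fst p *\<^sub>R snd q + fst q *\<^sub>R snd p + cross3 (snd p) (snd q))"

definition qcnj :: "quat \<Rightarrow> quat" where
  "qcnj q = (fst q, - snd q)"

definition qi :: quat where
  "qi = (0, axis 1 1)"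

text \<open>The unit quaternion \<open>e^{i\<theta>}\<close>.\<close>

definition qexpi :: "real \<Rightarrow> quat" where
  "qexpi \<theta> = (cos \<theta>, sin \<theta> *\<^sub>R axis 1 1)"


section \<open>The regularized phase space and its symplectic form\<close>

type_synonym qpair = "quat \<times> quat"

definition bilin :: "qpair \<Rightarrow> real" where
  "bilin = (\<lambda>(z, w). fst (qcnj z \<odot> qi \<odot> w))"

definition Sigma0 :: "qpair set" where
  "Sigma0 = {p. p \<noteq> (0, 0) \<and> bilin p = 0}"

definition act :: "real \<Rightarrow> qpair \<Rightarrow> qpair" where
  "act \<theta> = (\<lambda>(z, w). (qexpi \<theta> \<odot> z, qexpi \<theta> \<odot> w))"

text \<open>Points of the quotient are the circle orbits.\<close>

type_synonym vpoint = "qpair set"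

definition proj :: "qpair \<Rightarrow> vpoint" where
  "proj p = range (\<lambda>\<theta>. act \<theta> p)"

definition V0 :: "vpoint set" where
  "V0 = proj ` Sigma0"

text \<open>Openness for the quotient topology of \<open>Sigma0\<close>.\<close>

definition V0_open :: "vpoint set \<Rightarrow> bool" where
  "V0_open U \<longleftrightarrow> U \<subseteq> V0 \<and> openin (top_of_set Sigma0) {p \<in> Sigma0. proj p \<in> U}"

text \<open>The form \<open>Re (d\<bar>w \<and> dz) = \<Sum>\<^sub>k dw\<^sub>k \<and> dz\<^sub>k\<close> on pairs of quaternions, with the convention
  \<open>(\<alpha> \<and> \<beta>)(X, Y) = \<alpha>(X) \<beta>(Y) - \<alpha>(Y) \<beta>(X)\<close>.\<close>

definition omega :: "qpair \<Rightarrow> qpair \<Rightarrow> real" where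
  "omega X Y = fst (qcnj (snd X) \<odot> fst Y) - fst (qcnj (snd Y) \<odot> fst X)"

text \<open>Tangent space of the regular level set \<open>Sigma0\<close> at \<open>p\<close>.\<close>

definition tangent :: "qpair \<Rightarrow> qpair set" where
  "tangent p = {X. frechet_derivative bilin (at p) X = 0}"

text \<open>Generator of the circle action at \<open>p\<close>.\<close>

definition vert :: "qpair \<Rightarrow> qpair" where
  "vert p = (qi \<odot> fst p, qi \<odot> snd p)"

text \<open>A tangent vector of the quotient is a class of tangent vectors of \<open>Sigma0\<close>, modulo the circle
  action and modulo the vertical direction; \<open>dproj p X\<close> is the class of the vector \<open>X\<close> at \<open>p\<close>, that
  is, the image of \<open>X\<close> under the differential of \<open>proj\<close> at \<open>p\<close>.\<close>

type_synonym vtangent = "(qpair \<times> qpair) set"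

definition dproj :: "qpair \<Rightarrow> qpair \<Rightarrow> vtangent" where
  "dproj p X = {(act \<theta> p, act \<theta> X + s *\<^sub>R vert (act \<theta> p)) | \<theta> s. True}"

text \<open>The reduced form: its pullback under \<open>proj\<close> is the restriction of \<open>omega\<close> to \<open>Sigma0\<close>.\<close>

definition omega1 :: "vtangent \<Rightarrow> vtangent \<Rightarrow> real" where
  "omega1 \<xi> \<eta> = (THE r. \<exists>p\<in>Sigma0. \<exists>X\<in>tangent p. \<exists>Y\<in>tangent p.
      \<xi> = dproj p X \<and> \<eta> = dproj p Y \<and> r = omega X Y)"


section \<open>Smooth charts of the regularized phase space\<close>

fun Ck_on :: "nat \<Rightarrow> 'a::euclidean_space set \<Rightarrow> ('a \<Rightarrow> 'b::euclidean_space) \<Rightarrow> bool" where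
  "Ck_on 0 S g = continuous_on S g"
| "Ck_on (Suc n) S g =
     (g differentiable_on S \<and> (\<forall>v. Ck_on n S (\<lambda>x. frechet_derivative g (at x) v)))"

text \<open>Only meant for open \<open>S\<close>.\<close>

definition smooth_on :: "'a::euclidean_space set \<Rightarrow> ('a \<Rightarrow> 'b::euclidean_space) \<Rightarrow> bool" where
  "smooth_on S g \<longleftrightarrow> (\<forall>n. Ck_on n S g)"

text \<open>A function on the quotient is smooth iff its lift to \<open>Sigma0\<close> is, and the latter means that
  the lift is locally the restriction of a smooth function of the ambient space.\<close>

definition V0_smooth_on :: "vpoint set \<Rightarrow> (vpoint \<Rightarrow> 'b::euclidean_space) \<Rightarrow> bool" where
  "V0_smooth_on U \<phi> \<longleftrightarrow> (\<forall>p\<in>Sigma0. proj p \<in> U \<longrightarrow>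
     (\<exists>N g. open N \<and> p \<in> N \<and> smooth_on N g \<and>
        (\<forall>q\<in>N \<inter> Sigma0. proj q \<in> U \<longrightarrow> \<phi> (proj q) = g q)))"

type_synonym real6 = "real \<times> real \<times> real \<times> real \<times> real \<times> real"

text \<open>A chart is a diffeomorphism onto an open set. As \<open>proj\<close> admits smooth local sections, smoothness
  of the inverse means that it lifts locally to a smooth map into \<open>Sigma0\<close>.\<close>

definition V0_chart :: "vpoint set \<Rightarrow> (vpoint \<Rightarrow> real6) \<Rightarrow> bool" where
  "V0_chart N \<phi> \<longleftrightarrow> V0_open N \<and> V0_smooth_on N \<phi> \<and> inj_on \<phi> N \<and> open (\<phi> ` N) \<and>
     (\<forall>c\<in>\<phi> ` N. \<exists>W s. open W \<and> c \<in> W \<and> W \<subseteq> \<phi> ` N \<and> smooth_on W s \<and>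
        (\<forall>c'\<in>W. s c' \<in> Sigma0 \<and> proj (s c') \<in> N \<and> \<phi> (proj (s c')) = c'))"

text \<open>Coordinates are ordered as (action, angle, action, angle, action, angle).\<close>

definition wedge_form :: "real6 \<Rightarrow> real6 \<Rightarrow> real" where
  "wedge_form = (\<lambda>(l, d, g, c, h, s) (l', d', g', c', h', s').
     (l * d' - l' * d) + (g * c' - g' * c) + (h * s' - h' * s))"

definition same_mod_2pi :: "real6 \<Rightarrow> real6 \<Rightarrow> bool" where
  "same_mod_2pi = (\<lambda>(l, d, g, c, h, s) (l', d', g', c', h', s').
     l = l' \<and> g = g' \<and> h = h' \<and>
     [d = d'] (rmod (2 * pi)) \<and> [c = c'] (rmod (2 * pi)) \<and> [s = s'] (rmod (2 * pi)))"

text \<open>\<open>\<Phi>\<close>, with its angles read modulo \<open>2\<pi>\<close>, is injective on \<open>U\<close>; near each point of \<open>U\<close> it has a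
  real-valued determination \<open>\<phi>\<close> which is a chart, and in this chart \<open>omega1\<close> is the standard form.
  Here \<open>D\<close> is the differential of \<open>\<phi> \<circ> proj\<close> along \<open>Sigma0\<close>; on vectors tangent to \<open>Sigma0\<close> it is
  uniquely determined and it is the differential of \<open>\<phi>\<close> applied to \<open>dproj p X\<close>.\<close>

definition Darboux_coordinates_on :: "vpoint set \<Rightarrow> (vpoint \<Rightarrow> real6) \<Rightarrow> bool" where
  "Darboux_coordinates_on U \<Phi> \<longleftrightarrow>
     (\<forall>x\<in>U. \<forall>y\<in>U. same_mod_2pi (\<Phi> x) (\<Phi> y) \<longrightarrow> x = y) \<and>
     (\<forall>x\<in>U. \<exists>N \<phi>. x \<in> N \<and> N \<subseteq> U \<and> V0_chart N \<phi> \<and>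
        (\<forall>y\<in>N. same_mod_2pi (\<phi> y) (\<Phi> y)) \<and>
        (\<forall>p\<in>Sigma0. proj p \<in> N \<longrightarrow>
           (\<exists>D. ((\<phi> \<circ> proj) has_derivative D) (at p within Sigma0) \<and>
              (\<forall>X\<in>tangent p. \<forall>Y\<in>tangent p.
                 omega1 (dproj p X) (dproj p Y) = wedge_form (D X) (D Y)))))"


section \<open>Positions, momenta and KS-ellipses\<close>

definition pos :: "qpair \<Rightarrow> real^3" where
  "pos = (\<lambda>(z, w). snd (qcnj z \<odot> qi \<odot> z))"

definition mom :: "qpair \<Rightarrow> real^3" where
  "mom = (\<lambda>(z, w). (1 / (2 * (norm z)\<^sup>2)) *\<^sub>R snd (qcnj z \<odot> qi \<odot> w))"

text \<open>The pair \<open>(P, Q)\<close> of a point of the quotient; it does not depend on the representative.\<close>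

definition PQ :: "vpoint \<Rightarrow> (real^3) \<times> (real^3)" where
  "PQ x = the_elem ((\<lambda>p. (mom p, pos p)) ` x)"

definition ham_K :: "real \<Rightarrow> real \<Rightarrow> real \<Rightarrow> qpair \<Rightarrow> real" where
  "ham_K \<mu> M f = (\<lambda>(z, w). (norm w)\<^sup>2 / (8 * \<mu>) + f * (norm z)\<^sup>2 - \<mu> * M)"

text \<open>With the sign convention of \<open>omega\<close>, Hamilton's equations \<open>dz/dt = \<partial>K/\<partial>w\<close>,
  \<open>dw/dt = -\<partial>K/\<partial>z\<close> say that the velocity \<open>X\<close> satisfies \<open>dK(Y) = omega Y X\<close> for all \<open>Y\<close>.\<close>

definition K_orbit :: "real \<Rightarrow> real \<Rightarrow> real \<Rightarrow> (real \<Rightarrow> qpair) \<Rightarrow> bool" where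
  "K_orbit \<mu> M f c \<longleftrightarrow> (\<forall>t. \<exists>X. (c has_vector_derivative X) (at t) \<and>
     (\<forall>Y. frechet_derivative (ham_K \<mu> M f) (at (c t)) Y = omega Y X))"

definition KS_ellipse :: "real \<Rightarrow> real \<Rightarrow> real \<Rightarrow> vpoint \<Rightarrow> (real^3) set" where
  "KS_ellipse \<mu> M f x = {pos (c t) | c t. K_orbit \<mu> M f c \<and> c 0 \<in> x}"

text \<open>An ellipse is degenerate if it is a line segment, and, being planar, it is a circle iff it lies on
  some sphere.\<close>

definition V1tilde :: "real \<Rightarrow> real \<Rightarrow> real \<Rightarrow> vpoint set" where
  "V1tilde \<mu> M f = {x \<in> V0.
     \<not> collinear (KS_ellipse \<mu> M f x) \<and>
     \<not> (\<exists>b r. KS_ellipse \<mu> M f x \<subseteq> sphere b r) \<and>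
     \<not> KS_ellipse \<mu> M f x \<subseteq> {v. v $ 3 = 0}}"


section \<open>Delaunay elements of the Kepler problem\<close>

text \<open>Osculating elements of a state \<open>(P, Q)\<close> of the Kepler problem with mass \<open>\<mu>\<close> and Hamiltonian
  \<open>ham_T\<close>. They are meaningful for \<open>Q \<noteq> 0\<close> and \<open>ham_T \<mu> M P Q < 0\<close> and for
  non-degenerate orbits; the eccentric anomaly and the argument of pericenter in addition require
  the orbit to be non-circular, the node and the argument of pericenter require it to be
  non-horizontal.\<close>

definition ham_T :: "real \<Rightarrow> real \<Rightarrow> real^3 \<Rightarrow> real^3 \<Rightarrow> real" where
  "ham_T \<mu> M P Q = (norm P)\<^sup>2 / (2 * \<mu>) - \<mu> * M / norm Q"

text \<open>The energy of an elliptic orbit of semi major axis \<open>a\<close> is \<open>- \<mu> M / (2 a)\<close>.\<close>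

definition semi_major :: "real \<Rightarrow> real \<Rightarrow> real^3 \<Rightarrow> real^3 \<Rightarrow> real" where
  "semi_major \<mu> M P Q = - \<mu> * M / (2 * ham_T \<mu> M P Q)"

definition angmom :: "real^3 \<Rightarrow> real^3 \<Rightarrow> real^3" where
  "angmom P Q = cross3 Q P"

text \<open>The eccentricity (Laplace-Runge-Lenz) vector: it points to the pericenter and its norm is the
  eccentricity.\<close>

definition ecc_vec :: "real \<Rightarrow> real \<Rightarrow> real^3 \<Rightarrow> real^3 \<Rightarrow> real^3" where
  "ecc_vec \<mu> M P Q = (1 / (\<mu>\<^sup>2 * M)) *\<^sub>R cross3 P (angmom P Q) - (1 / norm Q) *\<^sub>R Q"

definition ecc :: "real \<Rightarrow> real \<Rightarrow> real^3 \<Rightarrow> real^3 \<Rightarrow> real" where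
  "ecc \<mu> M P Q = norm (ecc_vec \<mu> M P Q)"

definition Del_L :: "real \<Rightarrow> real \<Rightarrow> real^3 \<Rightarrow> real^3 \<Rightarrow> real" where
  "Del_L \<mu> M P Q = \<mu> * sqrt M * sqrt (semi_major \<mu> M P Q)"

definition Del_G :: "real \<Rightarrow> real \<Rightarrow> real^3 \<Rightarrow> real^3 \<Rightarrow> real" where
  "Del_G \<mu> M P Q = Del_L \<mu> M P Q * sqrt (1 - (ecc \<mu> M P Q)\<^sup>2)"

text \<open>The angle in \<open>[0, 2\<pi>)\<close> of the unit vector \<open>v\<close> in the plane oriented by the orthonormal pair
  \<open>(x, y)\<close>.\<close>

definition angle_in :: "real^3 \<Rightarrow> real^3 \<Rightarrow> real^3 \<Rightarrow> real" where
  "angle_in x y v = (THE \<theta>. 0 \<le> \<theta> \<and> \<theta> < 2 * pi \<and> v = cos \<theta> *\<^sub>R x + sin \<theta> *\<^sub>R y)"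

text \<open>The direction of the ascending node is that of (vertical direction) \<open>\<times>\<close> (angular momentum).\<close>

definition node_dir :: "real^3 \<Rightarrow> real^3 \<Rightarrow> real^3" where
  "node_dir P Q = sgn (cross3 (axis 3 1) (angmom P Q))"

definition Del_h :: "real^3 \<Rightarrow> real^3 \<Rightarrow> real" where
  "Del_h P Q = angle_in (axis 1 1) (axis 2 1) (node_dir P Q)"

definition Del_g :: "real \<Rightarrow> real \<Rightarrow> real^3 \<Rightarrow> real^3 \<Rightarrow> real" where
  "Del_g \<mu> M P Q = angle_in (node_dir P Q) (cross3 (sgn (angmom P Q)) (node_dir P Q))
     (sgn (ecc_vec \<mu> M P Q))"

text \<open>With the pericenter direction as first axis, the position on the ellipse with focus at the
  origin is \<open>(a (cos u - e), a sqrt (1 - e\<^sup>2) sin u)\<close>.\<close>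

definition ecc_anomaly :: "real \<Rightarrow> real \<Rightarrow> real^3 \<Rightarrow> real^3 \<Rightarrow> real" where
  "ecc_anomaly \<mu> M P Q = (THE u. 0 \<le> u \<and> u < 2 * pi \<and>
     (let a = semi_major \<mu> M P Q; e = ecc \<mu> M P Q; x = sgn (ecc_vec \<mu> M P Q);
          y = cross3 (sgn (angmom P Q)) x
      in Q = (a * (cos u - e)) *\<^sub>R x + (a * sqrt (1 - e\<^sup>2) * sin u) *\<^sub>R y))"


section \<open>LCF coordinates\<close>

text \<open>The momentum \<open>P'\<close> of \<open>k\<^sub>f (P, Q) = (P', Q)\<close>. The rescaling factor contains the element \<open>L\<close> of
  \<open>(P', Q)\<close>, so it is defined implicitly; there is exactly one solution with \<open>(P', Q)\<close> elliptic.\<close>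

definition kf_mom :: "real \<Rightarrow> real \<Rightarrow> real \<Rightarrow> real^3 \<Rightarrow> real^3 \<Rightarrow> real^3" where
  "kf_mom \<mu> M f P Q = (THE P'. ham_T \<mu> M P' Q < 0 \<and>
     P' = (\<mu> powr (3/2) * M / (sqrt (2 * f) * Del_L \<mu> M P' Q)) *\<^sub>R P)"

definition LCF :: "real \<Rightarrow> real \<Rightarrow> real \<Rightarrow> vpoint \<Rightarrow> real6" where
  "LCF \<mu> M f x =
    (let (P, Q) = PQ x;
         P' = kf_mom \<mu> M f P Q;
         L = Del_L \<mu> M P' Q;
         G = Del_G \<mu> M P' Q
     in (sqrt (2 * f) * L\<^sup>2 / (\<mu> powr (3/2) * M),
         ecc_anomaly \<mu> M P' Q,
         sqrt (2 * f) * L * G / (\<mu> powr (3/2) * M),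
         Del_g \<mu> M P' Q,
         angmom P Q $ 3,
         Del_h P Q))"

end

theory Submission
  imports Defs
begin

text \<open>Let \<open>m = 2 sqrt (2 f \<mu>)\<close> and \<open>b = w / m\<close>. In the pair \<open>(z, b)\<close> the regularized Hamiltonian is that of
  an isotropic harmonic oscillator, so that the physical orbit is the image of \<open>cos t z + sin t b\<close> under the
  Hopf map \<open>z \<mapsto> qcnj z \<odot> qi \<odot> z\<close>. On \<open>Sigma0\<close> all products of \<open>qcnj z \<odot> qi \<odot> z\<close>, \<open>qcnj b \<odot> qi \<odot> b\<close> and
  \<open>qcnj z \<odot> qi \<odot> b\<close> are expressed by the quaternion \<open>qcnj z \<odot> b\<close> (locale \<open>level_pair\<close>). Consequently the
  Keplerian elements of the rescaled state \<open>k\<^sub>f (P, Q)\<close> can be read off from polynomials in \<open>(z, b)\<close>: the semi major axis is \<open>a = (norm z ^ 2 + norm b ^ 2) / 2\<close>, the angular momentum \<open>Q \<times> P\<close> is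
  \<open>- (m / 2) Im (qcnj z \<odot> b)\<close>, the eccentricity vector is \<open>- (qcnj z \<odot> qi \<odot> z + qcnj b \<odot> qi \<odot> b) / (2 a)\<close> and
  \<open>(norm b ^ 2 - norm z ^ 2, 2 Re (qcnj z \<odot> b))\<close> is a positive multiple of the cosine and the sine of the
  eccentric anomaly. The resulting relation between points and coordinates is called \<open>elements\<close>; it is
  invariant under shifts of the angles by \<open>2 \<pi>\<close>, the coordinates determine the point up to the circle action
  (\<open>elements_inject\<close>), the point determines them modulo \<open>2 \<pi>\<close> (\<open>elements_determined\<close>), and the LCF
  coordinates satisfy it (\<open>LCF_elements\<close>). The same polynomials give smooth local determinations of the
  coordinates (\<open>local_determination\<close>) and show that non-degenerate, non-circular and non-horizontal means that
  the eccentricity vector and the horizontal part of the angular momentum do not vanish (\<open>V1tilde_iff\<close>).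

  The symplectic form is computed from a global section. For a horizontal orbital plane \<open>z\<close> can be chosen in the
  span of 1 and k; with \<open>- k\<close> as imaginary unit it is \<open>\<sigma> cis ((\<delta> + \<gamma>) / 2) - \<tau> cis ((\<gamma> - \<delta>) / 2)\<close>, where
  \<open>\<sigma>\<^sup>2 = (\<L> + \<G>) / m\<close> and \<open>\<tau>\<^sup>2 = (\<L> - \<G>) / m\<close>. The angles are halved because the Hopf map is quadratic. Inclination and node split each of the two
  oscillations into two. The section is therefore a sum of four oscillations in symplectic planes, whose
  squared amplitudes are \<open>(\<L> \<plusminus> \<G>) (\<G> \<plusminus> \<H>) / (2 m \<G>)\<close> and whose phases are \<open>(\<plusminus>\<delta> + \<gamma> \<plusminus> \<zeta>) / 2\<close>. In polar
  coordinates the pullback of \<open>omega\<close> is the sum of the four forms \<open>\<plusminus> m d (amplitude^2) \<and> d phase\<close>, and this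
  sum is \<open>d\<L> \<and> d\<delta> + d\<G> \<and> d\<gamma> + d\<H> \<and> d\<zeta>\<close> (\<open>lift6_symplectic\<close>). Local inverses of the section are the charts,
  and as the tangent space of \<open>Sigma0\<close> is spanned by the image of the section and the vertical direction
  (\<open>tangent_decomposition\<close>), the form on the quotient is the standard one (\<open>chart_symplectic\<close>).\<close>

section \<open>Calculus of smooth functions\<close>

text \<open>On an open set the value of the derivative operator at a point depends only on the function near that
  point; hence \<open>Ck_on\<close> may be checked with any expression for the derivative.\<close>

lemma Ck_on_cong:
  assumes "open S" "\<And>x. x \<in> S \<Longrightarrow> g x = h x" "Ck_on n S g"
  shows "Ck_on n S h"
  using assms(2,3)
proof (induction n arbitrary: g h)
  case 0
  then show ?case using continuous_on_cong by (metis Ck_on.simps(1))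
next
  case (Suc n)
  have d: "(h has_derivative frechet_derivative g (at x)) (at x)" if "x \<in> S" for x
  proof (rule has_derivative_transform_within_open[OF _ assms(1) that])
    have "g differentiable (at x)"
      using Suc.prems(2) that assms(1) by (auto simp: differentiable_on_eq_differentiable_at)
    then show "(g has_derivative frechet_derivative g (at x)) (at x)"
      using frechet_derivative_works by blast
  qed (use Suc.prems in auto)
  then have "h differentiable_on S"
    using assms(1) by (auto simp: differentiable_on_eq_differentiable_at differentiable_def)
  moreover have "frechet_derivative h (at x) = frechet_derivative g (at x)" if "x \<in> S" for x
    using d[OF that] by (metis frechet_derivative_at)
  ultimately show ?case
    using Suc.IH[of "\<lambda>x. frechet_derivative g (at x) v" "\<lambda>x. frechet_derivative h (at x) v" for v]
      Suc.prems(2) by simp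
qed

lemma Ck_on_SucI:
  assumes "open S" "\<And>x. x \<in> S \<Longrightarrow> (g has_derivative g' x) (at x)" "\<And>v. Ck_on n S (\<lambda>x. g' x v)"
  shows "Ck_on (Suc n) S g"
proof -
  have "g differentiable_on S"
    using assms by (auto simp: differentiable_on_eq_differentiable_at differentiable_def)
  moreover have "g' x = frechet_derivative g (at x)" if "x \<in> S" for x
    using frechet_derivative_at assms(2) that by blast
  ultimately show ?thesis
    using Ck_on_cong[OF assms(1) _ assms(3)] by simp
qed

lemma Ck_on_SucE:
  assumes "open S" "Ck_on (Suc n) S g"
  obtains g' where "\<And>x. x \<in> S \<Longrightarrow> (g has_derivative g' x) (at x)" "\<And>v. Ck_on n S (\<lambda>x. g' x v)"
proof (rule that[of "\<lambda>x. frechet_derivative g (at x)"])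
  show "(g has_derivative frechet_derivative g (at x)) (at x)" if "x \<in> S" for x
    using assms that differentiable_on_eq_differentiable_at frechet_derivative_works
    by (metis Ck_on.simps(2))
qed (use assms in auto)

lemma Ck_on_SucD: "open S \<Longrightarrow> Ck_on (Suc n) S g \<Longrightarrow> Ck_on n S g"
proof (induction n arbitrary: g)
  case 0
  then show ?case by (simp add: differentiable_imp_continuous_on)
next
  case (Suc n)
  then show ?case using Ck_on.simps(2) by blast
qed

lemma Ck_on_const: "open S \<Longrightarrow> Ck_on n S (\<lambda>x. c)"
proof (induction n arbitrary: c)
  case (Suc n)
  show ?case by (rule Ck_on_SucI[where g' = "\<lambda>x v. 0"]) (use Suc in auto)
qed simp

lemma Ck_on_linear: 
  assumes "open S" "bounded_linear L" "Ck_on n S g"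
  shows "Ck_on n S (\<lambda>x. L (g x))"
  using assms(3)
proof (induction n arbitrary: g)
  case 0
  then show ?case using assms(2)
    by (simp add: bounded_linear.continuous_on)
next
  case (Suc n)
  from Ck_on_SucE[OF assms(1) Suc.prems] obtain g' where
    g: "\<And>x. x \<in> S \<Longrightarrow> (g has_derivative g' x) (at x)" "\<And>v. Ck_on n S (\<lambda>x. g' x v)" by blast
  have "((\<lambda>x. L (g x)) has_derivative (\<lambda>v. L (g' x v))) (at x)" if "x \<in> S" for x
    using bounded_linear.has_derivative[OF assms(2) g(1)[OF that]] .
  from Ck_on_SucI[OF assms(1) this Suc.IH[OF g(2)]] show ?case .
qed

lemma Ck_on_add: 
  assumes "open S" "Ck_on n S f" "Ck_on n S g"
  shows "Ck_on n S (\<lambda>x. f x + g x)"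
  using assms(2,3)
proof (induction n arbitrary: f g)
  case 0
  then show ?case by (simp add: continuous_on_add)
next
  case (Suc n)
  from Ck_on_SucE[OF assms(1) Suc.prems(1)] obtain f' where
    f: "\<And>x. x \<in> S \<Longrightarrow> (f has_derivative f' x) (at x)" "\<And>v. Ck_on n S (\<lambda>x. f' x v)" by blast
  from Ck_on_SucE[OF assms(1) Suc.prems(2)] obtain g' where
    g: "\<And>x. x \<in> S \<Longrightarrow> (g has_derivative g' x) (at x)" "\<And>v. Ck_on n S (\<lambda>x. g' x v)" by blast
  show ?case
    by (rule Ck_on_SucI[OF assms(1), where g' = "\<lambda>x v. f' x v + g' x v"])
      (use f g Suc.IH has_derivative_add in auto)
qed

lemma Ck_on_bilinear: 
  assumes "open S" "bounded_bilinear B" "Ck_on n S f" "Ck_on n S g"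
  shows "Ck_on n S (\<lambda>x. B (f x) (g x))"
  using assms(3,4)
proof (induction n arbitrary: f g)
  case 0
  then show ?case using bounded_bilinear.continuous_on[OF assms(2)] by simp
next
  case (Suc n)
  from Ck_on_SucE[OF assms(1) Suc.prems(1)] obtain f' where
    f: "\<And>x. x \<in> S \<Longrightarrow> (f has_derivative f' x) (at x)" "\<And>v. Ck_on n S (\<lambda>x. f' x v)" by blast
  from Ck_on_SucE[OF assms(1) Suc.prems(2)] obtain g' where
    g: "\<And>x. x \<in> S \<Longrightarrow> (g has_derivative g' x) (at x)" "\<And>v. Ck_on n S (\<lambda>x. g' x v)" by blast
  have fg: "Ck_on n S f" "Ck_on n S g"
    using Suc.prems Ck_on_SucD[OF assms(1)] by blast+
  have "((\<lambda>x. B (f x) (g x)) has_derivative (\<lambda>v. B (f x) (g' x v) + B (f' x v) (g x))) (at x)"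
    if "x \<in> S" for x
    using bounded_bilinear.FDERIV[OF assms(2) f(1)[OF that] g(1)[OF that]] .
  from Ck_on_SucI[OF assms(1) this Ck_on_add[OF assms(1) Suc.IH[OF fg(1) g(2)] Suc.IH[OF f(2) fg(2)]]]
  show ?case .
qed

lemma Ck_on_Pair: 
  assumes "open S" "Ck_on n S f" "Ck_on n S g"
  shows "Ck_on n S (\<lambda>x. (f x, g x))"
proof -
  have "bounded_linear (\<lambda>y. (y, 0))" "bounded_linear (\<lambda>y. (0, y))"
    by (simp_all add: bounded_linear_Pair bounded_linear_ident bounded_linear_zero)
  from Ck_on_add[OF assms(1) Ck_on_linear[OF assms(1) this(1) assms(2)]
      Ck_on_linear[OF assms(1) this(2) assms(3)]]
  show ?thesis by simp
qed

text \<open>The chain rule expresses the derivative of \<open>h \<circ> g\<close> through the derivative of \<open>g\<close> and \<open>h' \<circ> g\<close>,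
  where \<open>h'\<close> is an algebraic expression in \<open>h\<close> itself for the reciprocal, the square root and the pair
  sine, cosine. Hence these lemmas are inductions on the order of differentiability. The derivative of the
  arc tangent is rational, which reduces it to the reciprocal.\<close>

lemma Ck_on_inverse:
  fixes g :: "'a::euclidean_space \<Rightarrow> real"
  assumes "open S" "Ck_on n S g" "\<And>x. x \<in> S \<Longrightarrow> g x \<noteq> 0"
  shows "Ck_on n S (\<lambda>x. inverse (g x))"
  using assms(2)
proof (induction n)
  case 0
  then show ?case using assms(3) by (auto intro: continuous_on_inverse)
next
  case (Suc n)
  from Ck_on_SucE[OF assms(1) Suc.prems] obtain g' where
    g: "\<And>x. x \<in> S \<Longrightarrow> (g has_derivative g' x) (at x)" "\<And>v. Ck_on n S (\<lambda>x. g' x v)" by blast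
  have i: "Ck_on n S (\<lambda>x. inverse (g x))"
    using Suc Ck_on_SucD[OF assms(1)] by blast
  have d: "((\<lambda>x. inverse (g x)) has_derivative (\<lambda>v. - (inverse (g x) * g' x v * inverse (g x)))) (at x)"
    if "x \<in> S" for x
    using Deriv.has_derivative_inverse[OF assms(3)[OF that] g(1)[OF that]] .
  have "Ck_on n S (\<lambda>x. - (inverse (g x) * g' x v * inverse (g x)))" for v
    by (intro Ck_on_linear[OF assms(1) bounded_linear_minus[OF bounded_linear_ident]]
         Ck_on_bilinear[OF assms(1) bounded_bilinear_mult] i g)
  then show ?case
    using Ck_on_SucI[OF assms(1) d] by blast
qed

lemma Ck_on_sqrt:
  assumes "open S" "Ck_on n S g" "\<And>x. x \<in> S \<Longrightarrow> g x > 0"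
  shows "Ck_on n S (\<lambda>x. sqrt (g x))"
  using assms(2)
proof (induction n)
  case 0
  then show ?case by (auto intro: continuous_on_real_sqrt)
next
  case (Suc n)
  from Ck_on_SucE[OF assms(1) Suc.prems] obtain g' where
    g: "\<And>x. x \<in> S \<Longrightarrow> (g has_derivative g' x) (at x)" "\<And>v. Ck_on n S (\<lambda>x. g' x v)" by blast
  have i: "Ck_on n S (\<lambda>x. sqrt (g x))"
    using Suc Ck_on_SucD[OF assms(1)] by blast
  have d: "((\<lambda>x. sqrt (g x)) has_derivative (\<lambda>v. g' x v * (inverse (sqrt (g x)) / 2))) (at x)" if "x \<in> S" for x
    using g(1)[OF that] assms(3)[OF that] by (auto intro!: derivative_eq_intros)
  have nz: "sqrt (g x) \<noteq> 0" if "x \<in> S" for x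
    using assms(3)[OF that] by simp
  have "Ck_on n S (\<lambda>x. g' x v * (inverse (sqrt (g x)) / 2))" for v
    by (intro Ck_on_linear[OF assms(1) bounded_linear_divide]
         Ck_on_bilinear[OF assms(1) bounded_bilinear_mult] Ck_on_inverse assms(1) i g nz)
  then show ?case
    using Ck_on_SucI[OF assms(1) d] by blast
qed

lemma Ck_on_sin_cos:
  fixes g :: "'a::euclidean_space \<Rightarrow> real"
  assumes "open S" "Ck_on n S g"
  shows "Ck_on n S (\<lambda>x. sin (g x)) \<and> Ck_on n S (\<lambda>x. cos (g x))"
  using assms(2)
proof (induction n)
  case 0
  then show ?case by (auto intro: continuous_intros)
next
  case (Suc n)
  from Ck_on_SucE[OF assms(1) Suc.prems] obtain g' where
    g: "\<And>x. x \<in> S \<Longrightarrow> (g has_derivative g' x) (at x)" "\<And>v. Ck_on n S (\<lambda>x. g' x v)" by blast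
  have i: "Ck_on n S (\<lambda>x. sin (g x))" "Ck_on n S (\<lambda>x. cos (g x))"
    using Suc Ck_on_SucD[OF assms(1)] by blast+
  have d: "((\<lambda>x. sin (g x)) has_derivative (\<lambda>v. g' x v * cos (g x))) (at x)"
    "((\<lambda>x. cos (g x)) has_derivative (\<lambda>v. - (g' x v * sin (g x)))) (at x)" if "x \<in> S" for x
    using g(1)[OF that] by (auto intro!: derivative_eq_intros simp: algebra_simps)
  have "Ck_on n S (\<lambda>x. g' x v * cos (g x))" "Ck_on n S (\<lambda>x. - (g' x v * sin (g x)))" for v
    by (intro Ck_on_linear[OF assms(1) bounded_linear_minus[OF bounded_linear_ident]]
         Ck_on_bilinear[OF assms(1) bounded_bilinear_mult] i g)+
  then show ?case
    using Ck_on_SucI[OF assms(1) d(1)] Ck_on_SucI[OF assms(1) d(2)] by blast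
qed

lemma Ck_on_arctan:
  fixes g :: "'a::euclidean_space \<Rightarrow> real"
  assumes "open S" "Ck_on n S g"
  shows "Ck_on n S (\<lambda>x. arctan (g x))"
  using assms(2)
proof (cases n)
  case 0
  then show ?thesis using assms(2) by (auto intro: continuous_intros)
next
  case (Suc k)
  with assms have "Ck_on (Suc k) S g" by simp
  from Ck_on_SucE[OF assms(1) this] obtain g' where
    g: "\<And>x. x \<in> S \<Longrightarrow> (g has_derivative g' x) (at x)" "\<And>v. Ck_on k S (\<lambda>x. g' x v)" by blast
  have i: "Ck_on k S g"
    using \<open>Ck_on (Suc k) S g\<close> Ck_on_SucD[OF assms(1)] by blast
  have d: "((\<lambda>x. arctan (g x)) has_derivative (\<lambda>v. g' x v * inverse (1 + g x * g x))) (at x)" if "x \<in> S" for x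
    using g(1)[OF that] by (auto intro!: derivative_eq_intros simp: power2_eq_square)
  have nz: "1 + g x * g x \<noteq> 0" for x
    by (smt (verit) zero_le_square)
  have "Ck_on k S (\<lambda>x. g' x v * inverse (1 + g x * g x))" for v
    by (intro Ck_on_bilinear[OF assms(1) bounded_bilinear_mult] Ck_on_inverse
          Ck_on_add Ck_on_const assms(1) i g nz)
  then show ?thesis unfolding Suc
    using Ck_on_SucI[OF assms(1) d] by blast
qed

named_theorems smooth_intros

lemma smooth_on_const [smooth_intros]: "open S \<Longrightarrow> smooth_on S (\<lambda>x. c)"
  by (simp add: smooth_on_def Ck_on_const)

lemma smooth_on_bounded_linear:
  assumes "open S" "bounded_linear L" "smooth_on S g"
  shows "smooth_on S (\<lambda>x. L (g x))"
  using Ck_on_linear[OF assms(1,2)] assms(3) unfolding smooth_on_def by blast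

lemma smooth_on_id [smooth_intros]:
  assumes "open S"
  shows "smooth_on S (\<lambda>x. x)"
  unfolding smooth_on_def
proof
  show "Ck_on n S (\<lambda>x. x)" for n
  proof (cases n)
    case (Suc k)
    have "Ck_on (Suc k) S (\<lambda>x. x)"
      by (rule Ck_on_SucI[OF assms has_derivative_ident Ck_on_const[OF assms]])
    then show ?thesis unfolding Suc .
  qed (simp add: assms)
qed

lemmas smooth_on_fst [smooth_intros] = smooth_on_bounded_linear[OF _ bounded_linear_fst]
lemmas smooth_on_snd [smooth_intros] = smooth_on_bounded_linear[OF _ bounded_linear_snd]
lemmas smooth_on_minus [smooth_intros] =
  smooth_on_bounded_linear[OF _ bounded_linear_minus[OF bounded_linear_ident]]
lemmas smooth_on_vec_nth [smooth_intros] = smooth_on_bounded_linear[OF _ bounded_linear_vec_nth]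
lemmas smooth_on_divide_const [smooth_intros] = smooth_on_bounded_linear[OF _ bounded_linear_divide]

lemma smooth_on_add [smooth_intros]: 
  "open S \<Longrightarrow> smooth_on S f \<Longrightarrow> smooth_on S g \<Longrightarrow> smooth_on S (\<lambda>x. f x + g x)"
  unfolding smooth_on_def using Ck_on_add by blast

lemma smooth_on_diff [smooth_intros]: 
  "open S \<Longrightarrow> smooth_on S f \<Longrightarrow> smooth_on S g \<Longrightarrow> smooth_on S (\<lambda>x. f x - g x)"
  using smooth_on_add[of S f "\<lambda>x. - g x"] smooth_on_minus[of S g] by simp

lemma smooth_on_bilinear:
  "open S \<Longrightarrow> bounded_bilinear B \<Longrightarrow> smooth_on S f \<Longrightarrow> smooth_on S g \<Longrightarrow> smooth_on S (\<lambda>x. B (f x) (g x))"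
  unfolding smooth_on_def using Ck_on_bilinear[of S B] by blast

lemmas smooth_on_mult [smooth_intros] = 
  smooth_on_bilinear[OF _ bounded_bilinear_mult[where 'a=real]]
lemmas smooth_on_scaleR [smooth_intros] = 
  smooth_on_bilinear[OF _ bounded_bilinear_scaleR]
lemmas smooth_on_inner [smooth_intros] = 
  smooth_on_bilinear[OF _ bounded_bilinear_inner]

lemma smooth_on_cross3 [smooth_intros]: 
  "open S \<Longrightarrow> smooth_on S f \<Longrightarrow> smooth_on S g \<Longrightarrow> smooth_on S (\<lambda>x. cross3 (f x) (g x))"
  by (rule smooth_on_bilinear[OF _ bilinear_cross[unfolded bilinear_conv_bounded_bilinear]])

lemma smooth_on_Pair [smooth_intros]: 
  "open S \<Longrightarrow> smooth_on S f \<Longrightarrow> smooth_on S g \<Longrightarrow> smooth_on S (\<lambda>x. (f x, g x))"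
  unfolding smooth_on_def using Ck_on_Pair by blast

lemma smooth_on_sin [smooth_intros]: "open S \<Longrightarrow> smooth_on S g \<Longrightarrow> smooth_on S (\<lambda>x. sin (g x :: real))"
  and smooth_on_cos [smooth_intros]: "open S \<Longrightarrow> smooth_on S g \<Longrightarrow> smooth_on S (\<lambda>x. cos (g x :: real))"
  unfolding smooth_on_def using Ck_on_sin_cos by blast+

lemma smooth_on_arctan [smooth_intros]:
  "open S \<Longrightarrow> smooth_on S g \<Longrightarrow> smooth_on S (\<lambda>x. arctan (g x))"
  unfolding smooth_on_def using Ck_on_arctan by blast

lemma smooth_on_sqrt [smooth_intros]: 
  "open S \<Longrightarrow> smooth_on S g \<Longrightarrow> (\<And>x. x \<in> S \<Longrightarrow> g x > 0) \<Longrightarrow> smooth_on S (\<lambda>x. sqrt (g x))"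
  unfolding smooth_on_def using Ck_on_sqrt by blast

lemma smooth_on_divide [smooth_intros]:
  fixes f g :: "'a::euclidean_space \<Rightarrow> real"
  shows "open S \<Longrightarrow> smooth_on S f \<Longrightarrow> smooth_on S g \<Longrightarrow> (\<And>x. x \<in> S \<Longrightarrow> g x \<noteq> 0)
    \<Longrightarrow> smooth_on S (\<lambda>x. f x / g x)"
  unfolding divide_inverse
  by (intro smooth_on_mult; (assumption | simp only: smooth_on_def)?) (blast intro: Ck_on_inverse)

lemma smooth_on_has_derivative:
  assumes "open S" "smooth_on S g" "x \<in> S"
  shows "(g has_derivative frechet_derivative g (at x)) (at x)"
  using assms differentiable_on_eq_differentiable_at frechet_derivative_works
  unfolding smooth_on_def by (metis Ck_on.simps(2))

lemma smooth_on_subset: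
  assumes "open S" "open N" "N \<subseteq> S" "smooth_on S g"
  shows "smooth_on N g"
proof -
  have "Ck_on n N g" if "Ck_on n S g" for n
    using that
  proof (induction n arbitrary: g)
    case 0
    then show ?case using assms(3) continuous_on_subset by auto
  next
    case (Suc n)
    then show ?case using assms(3) differentiable_on_subset by auto
  qed
  then show ?thesis using assms(4) by (simp add: smooth_on_def)
qed

lemma smooth_on_continuous: "smooth_on S g \<Longrightarrow> continuous_on S g"
  unfolding smooth_on_def using Ck_on.simps(1) by blast

section \<open>Quaternions\<close>

lemmas quat_comps = prod_eq_iff vec_eq_iff forall_3 inner_vec_def sum_3 cross_components

lemma norm_quat: "(norm (q::quat))\<^sup>2 = (fst q)\<^sup>2 + (norm (snd q))\<^sup>2"
  by (simp add: norm_prod_def)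

lemma inner_quat: "p \<bullet> q = fst (qcnj p \<odot> q)"
  by (simp add: qmul_def qcnj_def inner_prod_def)

lemma qmul_assoc: "(p \<odot> q) \<odot> r = p \<odot> (q \<odot> r)"
  unfolding qmul_def by (simp add: quat_comps) (simp add: algebra_simps)

lemma qcnj_qmul: "qcnj (p \<odot> q) = qcnj q \<odot> qcnj p"
  unfolding qmul_def qcnj_def by (simp add: quat_comps algebra_simps)

lemma qcnj_qcnj [simp]: "qcnj (qcnj q) = q"
  by (simp add: qcnj_def)

lemma fst_qcnj [simp]: "fst (qcnj q) = fst q" and snd_qcnj [simp]: "snd (qcnj q) = - snd q"
  by (simp_all add: qcnj_def)

lemma qcnj_qi [simp]: "qcnj qi = - qi"
  by (simp add: qcnj_def qi_def)

lemma bounded_bilinear_qmul: "bounded_bilinear (\<odot>)"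
  unfolding bilinear_conv_bounded_bilinear[symmetric] bilinear_def qmul_def
  by (auto intro!: linearI simp: algebra_simps cross_add_left cross_add_right cross_mult_left cross_mult_right)

lemma bounded_linear_qcnj: "bounded_linear qcnj"
  unfolding linear_conv_bounded_linear[symmetric] qcnj_def
  by (auto intro!: linearI)

lemma smooth_on_qmul [smooth_intros]:
  "open S \<Longrightarrow> smooth_on S f \<Longrightarrow> smooth_on S g \<Longrightarrow> smooth_on S (\<lambda>x. f x \<odot> g x)"
  by (rule smooth_on_bilinear[OF _ bounded_bilinear_qmul])

lemmas qmul_linear = 
  bounded_bilinear.add_left[OF bounded_bilinear_qmul] bounded_bilinear.add_right[OF bounded_bilinear_qmul]
  bounded_bilinear.diff_left[OF bounded_bilinear_qmul] bounded_bilinear.diff_right[OF bounded_bilinear_qmul]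
  bounded_bilinear.minus_left[OF bounded_bilinear_qmul] bounded_bilinear.minus_right[OF bounded_bilinear_qmul]
  bounded_bilinear.scaleR_left[OF bounded_bilinear_qmul] bounded_bilinear.scaleR_right[OF bounded_bilinear_qmul]
  bounded_bilinear.zero_left[OF bounded_bilinear_qmul] bounded_bilinear.zero_right[OF bounded_bilinear_qmul]

lemma qmul_scalar: "(c, 0) \<odot> q = c *\<^sub>R q" "q \<odot> (c, 0) = c *\<^sub>R q"
  by (simp_all add: qmul_def prod_eq_iff)

lemma qmul_qcnj: "qcnj q \<odot> q = ((norm q)\<^sup>2, 0)" "q \<odot> qcnj q = ((norm q)\<^sup>2, 0)"
  by (simp_all only: norm_quat) (simp_all add: qmul_def prod_eq_iff dot_square_norm power2_eq_square)

lemma qi_qi: "qi \<odot> qi = (-1, 0)"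
  by (simp add: qmul_def qi_def inner_axis_axis)

text \<open>As rewrite rules for right-associated products these extract the squared norms, which are scalars.\<close>

lemma qmul_cancel: 
  "qcnj q \<odot> (q \<odot> r) = (norm q)\<^sup>2 *\<^sub>R r" "q \<odot> (qcnj q \<odot> r) = (norm q)\<^sup>2 *\<^sub>R r"
  "qi \<odot> (qi \<odot> r) = - r"
  unfolding qmul_assoc[symmetric] by (simp_all add: qmul_qcnj qmul_scalar qi_qi)

lemma norm_qmul: "norm (p \<odot> q) = norm p * norm q"
proof -
  have "((norm (p \<odot> q))\<^sup>2, 0) = ((norm p * norm q)\<^sup>2, 0 :: real^3)"
    unfolding qmul_qcnj(1)[symmetric] qcnj_qmul qmul_assoc qmul_cancel
    by (simp add: qmul_linear qmul_qcnj power_mult_distrib)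
  then have "(norm (p \<odot> q))\<^sup>2 = (norm p * norm q)\<^sup>2"
    by simp
  then show ?thesis
    by (simp add: power2_eq_iff_nonneg)
qed

lemma norm_imaginary: "norm (0 :: real, u) = norm u"
  by (simp add: norm_prod_def)

lemma norm_qcnj [simp]: "norm (qcnj q) = norm q"
  by (simp add: qcnj_def norm_prod_def)

lemma norm_qi [simp]: "norm qi = 1"
  by (simp add: qi_def norm_prod_def norm_axis_1)

lemma qmul_imaginary: "(0, u) \<odot> (0, v) = (- (u \<bullet> v), cross3 u v)"
  by (simp add: qmul_def)

lemma qmul_cancel_right:
  assumes "p \<odot> q = p' \<odot> q" "q \<noteq> 0"
  shows "p = p'"
proof -
  have "(norm q)\<^sup>2 *\<^sub>R p = (norm q)\<^sup>2 *\<^sub>R p'"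
    using arg_cong[OF assms(1), of "\<lambda>x. x \<odot> qcnj q"] by (simp add: qmul_assoc qmul_qcnj qmul_scalar)
  then show ?thesis using assms(2) by simp
qed

section \<open>Quadratic invariants of the circle action\<close>

text \<open>For a pair with vanishing \<open>bilin\<close> all products of the imaginary quaternions below are governed by
  the quaternion \<open>qcnj z \<odot> b\<close>, whose imaginary and real parts are, up to factors, the angular momentum
  and the scalar product of \<open>P\<close> and \<open>Q\<close>.\<close>

text \<open>\<open>ivec z z\<close> is the Hopf map, that is, the position of \<open>(z, w)\<close>.\<close>

definition ivec :: "quat \<Rightarrow> quat \<Rightarrow> real^3" where
  "ivec z b = snd (qcnj z \<odot> qi \<odot> b)"

text \<open>The center of the KS-ellipse is \<open>- evec z b / 2\<close>, and the center of an ellipse with a focus at the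
  origin lies opposite to the pericenter at distance \<open>a e\<close>.\<close>

definition evec :: "quat \<Rightarrow> quat \<Rightarrow> real^3" where
  "evec z b = - (ivec z z + ivec b b)"

text \<open>The conjugate of \<open>qcnj z \<odot> qi \<odot> z\<close> is its negative, because \<open>qi\<close> is imaginary.\<close>

lemma qmul_ivec_self: "qcnj z \<odot> qi \<odot> z = (0, ivec z z)"
proof -
  have "qcnj (qcnj z \<odot> qi \<odot> z) = - (qcnj z \<odot> qi \<odot> z)"
    by (simp add: qcnj_qmul qmul_assoc qmul_linear)
  then have "fst (qcnj z \<odot> qi \<odot> z) = 0"
    by (simp add: prod_eq_iff)
  then show ?thesis
    by (simp add: ivec_def prod_eq_iff)
qed

locale level_pair =
  fixes z b :: quat
  assumes level: "fst (qcnj z \<odot> qi \<odot> b) = 0"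
begin

abbreviation "A \<equiv> ivec z z"
abbreviation "B \<equiv> ivec b b"
abbreviation "C \<equiv> ivec z b"
abbreviation "E \<equiv> evec z b"
abbreviation "r \<equiv> fst (qcnj z \<odot> b)"
abbreviation "v \<equiv> snd (qcnj z \<odot> b)"

text \<open>The level condition makes \<open>qcnj z \<odot> qi \<odot> b\<close> imaginary, hence equal to minus its conjugate. The two
  factorizations of the same imaginary quaternion let \<open>z \<odot> qcnj z\<close>, \<open>b \<odot> qcnj b\<close> or \<open>qi \<odot> qi\<close> cancel in all of the
  products that follow.\<close>

lemma quat_C: "(0, C) = qcnj z \<odot> qi \<odot> b" "(0, C) = qcnj b \<odot> qi \<odot> z"
proof -
  show C: "(0, C) = qcnj z \<odot> qi \<odot> b"
    by (simp add: ivec_def prod_eq_iff level)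
  have "qcnj (qcnj z \<odot> qi \<odot> b) = - (qcnj b \<odot> qi \<odot> z)"
    by (simp add: qcnj_qmul qmul_assoc qmul_linear)
  then show "(0, C) = qcnj b \<odot> qi \<odot> z"
    unfolding C[symmetric] by (simp add: prod_eq_iff)
qed

lemma AC: "(0, A) \<odot> (0, C) = - ((norm z)\<^sup>2 *\<^sub>R (qcnj z \<odot> b))"
  unfolding quat_C(1) qmul_ivec_self[symmetric]
  by (simp add: qmul_assoc qmul_cancel qmul_linear)

lemma BC: "(0, B) \<odot> (0, C) = - ((norm b)\<^sup>2 *\<^sub>R (qcnj b \<odot> z))"
  unfolding quat_C(2) qmul_ivec_self[symmetric]
  by (simp add: qmul_assoc qmul_cancel qmul_linear)

lemma C_rho: "(0, C) \<odot> (qcnj z \<odot> b) = (norm z)\<^sup>2 *\<^sub>R (0, B)"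
  unfolding quat_C(2) qmul_ivec_self[symmetric]
  by (simp add: qmul_assoc qmul_cancel qmul_linear)

lemma C_rho': "(0, C) \<odot> (qcnj b \<odot> z) = (norm b)\<^sup>2 *\<^sub>R (0, A)"
  unfolding quat_C(1) qmul_ivec_self[symmetric]
  by (simp add: qmul_assoc qmul_cancel qmul_linear)

lemma A_rho: "(0, A) \<odot> (qcnj z \<odot> b) = (norm z)\<^sup>2 *\<^sub>R (0, C)"
  unfolding quat_C(1) qmul_ivec_self[symmetric]
  by (simp add: qmul_assoc qmul_cancel qmul_linear)

lemma B_rho: "(0, B) \<odot> (qcnj b \<odot> z) = (norm b)\<^sup>2 *\<^sub>R (0, C)"
  unfolding quat_C(2) qmul_ivec_self[symmetric]
  by (simp add: qmul_assoc qmul_cancel qmul_linear)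

text \<open>For \<open>z \<noteq> 0\<close> write \<open>B\<close> as a multiple of \<open>C \<odot> (qcnj z \<odot> b)\<close> and use the product of \<open>A\<close> and \<open>C\<close>.\<close>

lemma AB: "(0, A) \<odot> (0, B) = - ((qcnj z \<odot> b) \<odot> (qcnj z \<odot> b))"
proof (cases "z = 0")
  case True
  then have "(0, A) = (0::quat)" by (simp add: ivec_def qcnj_def qmul_def zero_prod_def)
  moreover have "(qcnj z \<odot> b) = 0" using True by (simp add: qcnj_def qmul_def zero_prod_def)
  ultimately show ?thesis by (simp only: qmul_linear minus_zero)
next
  case False
  have "(norm z)\<^sup>2 *\<^sub>R ((0, A) \<odot> (0, B)) = (0, A) \<odot> ((0, C) \<odot> (qcnj z \<odot> b))"
    by (simp only: C_rho qmul_linear)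
  also have "\<dots> = (norm z)\<^sup>2 *\<^sub>R (- ((qcnj z \<odot> b) \<odot> (qcnj z \<odot> b)))"
    by (simp only: AC qmul_linear flip: qmul_assoc) simp
  finally show ?thesis using False by (simp only: scaleR_cancel_left) simp
qed

lemma rho_conj: "qcnj b \<odot> z = (r, - v)"
  using qcnj_qmul[of "qcnj z" b] by (simp add: prod_eq_iff)

lemma rho_norm: "(norm z)\<^sup>2 * (norm b)\<^sup>2 = r\<^sup>2 + (norm v)\<^sup>2"
  using norm_quat[of "qcnj z \<odot> b"] by (simp add: norm_qmul power_mult_distrib)

lemma norm_A: "norm A = (norm z)\<^sup>2" and norm_B: "norm B = (norm b)\<^sup>2"
  using arg_cong[OF qmul_ivec_self[of z], of norm] arg_cong[OF qmul_ivec_self[of b], of norm]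
  by (simp_all only: norm_qmul norm_imaginary norm_qcnj norm_qi mult_1_right power2_eq_square)

lemma norm_C: "norm C = norm z * norm b"
  using arg_cong[OF quat_C(1), of norm]
  by (simp only: norm_qmul norm_imaginary norm_qcnj norm_qi mult_1_right)

lemma A_dot_C: "A \<bullet> C = (norm z)\<^sup>2 * r" and A_cross_C: "cross3 A C = - ((norm z)\<^sup>2 *\<^sub>R v)"
  using AC by (simp_all add: qmul_imaginary prod_eq_iff)

lemma B_dot_C: "B \<bullet> C = (norm b)\<^sup>2 * r" and B_cross_C: "cross3 B C = (norm b)\<^sup>2 *\<^sub>R v"
  using BC by (simp_all add: qmul_imaginary prod_eq_iff rho_conj)

lemma A_dot_B: "A \<bullet> B = r\<^sup>2 - (norm v)\<^sup>2"
  using arg_cong[OF AB, of fst] unfolding qmul_imaginary qmul_def[of "qcnj z \<odot> b"]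
  by (simp add: dot_square_norm power2_eq_square)

lemma A_dot_v: "A \<bullet> v = 0" and v_cross_A: "cross3 v A = r *\<^sub>R A - (norm z)\<^sup>2 *\<^sub>R C"
proof -
  have "(- (A \<bullet> v), r *\<^sub>R A + cross3 A v) = (0, (norm z)\<^sup>2 *\<^sub>R C)"
    using A_rho unfolding qmul_def[of "(0, A)"] by simp
  then have "A \<bullet> v = 0" "cross3 A v = (norm z)\<^sup>2 *\<^sub>R C - r *\<^sub>R A" by (auto simp: algebra_simps)
  then show "A \<bullet> v = 0" "cross3 v A = r *\<^sub>R A - (norm z)\<^sup>2 *\<^sub>R C"
    using cross_skew[of v A] by simp_all
qed

lemma B_dot_v: "B \<bullet> v = 0" and v_cross_B: "cross3 v B = (norm b)\<^sup>2 *\<^sub>R C - r *\<^sub>R B"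
proof -
  have "(B \<bullet> v, r *\<^sub>R B - cross3 B v) = (0, (norm b)\<^sup>2 *\<^sub>R C)"
    using B_rho unfolding qmul_def[of "(0, B)"] by (simp add: rho_conj)
  then have "B \<bullet> v = 0" "cross3 B v = r *\<^sub>R B - (norm b)\<^sup>2 *\<^sub>R C" by (auto simp: algebra_simps)
  then show "B \<bullet> v = 0" "cross3 v B = (norm b)\<^sup>2 *\<^sub>R C - r *\<^sub>R B"
    using cross_skew[of v B] by simp_all
qed

lemma E_dot_v: "E \<bullet> v = 0"
  by (simp add: evec_def inner_diff_left A_dot_v B_dot_v)

lemma two_r_C: "(2 * r) *\<^sub>R C = (norm z)\<^sup>2 *\<^sub>R B + (norm b)\<^sup>2 *\<^sub>R A"
proof -
  have "(0, C) \<odot> (qcnj z \<odot> b + qcnj b \<odot> z) = (0, (norm z)\<^sup>2 *\<^sub>R B + (norm b)\<^sup>2 *\<^sub>R A)"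
    by (simp only: qmul_linear C_rho C_rho') simp
  moreover have "qcnj z \<odot> b + qcnj b \<odot> z = (2 * r, 0)"
    by (simp add: rho_conj prod_eq_iff)
  ultimately show ?thesis
    by (simp add: qmul_scalar)
qed

text \<open>With \<open>2 a = norm z ^ 2 + norm b ^ 2\<close> these are \<open>(2 a e)\<^sup>2 = (2 a e cos u)\<^sup>2 + (2 a e sin u)\<^sup>2\<close> and
  \<open>e\<^sup>2 = 1 - (norm v / a)\<^sup>2\<close>; both follow from the scalar product of \<open>A\<close> and \<open>B\<close> and from
  the multiplicativity of the norm.\<close>

lemma norm_E: "(norm E)\<^sup>2 = ((norm b)\<^sup>2 - (norm z)\<^sup>2)\<^sup>2 + (2 * r)\<^sup>2"
  and norm_E': "(norm E)\<^sup>2 = ((norm z)\<^sup>2 + (norm b)\<^sup>2)\<^sup>2 - (2 * norm v)\<^sup>2"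
proof -
  have "(norm E)\<^sup>2 = (norm (A + B))\<^sup>2"
    by (simp only: evec_def norm_minus_cancel)
  also have "\<dots> = (norm A)\<^sup>2 + (norm B)\<^sup>2 + 2 * (A \<bullet> B)"
    by (simp add: power2_norm_eq_inner inner_add_left inner_add_right inner_commute)
  finally have *: "(norm E)\<^sup>2 = ((norm z)\<^sup>2)\<^sup>2 + ((norm b)\<^sup>2)\<^sup>2 + 2 * (r\<^sup>2 - (norm v)\<^sup>2)"
    by (simp add: norm_A norm_B A_dot_B)
  show "(norm E)\<^sup>2 = ((norm b)\<^sup>2 - (norm z)\<^sup>2)\<^sup>2 + (2 * r)\<^sup>2"
    "(norm E)\<^sup>2 = ((norm z)\<^sup>2 + (norm b)\<^sup>2)\<^sup>2 - (2 * norm v)\<^sup>2"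
    using * rho_norm by algebra+
qed

text \<open>The equation of the ellipse in the eccentric anomaly: \<open>evec z b\<close> points to the pericenter, and the
  first and second coefficient below are, up to normalization, \<open>cos u - e\<close> and \<open>sin u\<close>. The products of
  \<open>v\<close> with \<open>A\<close> and \<open>B\<close> involve \<open>C\<close>, which \<open>two_r_C\<close> eliminates after multiplication by \<open>r\<close>.\<close>

lemma A_in_apsidal_frame:
  "(2 * (norm E)\<^sup>2) *\<^sub>R A = 
     (((norm z)\<^sup>2 + (norm b)\<^sup>2) * ((norm b)\<^sup>2 - (norm z)\<^sup>2) - (norm E)\<^sup>2) *\<^sub>R E - (4 * r) *\<^sub>R cross3 v E"
proof -
  let ?x = "(norm z)\<^sup>2" and ?y = "(norm b)\<^sup>2"
  have "cross3 v E = - cross3 v A - cross3 v B"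
    by (simp add: evec_def cross_add_right Cross3.right_diff_distrib)
  also have "\<dots> = r *\<^sub>R (B - A) + (?x - ?y) *\<^sub>R C"
    by (simp add: v_cross_A v_cross_B algebra_simps)
  finally have "(4 * r) *\<^sub>R cross3 v E = (4 * r\<^sup>2) *\<^sub>R (B - A) + (2 * (?x - ?y)) *\<^sub>R ((2 * r) *\<^sub>R C)"
    by (simp only: scaleR_add_right scaleR_scaleR) (simp add: power2_eq_square mult_ac)
  also have "\<dots> = (4 * r\<^sup>2) *\<^sub>R (B - A) + (2 * (?x - ?y)) *\<^sub>R (?x *\<^sub>R B + ?y *\<^sub>R A)"
    by (simp only: two_r_C)
  finally have *: "(4 * r) *\<^sub>R cross3 v E = \<dots>" .
  show ?thesis
    unfolding * norm_E vec_eq_iff by (simp add: evec_def) algebra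
qed

end

section \<open>The circle action and the reduced form\<close>

lemma qexpi_add: "qexpi \<theta> \<odot> qexpi \<phi> = qexpi (\<theta> + \<phi>)"
  by (simp add: qexpi_def qmul_def cos_add sin_add inner_axis_axis algebra_simps)
    (simp add: cross_mult_left cross_mult_right flip: scaleR_add_left)

lemma qexpi_0 [simp]: "qexpi 0 = (1, 0)"
  by (simp add: qexpi_def)

lemma norm_qexpi [simp]: "norm (qexpi \<theta>) = 1"
  by (simp add: qexpi_def norm_prod_def norm_axis_1)

lemma qexpi_commute: "qexpi \<theta> \<odot> (qi \<odot> q) = qi \<odot> (qexpi \<theta> \<odot> q)"
  unfolding qmul_assoc[symmetric]
  by (rule arg_cong[of _ _ "\<lambda>x. x \<odot> q"])
    (simp add: qexpi_def qi_def qmul_def inner_axis_axis cross_mult_left cross_mult_right)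

lemma qexpi_cancel: "qcnj (qexpi \<theta>) \<odot> (qexpi \<theta> \<odot> q) = q"
  by (simp add: qmul_cancel)

lemma act_act: "act \<theta> (act \<phi> p) = act (\<theta> + \<phi>) p"
  by (simp add: act_def split_beta qexpi_add flip: qmul_assoc)

lemma act_0 [simp]: "act 0 p = p"
  by (simp add: act_def split_beta qmul_scalar)

lemma act_inverse [simp]: "act (- \<theta>) (act \<theta> p) = p" "act \<theta> (act (- \<theta>) p) = p"
  by (simp_all add: act_act)

lemma bounded_linear_act: "bounded_linear (act \<theta>)"
  unfolding linear_conv_bounded_linear[symmetric]
  by (rule linearI) (simp_all add: act_def split_beta qmul_linear prod_eq_iff)

lemma act_linear: "act \<theta> (X + Y) = act \<theta> X + act \<theta> Y" "act \<theta> (s *\<^sub>R X) = s *\<^sub>R act \<theta> X"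
  by (simp_all add: linear_add linear_scale bounded_linear.linear bounded_linear_act)

lemma vert_act: "vert (act \<theta> p) = act \<theta> (vert p)"
  by (simp add: vert_def act_def split_beta qexpi_commute)

lemma act_has_derivative: "((\<lambda>t. act t p) has_vector_derivative vert p) (at 0)"
proof -
  have "(qexpi has_derivative (\<lambda>t. t *\<^sub>R qi)) (at 0)"
    unfolding qexpi_def[abs_def] qi_def
    by (auto intro!: derivative_eq_intros)
  from has_derivative_Pair[OF bounded_bilinear.FDERIV[OF bounded_bilinear_qmul this has_derivative_const]
      bounded_bilinear.FDERIV[OF bounded_bilinear_qmul this has_derivative_const], of "fst p" "snd p"]
  show ?thesis
    by (simp add: has_vector_derivative_def act_def split_beta vert_def qmul_linear)
qed

lemma act_invariant_products:
  "qcnj (fst (act \<theta> p)) \<odot> snd (act \<theta> q) = qcnj (fst p) \<odot> snd q"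
  "qcnj (snd (act \<theta> p)) \<odot> fst (act \<theta> q) = qcnj (snd p) \<odot> fst q"
  "qcnj (fst (act \<theta> p)) \<odot> qi \<odot> fst (act \<theta> q) = qcnj (fst p) \<odot> qi \<odot> fst q"
  "qcnj (fst (act \<theta> p)) \<odot> qi \<odot> snd (act \<theta> q) = qcnj (fst p) \<odot> qi \<odot> snd q"
  "qcnj (snd (act \<theta> p)) \<odot> qi \<odot> snd (act \<theta> q) = qcnj (snd p) \<odot> qi \<odot> snd q"
  by (simp_all add: act_def split_beta qcnj_qmul qmul_assoc qexpi_cancel flip: qexpi_commute)

lemma norm_act: "norm (fst (act \<theta> p)) = norm (fst p)"
  by (simp add: act_def split_beta norm_qmul)

lemma bilin_eq: "bilin p = fst (qcnj (fst p) \<odot> qi \<odot> snd p)"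
  by (simp add: bilin_def split_beta)

lemma Sigma0_iff: "p \<in> Sigma0 \<longleftrightarrow> p \<noteq> 0 \<and> bilin p = 0"
  by (simp add: Sigma0_def zero_prod_def)

lemma act_zero_iff: "act \<theta> p = 0 \<longleftrightarrow> p = 0"
  by (metis act_inverse(1) act_linear(2) scale_zero_left)

lemma act_Sigma0: "act \<theta> p \<in> Sigma0 \<longleftrightarrow> p \<in> Sigma0"
  by (simp add: Sigma0_iff act_zero_iff bilin_eq act_invariant_products)

lemma proj_act: "proj (act \<theta> p) = proj p"
proof -
  have "act \<phi> p = act (\<phi> - \<theta>) (act \<theta> p)" "act \<phi> (act \<theta> p) = act (\<phi> + \<theta>) p" for \<phi>
    by (simp_all add: act_act)
  then show ?thesis
    unfolding proj_def by (metis (no_types, lifting) image_cong subset_antisym subsetI rangeE rangeI)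
qed

lemma self_in_proj: "p \<in> proj p"
  unfolding proj_def by (rule range_eqI[of _ _ 0]) simp

lemma proj_eq_iff: "proj p = proj q \<longleftrightarrow> (\<exists>\<theta>. q = act \<theta> p)"
proof
  assume "proj p = proj q"
  then have "q \<in> proj p" using self_in_proj by simp
  then show "\<exists>\<theta>. q = act \<theta> p" by (auto simp: proj_def)
qed (auto simp: proj_act)

lemma omega_inner: "omega X Y = snd X \<bullet> fst Y - snd Y \<bullet> fst X"
  by (simp add: omega_def inner_quat)

lemma omega_act: "omega (act \<theta> X) (act \<theta> Y) = omega X Y"
  by (simp add: omega_def act_invariant_products)

lemma omega_linear:
  "omega (X + X') Y = omega X Y + omega X' Y" "omega Y (X + X') = omega Y X + omega Y X'"
  "omega (s *\<^sub>R X) Y = s * omega X Y" "omega Y (s *\<^sub>R X) = s * omega Y X"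
  by (simp_all add: omega_inner inner_add_left inner_add_right algebra_simps)

lemma omega_skew: "omega X Y = - omega Y X"
  by (simp add: omega_def)

text \<open>\<open>bilin\<close> is the moment map of the circle action: its differential is the contraction of \<open>omega\<close> with
  the generator \<open>vert\<close>. So the tangent space of the level set is the symplectic complement of \<open>vert\<close>.\<close>

lemma bilin_has_derivative: "(bilin has_derivative (\<lambda>X. - omega X (vert p))) (at p)"
proof -
  have "((\<lambda>p. qcnj (fst p) \<odot> qi) has_derivative (\<lambda>X. qcnj (fst X) \<odot> qi)) (at p)"
    by (rule bounded_linear.has_derivative[OF bounded_bilinear.bounded_linear_left[OF bounded_bilinear_qmul]
          bounded_linear.has_derivative[OF bounded_linear_qcnj has_derivative_fst[OF has_derivative_ident]]])
  from has_derivative_fst[OF bounded_bilinear.FDERIV[OF bounded_bilinear_qmul this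
        has_derivative_snd[OF has_derivative_ident]]]
  have "((\<lambda>p. fst (qcnj (fst p) \<odot> qi \<odot> snd p)) has_derivative 
      (\<lambda>X. fst (qcnj (fst p) \<odot> qi \<odot> snd X + qcnj (fst X) \<odot> qi \<odot> snd p))) (at p)" .
  moreover have "fst (qcnj (fst p) \<odot> qi \<odot> snd X + qcnj (fst X) \<odot> qi \<odot> snd p) = - omega X (vert p)" for X
    using fst_qcnj[of "qcnj (fst p) \<odot> qi \<odot> snd X"] fst_qcnj[of "qcnj (fst X) \<odot> qi \<odot> snd p"]
    by (simp add: omega_def vert_def qcnj_qmul qmul_linear qmul_assoc)
  ultimately show ?thesis
    by (simp add: bilin_eq[abs_def])
qed

lemma tangent_iff: "X \<in> tangent p \<longleftrightarrow> omega X (vert p) = 0"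
  using frechet_derivative_at[OF bilin_has_derivative[of p], symmetric] by (simp add: tangent_def)

lemma vert_tangent: "vert p \<in> tangent p"
  by (simp add: tangent_iff omega_def)

lemma vert_nonzero: "p \<noteq> 0 \<Longrightarrow> vert p \<noteq> 0"
proof (erule contrapos_nn)
  assume "vert p = 0"
  then have "qi \<odot> fst p = 0" "qi \<odot> snd p = 0" by (simp_all add: vert_def zero_prod_def)
  then show "p = 0"
    using norm_qmul[of qi "fst p"] norm_qmul[of qi "snd p"] by (simp add: prod_eqI)
qed

text \<open>The action is free, so two lifts of the same pair of classes differ by one rotation of both vectors,
  up to vertical vectors; and vertical vectors are in the kernel of \<open>omega\<close> restricted to the tangent
  space.\<close>

lemma omega1_dproj:
  assumes p: "p \<in> Sigma0" and X: "X \<in> tangent p" and Y: "Y \<in> tangent p"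
  shows "omega1 (dproj p X) (dproj p Y) = omega X Y"
proof -
  have unique: "omega X' Y' = omega X Y"
    if eq: "dproj p X = dproj p' X'" "dproj p Y = dproj p' Y'" for p' X' Y'
  proof -
    have "(p', Z) \<in> dproj p' Z" for Z
      unfolding dproj_def by (rule CollectI, rule exI[of _ 0], rule exI[of _ 0]) simp
    then have "(p', X') \<in> dproj p X" "(p', Y') \<in> dproj p Y" 
      using eq by simp_all
    then obtain \<theta> s \<phi> t where 
      *: "p' = act \<theta> p" "X' = act \<theta> X + s *\<^sub>R vert (act \<theta> p)"
        "p' = act \<phi> p" "Y' = act \<phi> Y + t *\<^sub>R vert (act \<phi> p)"
      unfolding dproj_def by blast
    have "qexpi \<theta> \<odot> fst p = qexpi \<phi> \<odot> fst p" "qexpi \<theta> \<odot> snd p = qexpi \<phi> \<odot> snd p"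
      using *(1,3) by (simp_all add: act_def split_beta)
    moreover have "fst p \<noteq> 0 \<or> snd p \<noteq> 0"
      using p by (auto simp: Sigma0_iff prod_eq_iff)
    ultimately have "qexpi \<theta> = qexpi \<phi>"
      by (elim disjE) (rule qmul_cancel_right; simp)+
    then have "act \<theta> = act \<phi>" 
      by (simp add: act_def)
    then have "X' = act \<theta> (X + s *\<^sub>R vert p)" "Y' = act \<theta> (Y + t *\<^sub>R vert p)"
      by (simp_all add: *(2,4) vert_act act_linear)
    moreover have "omega X (vert p) = 0" "omega (vert p) Y = 0" "omega (vert p) (vert p) = 0"
      using X Y vert_tangent[of p] omega_skew[of "vert p" Y] by (simp_all add: tangent_iff)
    ultimately show ?thesis
      by (simp add: omega_act omega_linear)
  qed
  show ?thesis
    unfolding omega1_def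
  proof (rule the_equality)
    show "\<exists>p'\<in>Sigma0. \<exists>X'\<in>tangent p'. \<exists>Y'\<in>tangent p'.
        dproj p X = dproj p' X' \<and> dproj p Y = dproj p' Y' \<and> omega X Y = omega X' Y'"
      using assms by blast
  next
    fix s
    assume "\<exists>p'\<in>Sigma0. \<exists>X'\<in>tangent p'. \<exists>Y'\<in>tangent p'.
        dproj p X = dproj p' X' \<and> dproj p Y = dproj p' Y' \<and> s = omega X' Y'"
    then show "s = omega X Y"
      using unique by metis
  qed
qed

lemma wedge_form_nondegenerate:
  assumes "\<And>W. wedge_form V W = 0"
  shows "V = 0"
proof -
  obtain l d g c h s where V: "V = (l, d, g, c, h, s)" by (cases V)
  show ?thesis
    using assms[of "(1,0,0,0,0,0)"] assms[of "(0,1,0,0,0,0)"] assms[of "(0,0,1,0,0,0)"]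
      assms[of "(0,0,0,1,0,0)"] assms[of "(0,0,0,0,1,0)"] assms[of "(0,0,0,0,0,1)"]
    by (simp add: wedge_form_def V zero_prod_def)
qed

text \<open>A linear map \<open>T\<close> which pulls \<open>omega\<close> back to a non-degenerate form is injective and its range does
  not contain the vertical direction. As the tangent space has dimension 7, the range and the vertical
  direction span it.\<close>

lemma tangent_decomposition:
  assumes p: "p \<noteq> 0" and T: "linear T" and tan: "\<And>V. T V \<in> tangent p" 
    and form: "\<And>V W. omega (T V) (T W) = wedge_form V W" and X: "X \<in> tangent p"
  obtains V s where "X = T V + s *\<^sub>R vert p"
proof -
  define F where "F = (\<lambda>Vs :: real6 \<times> real. T (fst Vs) + snd Vs *\<^sub>R vert p)"
  have F: "linear F"
    unfolding F_def using T by (intro linearI) (simp_all add: linear_add linear_scale algebra_simps)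
  have "inj F"
    unfolding linear_injective_0[OF F]
  proof (intro allI impI)
    fix Vs assume "F Vs = 0"
    then obtain V s where Vs: "Vs = (V, s)" and 0: "T V + s *\<^sub>R vert p = 0"
      by (cases Vs) (auto simp: F_def)
    have "wedge_form V W = 0" for W
    proof -
      have "omega (T V + s *\<^sub>R vert p) (T W) = 0"
        unfolding 0 by (simp add: omega_inner)
      then show ?thesis
        using tan[of W] omega_skew[of "vert p" "T W"] by (simp add: omega_linear form tangent_iff)
    qed
    then have "V = 0" by (rule wedge_form_nondegenerate)
    with 0 have "s = 0"
      using vert_nonzero[OF p] T by (simp add: linear_0)
    with \<open>V = 0\<close> show "Vs = 0" by (simp add: Vs zero_prod_def)
  qed
  define a where "a = (- snd (vert p), fst (vert p))"
  have "a \<bullet> X = omega X (vert p)" for X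
    by (cases X) (simp add: a_def omega_inner inner_commute)
  then have tangent_eq: "tangent p = {X. a \<bullet> X = 0}"
    by (simp add: tangent_iff set_eq_iff)
  have "a \<noteq> 0"
    using vert_nonzero[OF p] by (auto simp: a_def prod_eq_iff)
  then have "dim (tangent p) = 7"
    unfolding tangent_eq by (simp add: dim_hyperplane)
  moreover have "dim (range F) = 7"
    using dim_image_eq[OF F, of UNIV] \<open>inj F\<close> by simp
  moreover have sub: "subspace (tangent p)"
    unfolding tangent_eq by (rule subspace_hyperplane)
  moreover have "F Vs \<in> tangent p" for Vs
    using subspace_add[OF sub tan subspace_scale[OF sub vert_tangent]] by (simp add: F_def)
  then have "range F \<subseteq> tangent p" by blast
  ultimately have "range F = tangent p"
    using subspace_dim_equal[of "range F" "tangent p"] linear_subspace_image[OF F subspace_UNIV]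
    by simp
  with X obtain Vs where "X = F Vs" by blast
  then show ?thesis using that[of "fst Vs" "snd Vs"] by (simp add: F_def)
qed

section \<open>KS-ellipses\<close>

text \<open>Five points decide whether the ellipse with center \<open>x\<close> and conjugate half diameters \<open>u\<close>, \<open>v\<close> lies
  on a sphere centered at the origin.\<close>

lemma circle_in_sphere:
  fixes x u v :: "'a::real_inner"
  assumes "(x + u) \<bullet> (x + u) = R" "(x - u) \<bullet> (x - u) = R" "(x + v) \<bullet> (x + v) = R" "(x - v) \<bullet> (x - v) = R"
    and "(x + (sqrt 2 / 2) *\<^sub>R (u + v)) \<bullet> (x + (sqrt 2 / 2) *\<^sub>R (u + v)) = R"
  shows "u \<bullet> u = v \<bullet> v" "u \<bullet> v = 0"
proof -
  have xu: "x \<bullet> u = 0" and xv: "x \<bullet> v = 0"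
    using assms(1-4) by (simp_all add: inner_diff_left inner_diff_right inner_add_left inner_add_right
        inner_commute)
  then have uu: "x \<bullet> x + u \<bullet> u = R" and vv: "x \<bullet> x + v \<bullet> v = R"
    using assms(1,3) by (simp_all add: inner_add_left inner_add_right inner_commute)
  then show "u \<bullet> u = v \<bullet> v" by simp
  define w where "w = u + v"
  have "x \<bullet> w = 0" "w \<bullet> w = u \<bullet> u + v \<bullet> v + 2 * (u \<bullet> v)"
    using xu xv by (simp_all add: w_def inner_add_left inner_add_right inner_commute)
  moreover have "(x + s *\<^sub>R w) \<bullet> (x + s *\<^sub>R w) = x \<bullet> x + 2 * s * (x \<bullet> w) + s * s * (w \<bullet> w)" for s
    by (simp add: inner_add_left inner_add_right inner_commute)
  note this[of "sqrt 2 / 2", unfolded assms(5)[folded w_def]]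
  ultimately show "u \<bullet> v = 0"
    using uu vv by simp
qed

context level_pair
begin

text \<open>The physical trajectory is the image of a harmonic oscillation under a quadratic map, so it runs through
  an ellipse at twice the frequency.\<close>

definition ell :: "real \<Rightarrow> real^3" where
  "ell t = ivec (cos t *\<^sub>R z + sin t *\<^sub>R b) (cos t *\<^sub>R z + sin t *\<^sub>R b)"

lemma ell_eq: "ell t = (cos t)\<^sup>2 *\<^sub>R A + (sin t)\<^sup>2 *\<^sub>R B + (2 * sin t * cos t) *\<^sub>R C"
proof -
  have "ivec b z = C"
    using quat_C(2) by (simp add: ivec_def prod_eq_iff)
  moreover have "ell t = (cos t)\<^sup>2 *\<^sub>R A + (sin t)\<^sup>2 *\<^sub>R B + (sin t * cos t) *\<^sub>R (C + ivec b z)"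
    unfolding ell_def ivec_def 
    by (simp add: qmul_linear linear_add linear_scale bounded_linear.linear bounded_linear_qcnj
        power2_eq_square algebra_simps)
  ultimately show ?thesis by (simp add: vec_eq_iff)
qed

lemma ell_center: "ell t = - (1/2) *\<^sub>R E + (cos (2 * t) / 2) *\<^sub>R (A - B) + sin (2 * t) *\<^sub>R C"
proof -
  have "(cos t)\<^sup>2 = (1 + cos (2 * t)) / 2" "(sin t)\<^sup>2 = (1 - cos (2 * t)) / 2"
    using cos_double_cos[of t] cos_double_sin[of t] by simp_all
  then show ?thesis
    by (simp only: ell_eq sin_double evec_def) (simp add: vec_eq_iff field_simps)
qed

lemma ell_points: 
  "ell 0 = - (1/2) *\<^sub>R E + (1/2) *\<^sub>R (A - B)" "ell (pi/2) = - (1/2) *\<^sub>R E - (1/2) *\<^sub>R (A - B)"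
  "ell (pi/4) = - (1/2) *\<^sub>R E + C" "ell (-pi/4) = - (1/2) *\<^sub>R E - C"
  "ell (pi/8) = - (1/2) *\<^sub>R E + (sqrt 2 / 4) *\<^sub>R (A - B) + (sqrt 2 / 2) *\<^sub>R C"
  by (simp_all add: ell_center cos_45 sin_45)

text \<open>The half diameters of the ellipse are \<open>(A - B) / 2\<close> and \<open>C\<close>, and their vector product is a negative
  multiple of \<open>v\<close>. If \<open>v\<close> vanishes, then \<open>B\<close> and \<open>C\<close> are multiples of \<open>A\<close>, unless \<open>z = 0\<close>, where only \<open>B\<close> remains.\<close>

lemma collinear_ell: "collinear (range ell) \<longleftrightarrow> v = 0"
proof
  assume "collinear (range ell)"
  then obtain u where u: "\<And>s t. \<exists>c. ell s - ell t = c *\<^sub>R u"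
    unfolding collinear_def by blast
  from u[of 0 "pi/2"] u[of "pi/4" "-pi/4"] obtain c d where "A - B = c *\<^sub>R u" "2 *\<^sub>R C = d *\<^sub>R u"
    unfolding ell_points by (auto simp: scaleR_2 simp flip: scaleR_add_left)
  then have "cross3 (A - B) (2 *\<^sub>R C) = 0"
    by (simp add: cross_mult_left cross_mult_right)
  moreover define k where "k = (norm z)\<^sup>2 + (norm b)\<^sup>2"
  have "cross3 (A - B) (2 *\<^sub>R C) = (- 2 * k) *\<^sub>R v"
    unfolding cross_mult_right Cross3.left_diff_distrib A_cross_C B_cross_C k_def
    by (simp add: vec_eq_iff algebra_simps)
  ultimately have "k = 0 \<or> v = 0"
    by simp
  then have "z = 0 \<or> v = 0"
    using sum_power2_eq_zero_iff[of "norm z" "norm b"] by (auto simp: k_def)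
  then show "v = 0"
    by (auto simp: qcnj_def qmul_def)
next
  assume v: "v = 0"
  show "collinear (range ell)"
  proof (cases "z = 0")
    case True
    then have "A = 0" "C = 0"
      by (simp_all add: ivec_def qcnj_def qmul_def zero_prod_def)
    then have "ell t = (sin t)\<^sup>2 *\<^sub>R B" for t
      unfolding ell_eq by simp
    then show ?thesis
      unfolding collinear_def by (auto intro!: exI[of _ B] simp flip: scaleR_diff_left)
  next
    case False
    obtain q where rho: "qcnj z \<odot> b = (q, 0)" using v by (metis prod.collapse)
    define k where "k = q / (norm z)\<^sup>2"
    have "(norm z)\<^sup>2 *\<^sub>R C = q *\<^sub>R A" "(norm z)\<^sup>2 *\<^sub>R B = q *\<^sub>R C"
      using A_rho C_rho unfolding rho by (simp_all add: qmul_scalar)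
    then have "(1 / (norm z)\<^sup>2) *\<^sub>R ((norm z)\<^sup>2 *\<^sub>R C) = k *\<^sub>R A" "(1 / (norm z)\<^sup>2) *\<^sub>R ((norm z)\<^sup>2 *\<^sub>R B) = k *\<^sub>R C"
      by (simp_all add: k_def)
    then have "C = k *\<^sub>R A" "B = (k * k) *\<^sub>R A" 
      using False by simp_all
    then have "ell t = ((cos t)\<^sup>2 + (sin t)\<^sup>2 * (k * k) + 2 * sin t * cos t * k) *\<^sub>R A" for t
      by (simp only: ell_eq) (simp add: algebra_simps)
    then show ?thesis
      unfolding collinear_def by (auto intro!: exI[of _ A] simp flip: scaleR_diff_left)
  qed
qed

text \<open>A planar ellipse on a sphere is a circle: the half diameters are orthogonal and of the same length. By
  the product formulas this says \<open>(norm z ^ 2 - norm b ^ 2) r = 0\<close> and \<open>(norm z ^ 2 - norm b ^ 2) ^ 2 = (2 r) ^ 2\<close>,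
  so that both quantities vanish, and with them \<open>E\<close> by \<open>norm_E\<close>. Conversely the distance to the origin is
  then constant along the trajectory.\<close>

lemma sphere_ell: "(\<exists>c R. range ell \<subseteq> sphere c R) \<longleftrightarrow> E = 0"
proof
  assume "\<exists>c R. range ell \<subseteq> sphere c R"
  then obtain c R where R: "\<And>t. norm (ell t - c) = R"
    by (metis dist_norm mem_sphere norm_minus_commute rangeI subset_iff)
  define O' where "O' = - (1/2) *\<^sub>R E - c"
  have inner: "(ell t - c) \<bullet> (ell t - c) = R\<^sup>2" for t
    using R[of t] by (simp add: dot_square_norm)
  have pts: "ell 0 - c = O' + (1/2) *\<^sub>R (A - B)" "ell (pi/2) - c = O' - (1/2) *\<^sub>R (A - B)"
    "ell (pi/4) - c = O' + C" "ell (-pi/4) - c = O' - C"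
    "ell (pi/8) - c = O' + ((sqrt 2 / 4) *\<^sub>R (A - B) + (sqrt 2 / 2) *\<^sub>R C)"
    unfolding ell_points O'_def by (simp_all add: algebra_simps)
  let ?U = "(1/2) *\<^sub>R (A - B)"
  have 8: "ell (pi/8) - c = O' + (sqrt 2 / 2) *\<^sub>R (?U + C)"
    unfolding pts by (simp add: algebra_simps)
  note conds = circle_in_sphere[OF inner[of 0, unfolded pts] inner[of "pi/2", unfolded pts]
      inner[of "pi/4", unfolded pts] inner[of "-pi/4", unfolded pts] inner[of "pi/8", unfolded 8]]
  have eq: "?U \<bullet> ?U = C \<bullet> C" and UC: "?U \<bullet> C = 0"
    using conds by simp_all
  let ?x = "(norm z)\<^sup>2" and ?y = "(norm b)\<^sup>2"
  have "(?x - ?y) * r = 0"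
    using UC by (simp add: inner_diff_left A_dot_C B_dot_C algebra_simps)
  moreover have "(?x - ?y)\<^sup>2 = (2 * r)\<^sup>2"
  proof -
    have "(A - B) \<bullet> (A - B) = 4 * (C \<bullet> C)"
      using eq by (simp only: inner_scaleR_left inner_scaleR_right)
    moreover have "(A - B) \<bullet> (A - B) = ?x\<^sup>2 + ?y\<^sup>2 - 2 * (r\<^sup>2 - (norm v)\<^sup>2)"
      unfolding inner_diff_left inner_diff_right inner_commute[of B A] A_dot_B
      by (simp add: dot_square_norm norm_A norm_B)
    moreover have "C \<bullet> C = ?x * ?y"
      by (simp only: dot_square_norm norm_C power_mult_distrib)
    ultimately have "?x\<^sup>2 + ?y\<^sup>2 - 2 * (r\<^sup>2 - (norm v)\<^sup>2) = 4 * (?x * ?y)"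
      by simp
    with rho_norm show ?thesis by algebra
  qed
  ultimately have "?x - ?y = 0" "r = 0" by auto
  then have "(norm E)\<^sup>2 = 0" unfolding norm_E by (simp add: algebra_simps)
  then show "E = 0" by simp
next
  assume "E = 0"
  then have "((norm b)\<^sup>2 - (norm z)\<^sup>2)\<^sup>2 + (2 * r)\<^sup>2 = 0" 
    using norm_E by simp
  then have "(norm b)\<^sup>2 - (norm z)\<^sup>2 = 0" "2 * r = 0"
    unfolding sum_power2_eq_zero_iff by blast+
  then have eq: "(norm b)\<^sup>2 = (norm z)\<^sup>2" "z \<bullet> b = 0"
    by (simp_all add: inner_quat)
  have "norm (ell t) = (norm z)\<^sup>2" for t
  proof -
    have "norm (ell t) = (norm (cos t *\<^sub>R z + sin t *\<^sub>R b))\<^sup>2"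
      using arg_cong[OF qmul_ivec_self[of "cos t *\<^sub>R z + sin t *\<^sub>R b"], of norm]
      by (simp only: ell_def norm_qmul norm_imaginary norm_qcnj norm_qi mult_1_right power2_eq_square)
    also have "\<dots> = (cos t)\<^sup>2 * (norm z)\<^sup>2 + (sin t)\<^sup>2 * (norm b)\<^sup>2"
      using eq(2) unfolding power2_norm_eq_inner
      by (simp add: inner_add_left inner_add_right inner_commute[of b z] power2_eq_square)
    finally show ?thesis
      by (simp add: eq(1) flip: distrib_right)
  qed
  then show "\<exists>c R. range ell \<subseteq> sphere c R"
    by (intro exI[of _ 0] exI[of _ "(norm z)\<^sup>2"]) auto
qed

text \<open>The plane of the ellipse is orthogonal to \<open>v\<close>.\<close>

lemma horizontal_ell: 
  assumes v: "v \<noteq> 0"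
  shows "range ell \<subseteq> {x. x $ 3 = 0} \<longleftrightarrow> cross3 (axis 3 1) v = 0"
proof -
  have z: "(norm z)\<^sup>2 \<noteq> 0" using v by (auto simp: qcnj_def qmul_def)
  have e3: "cross3 (axis 3 1) v = 0 \<longleftrightarrow> v $ 1 = 0 \<and> v $ 2 = 0"
    by (auto simp: vec_eq_iff forall_3 cross_components axis_def)
  show ?thesis
    unfolding e3
  proof
    assume *: "range ell \<subseteq> {x. x $ 3 = 0}"
    then have "ell 0 $ 3 = 0" "ell (pi/4) $ 3 = 0" "ell (-pi/4) $ 3 = 0" by auto
    then have "A $ 3 = 0" "C $ 3 = 0"
      unfolding ell_points by (simp_all add: evec_def)
    then have "cross3 A C $ 1 = 0" "cross3 A C $ 2 = 0"
      by (simp_all add: cross_components)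
    then show "v $ 1 = 0 \<and> v $ 2 = 0"
      using z by (simp add: A_cross_C)
  next
    assume *: "v $ 1 = 0 \<and> v $ 2 = 0"
    then have "v $ 3 \<noteq> 0" using v by (auto simp: vec_eq_iff forall_3)
    then have 1: "A $ 3 = 0" "B $ 3 = 0" 
      using A_dot_v B_dot_v * by (simp_all add: inner_vec_def sum_3)
    have "((norm z)\<^sup>2 *\<^sub>R C) $ 3 = (r *\<^sub>R A - cross3 v A) $ 3"
      by (simp add: v_cross_A)
    then have "C $ 3 = 0" using z 1 * by (simp add: cross_components)
    with 1 show "range ell \<subseteq> {x. x $ 3 = 0}" 
      by (auto simp: ell_eq)
  qed
qed

end

locale kepler =
  fixes \<mu> M f :: real
  assumes pos: "\<mu> > 0" "M > 0" "f > 0"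
begin

text \<open>With \<open>m\<close> as unit of momentum the two quadratic terms of the Hamiltonian get the same coefficient, and
  \<open>(z, vel)\<close> rotates with frequency \<open>freq\<close>.\<close>

definition m :: real where "m = 2 * sqrt (2 * f * \<mu>)"

definition freq :: real where "freq = sqrt (f / (2 * \<mu>))"

definition vel :: "qpair \<Rightarrow> quat" where "vel p = (1 / m) *\<^sub>R snd p"

lemma m_pos: "m > 0" and freq_pos: "freq > 0"
  using pos by (simp_all add: m_def freq_def)

lemma m_sq: "m\<^sup>2 = 8 * f * \<mu>"
  using pos by (simp add: m_def power_mult_distrib)

lemma m_freq: "m = 4 * \<mu> * freq" "2 * f = m * freq"
proof -
  have sq: "m\<^sup>2 = (4 * \<mu> * freq)\<^sup>2" "(2 * f)\<^sup>2 = (m * freq)\<^sup>2"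
    unfolding power_mult_distrib m_sq using pos by (simp_all add: freq_def power2_eq_square)
  show "m = 4 * \<mu> * freq" "2 * f = m * freq"
    by (rule power2_eq_imp_eq[OF sq(1)], use pos m_pos freq_pos in simp_all)
      (rule power2_eq_imp_eq[OF sq(2)], use pos m_pos freq_pos in simp_all)
qed

lemma level_pair_Sigma0: "p \<in> Sigma0 \<Longrightarrow> level_pair (fst p) (vel p)"
  by (simp add: level_pair_def Sigma0_iff bilin_eq vel_def qmul_linear)

lemma vel_act: "vel (act \<theta> p) = qexpi \<theta> \<odot> vel p"
  by (simp add: vel_def act_def split_beta qmul_linear)

lemma fst_act: "fst (act \<theta> p) = qexpi \<theta> \<odot> fst p"
  by (simp add: act_def split_beta)

lemma ivec_act: "ivec (qexpi \<theta> \<odot> z) (qexpi \<theta> \<odot> b) = ivec z b"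
  by (simp add: ivec_def qcnj_qmul qmul_assoc qexpi_cancel flip: qexpi_commute)

lemma ham_K_has_derivative:
  "(ham_K \<mu> M f has_derivative (\<lambda>Y. snd p \<bullet> snd Y / (4 * \<mu>) + 2 * f * (fst p \<bullet> fst Y))) (at p)"
proof -
  have "ham_K \<mu> M f = (\<lambda>p. snd p \<bullet> snd p / (8 * \<mu>) + f * (fst p \<bullet> fst p) - \<mu> * M)"
    by (auto simp: ham_K_def dot_square_norm)
  then show ?thesis
    using pos by (auto intro!: derivative_eq_intros simp: inner_commute field_simps)
qed

lemma K_orbit_iff:
  "K_orbit \<mu> M f c \<longleftrightarrow> 
     (\<forall>t. (c has_vector_derivative (freq *\<^sub>R vel (c t), - (m * freq) *\<^sub>R fst (c t))) (at t))"
proof -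
  have *: "(\<forall>Y. frechet_derivative (ham_K \<mu> M f) (at p) Y = omega Y X) \<longleftrightarrow>
      X = (freq *\<^sub>R vel p, - (m * freq) *\<^sub>R fst p)" for p X
  proof -
    have d: "frechet_derivative (ham_K \<mu> M f) (at p) = (\<lambda>Y. snd p \<bullet> snd Y / (4 * \<mu>) + 2 * f * (fst p \<bullet> fst Y))"
      using frechet_derivative_at[OF ham_K_has_derivative] by simp
    let ?X = "(freq *\<^sub>R vel p, - (m * freq) *\<^sub>R fst p)"
    have "snd p \<bullet> snd Y / (4 * \<mu>) + 2 * f * (fst p \<bullet> fst Y) = omega Y ?X" for Y
    proof -
      have "freq * (1 / m) = 1 / (4 * \<mu>)"
        using pos freq_pos by (simp add: m_freq(1))
      then have "freq *\<^sub>R vel p = (1 / (4 * \<mu>)) *\<^sub>R snd p"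
        by (simp only: vel_def scaleR_scaleR)
      then show ?thesis
        by (simp add: omega_inner m_freq(2) inner_commute)
    qed
    moreover have "X = ?X" if *: "\<And>Y. omega Y ?X = omega Y X"
    proof -
      have "fst ?X = fst X" "snd ?X = snd X"
        using *[of "(0, Z)" for Z] *[of "(Z, 0)" for Z] vector_eq_ldot[of "fst ?X" "fst X"] 
          vector_eq_rdot[of "snd ?X" "snd X"] by (simp_all add: omega_inner)
      then show ?thesis by (simp add: prod_eq_iff)
    qed
    ultimately show ?thesis unfolding d by auto
  qed
  show ?thesis unfolding K_orbit_def * by blast
qed

definition flow :: "qpair \<Rightarrow> real \<Rightarrow> qpair" where
  "flow p t = (cos (freq * t) *\<^sub>R fst p + sin (freq * t) *\<^sub>R vel p,
     m *\<^sub>R (cos (freq * t) *\<^sub>R vel p - sin (freq * t) *\<^sub>R fst p))"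

lemma K_orbit_flow: "K_orbit \<mu> M f (flow p)"
  unfolding K_orbit_iff
proof
  fix t
  show "(flow p has_vector_derivative (freq *\<^sub>R vel (flow p t), - (m * freq) *\<^sub>R fst (flow p t))) (at t)"
    using m_pos unfolding flow_def[abs_def] has_vector_derivative_def
    by (auto intro!: derivative_eq_intros simp: vel_def algebra_simps)
qed

text \<open>Rotating an orbit back by the flow gives a curve with vanishing derivative.\<close>

lemma K_orbit_unique:
  assumes "K_orbit \<mu> M f c"
  shows "fst (c t) = fst (flow (c 0) t)"
proof -
  define z where "z = (\<lambda>t. fst (c t))"
  define b where "b = (\<lambda>t. vel (c t))"
  define u where "u = (\<lambda>t. cos (freq * t) *\<^sub>R z t - sin (freq * t) *\<^sub>R b t)"
  define w where "w = (\<lambda>t. sin (freq * t) *\<^sub>R z t + cos (freq * t) *\<^sub>R b t)"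
  have c: "(c has_derivative (\<lambda>s. s *\<^sub>R (freq *\<^sub>R vel (c t), - (m * freq) *\<^sub>R fst (c t)))) (at t)" for t
    using assms unfolding K_orbit_iff has_vector_derivative_def by blast
  have z': "(z has_derivative (\<lambda>s. s *\<^sub>R freq *\<^sub>R b t)) (at t)" for t
    using has_derivative_fst[OF c[of t]] by (simp add: z_def b_def)
  have b': "(b has_derivative (\<lambda>s. - (s *\<^sub>R freq *\<^sub>R z t))) (at t)" for t
    using has_derivative_scaleR_right[OF has_derivative_snd[OF c[of t]], of "1/m"] m_pos 
    by (simp add: z_def b_def vel_def)
  have der: "(u has_derivative (\<lambda>h. 0)) (at t)" "(w has_derivative (\<lambda>h. 0)) (at t)" for t
    unfolding u_def w_def
    by (auto intro!: derivative_eq_intros z' b' simp: algebra_simps)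
  have "\<exists>k. \<forall>t\<in>UNIV. u t = k" "\<exists>k. \<forall>t\<in>UNIV. w t = k"
    using has_derivative_zero_constant[OF convex_UNIV der(1)]
      has_derivative_zero_constant[OF convex_UNIV der(2)] by simp_all
  then have const: "u t = u 0" "w t = w 0" for t
    by auto
  have "fst (c t) = ((cos (freq * t))\<^sup>2 + (sin (freq * t))\<^sup>2) *\<^sub>R z t"
    by (simp add: z_def)
  also have "\<dots> = cos (freq * t) *\<^sub>R u t + sin (freq * t) *\<^sub>R w t"
    unfolding u_def w_def by (simp add: power2_eq_square algebra_simps del: sin_cos_squared_add2 sin_cos_squared_add sin_cos_squared_add3)
  also have "\<dots> = fst (flow (c 0) t)"
    unfolding const[of t] by (simp add: flow_def u_def w_def z_def b_def)
  finally show ?thesis .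
qed

lemma pos_eq: "pos p = ivec (fst p) (fst p)"
  by (simp add: pos_def ivec_def split_beta)

lemma KS_ellipse_eq:
  assumes p: "p \<in> Sigma0"
  shows "KS_ellipse \<mu> M f (proj p) = range (level_pair.ell (fst p) (vel p))"
proof -
  interpret level_pair "fst p" "vel p" by (rule level_pair_Sigma0[OF p])
  have ell: "pos (flow p t) = ell (freq * t)" for t
    by (simp add: pos_eq flow_def ell_def)
  have "KS_ellipse \<mu> M f (proj p) = range (\<lambda>t. pos (flow p t))"
  proof (intro set_eqI iffI)
    fix y assume "y \<in> KS_ellipse \<mu> M f (proj p)"
    then obtain c t \<theta> where c: "K_orbit \<mu> M f c" "c 0 = act \<theta> p" "y = pos (c t)"
      by (auto simp: KS_ellipse_def proj_def)
    have "fst (c t) = qexpi \<theta> \<odot> fst (flow p t)"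
      unfolding K_orbit_unique[OF c(1)] c(2) by (simp add: flow_def vel_act fst_act qmul_linear)
    then have "y = pos (flow p t)"
      by (simp add: c(3) pos_eq ivec_act)
    then show "y \<in> range (\<lambda>t. pos (flow p t))" by simp
  next
    fix y assume "y \<in> range (\<lambda>t. pos (flow p t))"
    then obtain t where "y = pos (flow p t)" by auto
    moreover have "flow p 0 = p"
      using m_pos by (simp add: flow_def vel_def)
    ultimately show "y \<in> KS_ellipse \<mu> M f (proj p)"
      unfolding KS_ellipse_def
      by (intro CollectI exI[of _ "flow p"] exI[of _ t]) (simp add: K_orbit_flow self_in_proj)
  qed
  also have "\<dots> = range ell"
  proof (intro set_eqI iffI)
    fix y assume "y \<in> range ell"
    then obtain t where "y = ell (freq * (t / freq))" using freq_pos by auto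
    then show "y \<in> range (\<lambda>t. pos (flow p t))" unfolding ell[symmetric] by blast
  qed (auto simp: ell)
  finally show ?thesis .
qed

text \<open>The second condition excludes circular orbits. The third one excludes horizontal orbits and, since the
  angular momentum of a degenerate orbit vanishes, the degenerate ones as well.\<close>

definition generic :: "qpair \<Rightarrow> bool" where
  "generic p \<longleftrightarrow> p \<in> Sigma0 \<and> evec (fst p) (vel p) \<noteq> 0 \<and>
     cross3 (axis 3 1) (snd (qcnj (fst p) \<odot> vel p)) \<noteq> 0"

lemma V1tilde_iff:
  assumes p: "p \<in> Sigma0"
  shows "proj p \<in> V1tilde \<mu> M f \<longleftrightarrow> generic p"
proof -
  interpret level_pair "fst p" "vel p" by (rule level_pair_Sigma0[OF p])
  have "proj p \<in> V1tilde \<mu> M f \<longleftrightarrow> v \<noteq> 0 \<and> E \<noteq> 0 \<and> \<not> range ell \<subseteq> {x. x $ 3 = 0}"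
    unfolding V1tilde_def mem_Collect_eq KS_ellipse_eq[OF p] collinear_ell sphere_ell
    using p by (simp add: V0_def)
  moreover have "v \<noteq> 0" if "cross3 (axis 3 1) v \<noteq> 0"
    using that by auto
  ultimately show ?thesis
    using p horizontal_ell unfolding generic_def by blast
qed

end

section \<open>Orbital elements and the regularized phase space\<close>

lemma cross_cross3: "cross3 x (cross3 y z) = (x \<bullet> z) *\<^sub>R y - (x \<bullet> y) *\<^sub>R z"
  by (simp add: cross3_simps forall_3)

lemma inner_cross3: "cross3 x y \<bullet> cross3 x y = (x \<bullet> x) * (y \<bullet> y) - (x \<bullet> y)\<^sup>2"
  using norm_cross_dot[of x y] by (simp add: dot_square_norm power_mult_distrib)

lemma rcong_sin_cos: "sin a = sin b \<Longrightarrow> cos a = cos b \<Longrightarrow> [a = b] (rmod (2 * pi))"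
  using sin_cos_eq_iff[of b a] unfolding rcong_altdef by (auto simp: mult.commute)

lemma sin_cos_rcong:
  assumes "[a = b] (rmod (2 * pi))"
  shows "sin a = sin b" "cos a = cos b"
proof -
  obtain n where "b = a + 2 * pi * of_int n"
    using assms unfolding rcong_altdef by (auto simp: mult_ac)
  with sin_cos_eq_iff[of b a] show "sin a = sin b" "cos a = cos b" by metis+
qed

text \<open>The definite descriptions of the angles all select the determination in \<open>[0, 2\<pi>)\<close> of an angle
  with prescribed cosine and sine.\<close>

lemma the_angle:
  assumes "x\<^sup>2 + y\<^sup>2 = 1" and "\<And>u. P u \<longleftrightarrow> cos u = x \<and> sin u = y"
  shows "cos (THE u. 0 \<le> u \<and> u < 2 * pi \<and> P u) = x \<and> sin (THE u. 0 \<le> u \<and> u < 2 * pi \<and> P u) = y"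
proof -
  obtain t where t: "0 \<le> t" "t < 2 * pi" "x = cos t" "y = sin t"
    using sincos_total_2pi[OF assms(1)] .
  have "s = t" if "0 \<le> s" "s < 2 * pi" "cos s = x" "sin s = y" for s
    using rcong_sin_cos[of s t] rcong_imp_eq[of s t "2 * pi"] that t by simp
  then have "(THE u. 0 \<le> u \<and> u < 2 * pi \<and> P u) = t"
    using t assms(2) by (intro the_equality) auto
  then show ?thesis using t by simp
qed

lemma cos_sin_orthonormal:
  fixes x y :: "'a::real_inner"
  assumes "x \<bullet> x = 1" "y \<bullet> y = 1" "x \<bullet> y = 0"
  shows "a *\<^sub>R x + b *\<^sub>R y = c *\<^sub>R x + d *\<^sub>R y \<longleftrightarrow> a = c \<and> b = d"
proof
  assume *: "a *\<^sub>R x + b *\<^sub>R y = c *\<^sub>R x + d *\<^sub>R y"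
  show "a = c \<and> b = d"
    using arg_cong[OF *, of "\<lambda>v. v \<bullet> x"] arg_cong[OF *, of "\<lambda>v. v \<bullet> y"] assms
    by (simp add: inner_add_left inner_add_right inner_commute)
qed simp

lemma angle_in:
  assumes "x \<bullet> x = 1" "y \<bullet> y = 1" "x \<bullet> y = 0" "a\<^sup>2 + b\<^sup>2 = 1" "v = a *\<^sub>R x + b *\<^sub>R y"
  shows "cos (angle_in x y v) = a \<and> sin (angle_in x y v) = b"
  unfolding angle_in_def assms(5) cos_sin_orthonormal[OF assms(1-3)]
  by (rule the_angle[OF assms(4)]) auto

text \<open>With \<open>k\<close> the direction of the angular momentum and \<open>n\<close> that of the node, the coefficients are cosine and
  sine of the argument of pericenter if \<open>e\<close> points to the pericenter. The expansion is obtained by computing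
  \<open>w \<times> (e \<times> w)\<close> for \<open>w = k \<times> n\<close> in two ways.\<close>

lemma unit_vector_in_plane:
  fixes n k e :: "real^3"
  assumes "n \<bullet> n = 1" "k \<bullet> k = 1" "e \<bullet> e = 1" "n \<bullet> k = 0" "e \<bullet> k = 0"
  shows "e = (e \<bullet> n) *\<^sub>R n + (e \<bullet> cross3 k n) *\<^sub>R cross3 k n" "(e \<bullet> n)\<^sup>2 + (e \<bullet> cross3 k n)\<^sup>2 = 1"
    "cross3 k n \<bullet> cross3 k n = 1" "n \<bullet> cross3 k n = 0"
proof -
  let ?w = "cross3 k n"
  show w: "?w \<bullet> ?w = 1" "n \<bullet> ?w = 0"
    using assms by (simp_all add: inner_cross3 inner_commute dot_cross_self)
  have "cross3 e ?w = (e \<bullet> n) *\<^sub>R k"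
    by (simp add: cross_cross3 assms)
  then have "cross3 ?w (cross3 e ?w) = (e \<bullet> n) *\<^sub>R n"
    using cross_skew[of ?w k] assms by (simp add: cross_mult_right cross_cross3 inner_commute)
  moreover have "cross3 ?w (cross3 e ?w) = e - (e \<bullet> ?w) *\<^sub>R ?w"
    unfolding cross_cross3[of ?w e ?w] by (simp add: w inner_commute)
  ultimately show e: "e = (e \<bullet> n) *\<^sub>R n + (e \<bullet> ?w) *\<^sub>R ?w"
    by (simp add: algebra_simps)
  have "e \<bullet> e = (e \<bullet> n) * (e \<bullet> n) + (e \<bullet> ?w) * (e \<bullet> ?w)"
    using arg_cong[OF e, of "\<lambda>x. e \<bullet> x"] by (simp add: inner_add_right)
  then show "(e \<bullet> n)\<^sup>2 + (e \<bullet> ?w)\<^sup>2 = 1"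
    using assms(3) by (simp add: power2_eq_square)
qed

text \<open>The frame belonging to given elements: the direction of the ascending node, the angular momentum and the
  direction of the pericenter.\<close>

definition node :: "real \<Rightarrow> real^3" where
  "node h = cos h *\<^sub>R axis 1 1 + sin h *\<^sub>R axis 2 1"

definition jvec :: "real \<Rightarrow> real \<Rightarrow> real \<Rightarrow> real^3" where
  "jvec G H h = sqrt (G\<^sup>2 - H\<^sup>2) *\<^sub>R cross3 (node h) (axis 3 1) + H *\<^sub>R axis 3 1"

definition apsis :: "real \<Rightarrow> real \<Rightarrow> real \<Rightarrow> real \<Rightarrow> real^3" where
  "apsis G g H h = cos g *\<^sub>R node h + sin g *\<^sub>R ((1 / G) *\<^sub>R cross3 (jvec G H h) (node h))"

lemma node_inner: "node h \<bullet> node h = 1" "node h \<bullet> axis 3 1 = 0"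
  by (simp_all add: node_def inner_add_left inner_add_right inner_axis_axis flip: power2_eq_square)

lemma jvec_inner:
  assumes "\<bar>H\<bar> < G"
  shows "jvec G H h \<bullet> jvec G H h = G\<^sup>2" "node h \<bullet> jvec G H h = 0" "jvec G H h $ 3 = H"
    "cross3 (axis 3 1) (jvec G H h) = sqrt (G\<^sup>2 - H\<^sup>2) *\<^sub>R node h" "G\<^sup>2 - H\<^sup>2 > 0"
proof -
  show pos: "G\<^sup>2 - H\<^sup>2 > 0"
    using assms abs_square_less_1 power_strict_mono[of "\<bar>H\<bar>" G 2] by simp
  have o: "cross3 (node h) (axis 3 1) \<bullet> axis 3 1 = 0" "node h \<bullet> cross3 (node h) (axis 3 1) = 0"
    by (simp_all add: dot_cross_self)
  have 1: "cross3 (node h) (axis 3 1) \<bullet> cross3 (node h) (axis 3 1) = 1"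
    by (simp add: inner_cross3 node_inner inner_axis_axis)
  show "jvec G H h \<bullet> jvec G H h = G\<^sup>2"
    unfolding jvec_def using o 1 pos
    by (simp add: inner_add_left inner_add_right inner_axis_axis inner_commute[of "axis 3 1" "cross3 _ _"]
        flip: power2_eq_square)
  show "node h \<bullet> jvec G H h = 0"
    unfolding jvec_def using o by (simp add: inner_add_right node_inner)
  show "jvec G H h $ 3 = H"
    by (simp add: jvec_def cross_components axis_def)
  show "cross3 (axis 3 1) (jvec G H h) = sqrt (G\<^sup>2 - H\<^sup>2) *\<^sub>R node h"
    by (simp add: jvec_def cross_add_right cross_mult_right cross_cross3 node_inner inner_axis_axis
        inner_commute[of "axis 3 1"])
qed

lemma apsis_inner:
  assumes "\<bar>H\<bar> < G"
  shows "apsis G g H h \<bullet> node h = cos g" "apsis G g H h \<bullet> cross3 (jvec G H h) (node h) = G * sin g"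
    "apsis G g H h \<bullet> apsis G g H h = 1"
proof -
  have G: "G > 0" using assms by auto
  note j = jvec_inner(1,2)[OF assms, of h]
  have n: "cross3 (jvec G H h) (node h) \<bullet> node h = 0" "node h \<bullet> cross3 (jvec G H h) (node h) = 0"
    by (simp_all add: dot_cross_self)
  have w: "cross3 (jvec G H h) (node h) \<bullet> cross3 (jvec G H h) (node h) = G\<^sup>2"
    using j by (simp add: inner_cross3 node_inner inner_commute[of "jvec G H h" "node h"])
  show c: "apsis G g H h \<bullet> node h = cos g" 
    and s: "apsis G g H h \<bullet> cross3 (jvec G H h) (node h) = G * sin g"
    using G n w by (simp_all add: apsis_def inner_add_left node_inner power2_eq_square)
  show "apsis G g H h \<bullet> apsis G g H h = 1"
    by (subst (2) apsis_def) (use c s G in \<open>simp add: inner_add_right flip: power2_eq_square\<close>)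
qed

context kepler
begin

text \<open>This is \<open>2 a e\<close>, as \<open>L = m a / 2\<close> and \<open>G = L sqrt (1 - e\<^sup>2)\<close>.\<close>

definition ecc_scale :: "real \<Rightarrow> real \<Rightarrow> real" where
  "ecc_scale L G = (4 / m) * sqrt (L\<^sup>2 - G\<^sup>2)"

text \<open>The relation between a point of the level set and its LCF coordinates, stated without choice of
  determinations of the angles. With \<open>a\<close> the semi major axis, \<open>e\<close> the eccentricity and \<open>u\<close> the
  eccentric anomaly, \<open>norm b ^ 2 - norm z ^ 2 = 2 a e cos u\<close>, \<open>Re (qcnj z \<odot> b) = a e sin u\<close>, the vector
  \<open>snd (qcnj z \<odot> b)\<close> is a multiple of the angular momentum and \<open>evec z b\<close> is \<open>2 a\<close> times the
  eccentricity vector.\<close>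

definition elements :: "qpair \<Rightarrow> real \<Rightarrow> real \<Rightarrow> real \<Rightarrow> real \<Rightarrow> real \<Rightarrow> real \<Rightarrow> bool" where
  "elements p L d G g H h \<longleftrightarrow> p \<in> Sigma0 \<and> G < L \<and> \<bar>H\<bar> < G \<and>
     (norm (fst p))\<^sup>2 + (norm (vel p))\<^sup>2 = 4 * L / m \<and>
     (norm (vel p))\<^sup>2 - (norm (fst p))\<^sup>2 = ecc_scale L G * cos d \<and>
     2 * fst (qcnj (fst p) \<odot> vel p) = ecc_scale L G * sin d \<and>
     snd (qcnj (fst p) \<odot> vel p) = - ((2 / m) *\<^sub>R jvec G H h) \<and>
     evec (fst p) (vel p) = ecc_scale L G *\<^sub>R apsis G g H h"

lemma elementsD:
  assumes "elements p L d G g H h"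
  shows "p \<in> Sigma0" "G < L" "\<bar>H\<bar> < G"
    "(norm (fst p))\<^sup>2 + (norm (vel p))\<^sup>2 = 4 * L / m"
    "(norm (vel p))\<^sup>2 - (norm (fst p))\<^sup>2 = ecc_scale L G * cos d"
    "2 * fst (qcnj (fst p) \<odot> vel p) = ecc_scale L G * sin d"
    "snd (qcnj (fst p) \<odot> vel p) = - ((2 / m) *\<^sub>R jvec G H h)"
    "evec (fst p) (vel p) = ecc_scale L G *\<^sub>R apsis G g H h"
  using assms unfolding elements_def by blast+

lemma ecc_scale_pos: "0 < G \<Longrightarrow> G < L \<Longrightarrow> ecc_scale L G > 0"
  using m_pos by (simp add: ecc_scale_def power_strict_mono)

lemma elements_pos:
  assumes "elements p L d G g H h"
  shows "ecc_scale L G > 0" "G > 0" "L > 0"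
  using assms ecc_scale_pos[of G L] by (auto simp: elements_def)

lemma elements_generic:
  assumes "elements p L d G g H h"
  shows "generic p"
proof -
  have GH: "\<bar>H\<bar> < G" and p: "p \<in> Sigma0" using assms by (auto simp: elements_def)
  have "apsis G g H h \<noteq> 0" "node h \<noteq> 0"
    using apsis_inner(3)[OF GH, of g h] node_inner(1)[of h] by auto
  moreover have "cross3 (axis 3 1) (- ((2 / m) *\<^sub>R jvec G H h)) = - ((2 / m * sqrt (G\<^sup>2 - H\<^sup>2)) *\<^sub>R node h)"
    by (simp add: cross_mult_right jvec_inner(4)[OF GH])
  moreover have "sqrt (G\<^sup>2 - H\<^sup>2) > 0" using jvec_inner(5)[OF GH] by simp
  ultimately show ?thesis
    using assms elements_pos(1)[OF assms] p m_pos unfolding generic_def elements_def by simp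
qed

lemma elements_determined:
  assumes 1: "elements p L d G g H h" and 2: "elements p L' d' G' g' H' h'"
  shows "same_mod_2pi (L, d, G, g, H, h) (L', d', G', g', H', h')"
proof -
  note E1 = elementsD[OF 1] and E2 = elementsD[OF 2]
  note GH = E1(3) E2(3)
  have L: "L = L'" using E1(4) E2(4) m_pos by simp
  have "(2 / m) *\<^sub>R jvec G H h = (2 / m) *\<^sub>R jvec G' H' h'"
    using E1(7) E2(7) by (metis neg_equal_iff_equal)
  then have j: "jvec G H h = jvec G' H' h'"
    using m_pos by simp
  then have G: "G = G'" and H: "H = H'"
    using jvec_inner(1,3)[OF GH(1), of h] jvec_inner(1,3)[OF GH(2), of h'] GH
    by (simp_all add: power2_eq_iff_nonneg)
  have "sqrt (G\<^sup>2 - H\<^sup>2) *\<^sub>R node h = sqrt (G\<^sup>2 - H\<^sup>2) *\<^sub>R node h'"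
    using jvec_inner(4)[OF GH(1), of h] jvec_inner(4)[OF GH(2), of h'] j G H by metis
  then have n: "node h = node h'" using jvec_inner(5)[OF GH(1)] by auto
  have "node h $ 1 = cos h" "node h $ 2 = sin h" for h by (simp_all add: node_def axis_def)
  then have h: "[h = h'] (rmod (2 * pi))"
    using n by (intro rcong_sin_cos) metis+
  have sc: "ecc_scale L G > 0" using elements_pos(1)[OF 1] .
  have "ecc_scale L G *\<^sub>R apsis G g H h = ecc_scale L G *\<^sub>R apsis G' g' H' h'"
    using E1(8) E2(8) L G by metis
  then have "apsis G g H h = apsis G' g' H' h'"
    using sc by simp
  then have "cos g = cos g'" "G * sin g = G * sin g'"
    using apsis_inner(1,2)[OF GH(1), of g h] apsis_inner(1,2)[OF GH(2), of g' h'] n j G by metis+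
  then have g: "[g = g'] (rmod (2 * pi))"
    using elements_pos(2)[OF 1] by (auto intro: rcong_sin_cos)
  have "ecc_scale L G * cos d = ecc_scale L G * cos d'" "ecc_scale L G * sin d = ecc_scale L G * sin d'"
    using E1(5,6) E2(5,6) L G by metis+
  then have "[d = d'] (rmod (2 * pi))"
    using sc by (auto intro: rcong_sin_cos)
  with L G H g h show ?thesis by (simp add: same_mod_2pi_def)
qed

lemma elements_rcong:
  assumes "elements p L d G g H h" "same_mod_2pi (L, d, G, g, H, h) (L', d', G', g', H', h')"
  shows "elements p L' d' G' g' H' h'"
proof -
  have e: "L = L'" "G = G'" "H = H'" and
    c: "[d = d'] (rmod (2 * pi))" "[g = g'] (rmod (2 * pi))" "[h = h'] (rmod (2 * pi))"
    using assms(2) by (auto simp: same_mod_2pi_def)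
  have "node h = node h'" using sin_cos_rcong[OF c(3)] by (simp add: node_def)
  then show ?thesis
    using assms(1) sin_cos_rcong[OF c(1)] sin_cos_rcong[OF c(2)]
    unfolding elements_def jvec_def apsis_def e by simp
qed

text \<open>The hypotheses say that the quotient of \<open>y\<close> by \<open>z\<close> commutes with \<open>qi\<close> and has norm 1, and the centralizer
  of \<open>qi\<close> is the complex line spanned by 1 and \<open>qi\<close>.\<close>

lemma hopf_fibre:
  assumes "ivec z z = ivec y y" "norm z = norm y" "z \<noteq> 0"
  obtains \<theta> where "y = qexpi \<theta> \<odot> z"
proof -
  define q where "q = (1 / (norm z)\<^sup>2) *\<^sub>R (y \<odot> qcnj z)"
  have z: "(norm z)\<^sup>2 \<noteq> 0" using assms(3) by simp
  have y: "y = q \<odot> z"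
    using z by (simp add: q_def qmul_linear qmul_assoc qmul_qcnj qmul_scalar)
  have "qcnj z \<odot> qi \<odot> z = qcnj y \<odot> qi \<odot> y"
    using assms(1) by (simp add: qmul_ivec_self)
  from arg_cong[OF this, of "\<lambda>x. y \<odot> (x \<odot> qcnj z)"]
  have "(norm z)\<^sup>2 *\<^sub>R (y \<odot> qcnj z \<odot> qi) = (norm z)\<^sup>2 *\<^sub>R (qi \<odot> (y \<odot> qcnj z))"
    by (simp add: qmul_assoc qmul_cancel qmul_qcnj qmul_scalar qmul_linear assms(2))
  then have "q \<odot> qi = qi \<odot> q"
    using z by (simp add: q_def qmul_linear)
  then have q23: "snd q $ 2 = 0" "snd q $ 3 = 0"
    by (simp_all add: qmul_def qi_def vec_eq_iff forall_3 cross_components axis_def)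
  have "norm q = 1"
    using assms z by (simp add: q_def norm_qmul power2_eq_square)
  moreover have "snd q \<bullet> snd q = (snd q $ 1)\<^sup>2"
    using q23 by (simp add: inner_vec_def sum_3 power2_eq_square)
  ultimately have "(fst q)\<^sup>2 + (snd q $ 1)\<^sup>2 = 1"
    using norm_quat[of q] by (simp add: dot_square_norm)
  then obtain \<theta> where "fst q = cos \<theta>" "snd q $ 1 = sin \<theta>"
    using sincos_total_2pi by metis
  with q23 have "q = qexpi \<theta>"
    by (simp add: qexpi_def prod_eq_iff vec_eq_iff forall_3 axis_def)
  with y that show ?thesis by blast
qed

text \<open>The elements determine both norms, \<open>qcnj z \<odot> b\<close> and the eccentricity vector, hence the position by the
  ellipse equation. The position determines \<open>z\<close> up to the circle action, and \<open>z\<close> and \<open>qcnj z \<odot> b\<close> determine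
  \<open>b\<close>.\<close>

lemma elements_inject:
  assumes 1: "elements p L d G g H h" and 2: "elements q L d G g H h"
  shows "proj p = proj q"
proof -
  note E1 = elementsD[OF 1] and E2 = elementsD[OF 2]
  note p = E1(1) and q = E2(1)
  interpret p: level_pair "fst p" "vel p" by (rule level_pair_Sigma0[OF p])
  interpret q: level_pair "fst q" "vel q" by (rule level_pair_Sigma0[OF q])
  have n: "(norm (fst p))\<^sup>2 = (norm (fst q))\<^sup>2" "(norm (vel p))\<^sup>2 = (norm (vel q))\<^sup>2" and r: "p.r = q.r"
    using E1(4-6) E2(4-6) by linarith+
  have v: "p.v = q.v" and E: "p.E = q.E"
    using E1(7,8) E2(7,8) by simp_all
  have "p.E \<noteq> 0" and v0: "p.v \<noteq> 0"
    using elements_generic[OF 1] by (auto simp: generic_def)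
  moreover have "(2 * (norm p.E)\<^sup>2) *\<^sub>R p.A = (2 * (norm p.E)\<^sup>2) *\<^sub>R q.A"
    using p.A_in_apsidal_frame[unfolded n r v E] q.A_in_apsidal_frame by (simp add: E)
  ultimately have A: "p.A = q.A" by simp
  have z0: "fst p \<noteq> 0" using v0 by (auto simp: qcnj_def qmul_def)
  have nz: "norm (fst p) = norm (fst q)" using n(1) by (simp add: power2_eq_iff_nonneg)
  obtain \<theta> where \<theta>: "fst q = qexpi \<theta> \<odot> fst p"
    using hopf_fibre[OF A nz z0] .
  have "qcnj (fst q) \<odot> vel q = qcnj (fst p) \<odot> vel p"
    using r v by (simp add: prod_eq_iff)
  also have "\<dots> = qcnj (fst q) \<odot> (qexpi \<theta> \<odot> vel p)"
    unfolding \<theta> by (simp add: qcnj_qmul qmul_assoc qexpi_cancel)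
  finally have "fst q \<odot> (qcnj (fst q) \<odot> vel q) = fst q \<odot> (qcnj (fst q) \<odot> (qexpi \<theta> \<odot> vel p))"
    by simp
  moreover have "fst q \<noteq> 0" using z0 nz by auto
  ultimately have "vel q = vel (act \<theta> p)"
    by (simp add: qmul_cancel vel_act)
  then have "q = act \<theta> p"
    using m_pos \<theta> by (simp add: vel_def prod_eq_iff fst_act)
  then show ?thesis by (simp add: proj_act)
qed

end

section \<open>The LCF coordinates satisfy the defining relation of the elements\<close>

lemma sgn_pos_scaleR: "c > 0 \<Longrightarrow> sgn (c *\<^sub>R x) = (1 / norm x) *\<^sub>R x"
  for x :: "'a::real_normed_vector"
  by (simp add: sgn_scaleR sgn_div_norm inverse_eq_divide)

context kepler
begin

lemma powr_three_halves: "\<mu> powr (3/2) = \<mu> * sqrt \<mu>"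
  using pos powr_add[of \<mu> 1 "1/2"] by (simp add: powr_half_sqrt)

text \<open>The rescaling factor as a function of the semi major axis \<open>x\<close> of the rescaled orbit.\<close>

lemma kf_factor:
  assumes "x > 0"
  shows "\<mu> powr (3/2) * M / (sqrt (2 * f) * (\<mu> * sqrt M * sqrt x)) = sqrt (\<mu> * M / (2 * f * x))"
proof -
  have "M = sqrt M * sqrt M" using pos by simp
  then have "\<mu> powr (3/2) * M = (\<mu> * sqrt M) * (sqrt \<mu> * sqrt M)"
    unfolding powr_three_halves by (simp add: mult_ac)
  then have "\<mu> powr (3/2) * M / (sqrt (2 * f) * (\<mu> * sqrt M * sqrt x)) = sqrt \<mu> * sqrt M / (sqrt (2 * f) * sqrt x)"
    using pos assms by simp
  then show ?thesis
    by (simp add: real_sqrt_mult real_sqrt_divide)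
qed

text \<open>If the momentum is rescaled by the factor belonging to the semi major axis \<open>x\<close>, the energy is an
  affine function of \<open>1 / x\<close>; hence the implicit equation for the factor is linear in \<open>1 / x\<close>.\<close>

lemma ham_T_scaled:
  assumes "k\<^sup>2 = \<mu> * M / (2 * f * x)" "x > 0" "Q \<noteq> 0"
  shows "ham_T \<mu> M (k *\<^sub>R P) Q = (\<mu> * M / x) * ((norm P)\<^sup>2 / (4 * \<mu> * f) - x / norm Q)"
proof -
  have "ham_T \<mu> M (k *\<^sub>R P) Q = k\<^sup>2 * (norm P)\<^sup>2 / (2 * \<mu>) - \<mu> * M / norm Q"
    by (simp add: ham_T_def power_mult_distrib)
  also have "\<dots> = (\<mu> * M / x) * ((norm P)\<^sup>2 / (4 * \<mu> * f) - x / norm Q)"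
    unfolding assms(1) using pos assms(2,3) by (simp add: field_simps)
  finally show ?thesis .
qed

lemma kf_mom:
  fixes P Q :: "real^3"
  assumes Q: "Q \<noteq> 0"
  defines "a \<equiv> norm Q * (1 / 2 + (norm P)\<^sup>2 / (4 * \<mu> * f))"
  shows "a > 0" "kf_mom \<mu> M f P Q = sqrt (\<mu> * M / (2 * f * a)) *\<^sub>R P"
    "semi_major \<mu> M (sqrt (\<mu> * M / (2 * f * a)) *\<^sub>R P) Q = a"
proof -
  have "1 / 2 + (norm P)\<^sup>2 / (4 * \<mu> * f) > 0"
    using pos by (intro add_pos_nonneg) auto
  then show a: "a > 0" using Q by (simp add: a_def)
  have aQ: "(norm P)\<^sup>2 / (4 * \<mu> * f) = a / norm Q - 1 / 2"
    using Q by (simp add: a_def)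
  define k where "k x = sqrt (\<mu> * M / (2 * f * x))" for x
  have k: "(k x)\<^sup>2 = \<mu> * M / (2 * f * x)" if "x > 0" for x
    using pos that by (simp add: k_def)
  have T: "ham_T \<mu> M (k x *\<^sub>R P) Q = (\<mu> * M / x) * (a / norm Q - 1 / 2 - x / norm Q)" if "x > 0" for x
    using ham_T_scaled[OF k[OF that] that Q] aQ by simp
  have Ta: "ham_T \<mu> M (k a *\<^sub>R P) Q = - (\<mu> * M / (2 * a))"
    by (simp add: T[OF a])
  then show sm: "semi_major \<mu> M (sqrt (\<mu> * M / (2 * f * a)) *\<^sub>R P) Q = a"
    using pos a unfolding semi_major_def k_def by simp
  show "kf_mom \<mu> M f P Q = sqrt (\<mu> * M / (2 * f * a)) *\<^sub>R P"
    unfolding kf_mom_def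
  proof (rule the_equality)
    have "ham_T \<mu> M (k a *\<^sub>R P) Q < 0"
      unfolding Ta using pos a by simp
    then show "ham_T \<mu> M (sqrt (\<mu> * M / (2 * f * a)) *\<^sub>R P) Q < 0 \<and>
      sqrt (\<mu> * M / (2 * f * a)) *\<^sub>R P = (\<mu> powr (3/2) * M /
        (sqrt (2 * f) * Del_L \<mu> M (sqrt (\<mu> * M / (2 * f * a)) *\<^sub>R P) Q)) *\<^sub>R P"
      unfolding Del_L_def sm kf_factor[OF a] by (simp add: k_def)
  next
    fix P' assume P': "ham_T \<mu> M P' Q < 0 \<and>
      P' = (\<mu> powr (3/2) * M / (sqrt (2 * f) * Del_L \<mu> M P' Q)) *\<^sub>R P"
    define x where "x = semi_major \<mu> M P' Q"
    have x: "x > 0"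
      unfolding x_def semi_major_def using P' pos by (intro divide_neg_neg) simp_all
    have P'_eq: "P' = k x *\<^sub>R P"
      using P' unfolding Del_L_def x_def[symmetric] kf_factor[OF x] k_def by blast
    have "ham_T \<mu> M P' Q = - (\<mu> * M / (2 * x))"
      using P' pos unfolding x_def semi_major_def by simp
    then have "(\<mu> * M / x) * (a / norm Q - 1 / 2 - x / norm Q) = (\<mu> * M / x) * (- (1 / 2))"
      using T[OF x] P'_eq by simp
    moreover have "\<mu> * M / x \<noteq> 0" using pos x by simp
    ultimately have "a / norm Q - 1 / 2 - x / norm Q = - (1 / 2)"
      using mult_cancel_left by blast
    then have "x = a" using Q by simp
    then show "P' = sqrt (\<mu> * M / (2 * f * a)) *\<^sub>R P"
      using P'_eq by (simp add: k_def)
  qed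
qed

lemma PQ_proj: "PQ (proj p) = (mom p, pos p)"
proof -
  have "mom (act \<theta> p) = mom p" "pos (act \<theta> p) = pos p" for \<theta>
    using act_invariant_products(3)[of \<theta> p p] act_invariant_products(4)[of \<theta> p p] norm_act[of \<theta> p]
    by (simp_all add: mom_def pos_def split_beta)
  then have "mom q = mom p \<and> pos q = pos p" if "q \<in> proj p" for q
    using that by (auto simp: proj_def)
  then have "(\<lambda>p. (mom p, pos p)) ` proj p = {(mom p, pos p)}"
    using self_in_proj[of p] by force
  then show ?thesis by (simp add: PQ_def)
qed

lemma mom_eq: "mom p = (m / (2 * (norm (fst p))\<^sup>2)) *\<^sub>R ivec (fst p) (vel p)"
proof -
  have "snd p = m *\<^sub>R vel p" using m_pos by (simp add: vel_def)
  then show ?thesis by (simp add: mom_def split_beta ivec_def qmul_linear)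
qed

text \<open>The implicitly defined semi major axis comes out as the mean of the squared norms since
  \<open>norm Q = norm z ^ 2\<close> and \<open>norm P ^ 2 norm Q = norm w ^ 2 / 4\<close>. The factor \<open>k\<^sup>2\<close> in the first term of the
  eccentricity vector then is \<open>4 \<mu>\<^sup>2 M / (m\<^sup>2 a)\<close>, and \<open>two_r_C\<close> turns the sum of the two terms into \<open>E / (2 a)\<close>.\<close>

lemma rescaled_state:
  assumes p: "p \<in> Sigma0" and z: "fst p \<noteq> 0"
  defines "a \<equiv> ((norm (fst p))\<^sup>2 + (norm (vel p))\<^sup>2) / 2"
  obtains k where "k > 0" "kf_mom \<mu> M f (mom p) (pos p) = k *\<^sub>R mom p" "a > 0"
    "semi_major \<mu> M (k *\<^sub>R mom p) (pos p) = a"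
    "angmom (mom p) (pos p) = - ((m / 2) *\<^sub>R snd (qcnj (fst p) \<odot> vel p))"
    "angmom (k *\<^sub>R mom p) (pos p) = k *\<^sub>R angmom (mom p) (pos p)"
    "ecc_vec \<mu> M (k *\<^sub>R mom p) (pos p) = (1 / (2 * a)) *\<^sub>R evec (fst p) (vel p)"
proof -
  interpret level_pair "fst p" "vel p" by (rule level_pair_Sigma0[OF p])
  define Z where "Z = (norm (fst p))\<^sup>2"
  define Y where "Y = (norm (vel p))\<^sup>2"
  have Z: "Z > 0" and Y: "Y \<ge> 0" using z by (simp_all add: Z_def Y_def)
  have Q: "pos p = A" "norm A = Z" by (simp_all add: pos_eq norm_A Z_def)
  have P: "mom p = (m / (2 * Z)) *\<^sub>R C" by (simp add: mom_eq Z_def)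
  have "(norm (mom p))\<^sup>2 = m\<^sup>2 / (4 * Z\<^sup>2) * (Z * Y)"
    by (simp add: P norm_C power_mult_distrib power_divide Z_def Y_def)
  also have "\<dots> = m\<^sup>2 * Y / (4 * Z)"
    using Z by (simp add: power2_eq_square)
  also have "\<dots> = 2 * f * \<mu> * Y / Z"
    using Z by (simp add: m_sq)
  finally have "norm A * (1 / 2 + (norm (mom p))\<^sup>2 / (4 * \<mu> * f)) = a"
    using pos Z by (simp add: Q a_def Z_def[symmetric] Y_def[symmetric] field_simps)
  moreover have "A \<noteq> 0" using Z Q by auto
  ultimately have a: "a > 0" and kf: "kf_mom \<mu> M f (mom p) (pos p) = sqrt (\<mu> * M / (2 * f * a)) *\<^sub>R mom p"
    and sm: "semi_major \<mu> M (sqrt (\<mu> * M / (2 * f * a)) *\<^sub>R mom p) (pos p) = a"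
    using kf_mom[of A "mom p"] by (simp_all add: Q)
  define k where "k = sqrt (\<mu> * M / (2 * f * a))"
  have k: "k > 0" "k\<^sup>2 = \<mu> * M / (2 * f * a)"
    using pos a by (simp_all add: k_def)
  have J: "angmom (mom p) (pos p) = - ((m / 2) *\<^sub>R v)"
    using Z by (simp add: angmom_def P Q cross_mult_right A_cross_C flip: Z_def)
  have J': "angmom (k *\<^sub>R mom p) (pos p) = k *\<^sub>R angmom (mom p) (pos p)"
    by (simp add: angmom_def cross_mult_right)
  have Cv: "cross3 C v = Z *\<^sub>R B - r *\<^sub>R C"
  proof -
    have "(- (C \<bullet> v), r *\<^sub>R C + cross3 C v) = Z *\<^sub>R (0, B)"
      using C_rho unfolding qmul_def[of "(0, C)"] by (simp add: Z_def)
    then show ?thesis by (simp add: algebra_simps)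
  qed
  have twoa: "2 * a = Z + Y" by (simp add: a_def Z_def Y_def)
  have "cross3 (k *\<^sub>R mom p) (angmom (k *\<^sub>R mom p) (pos p)) = (- (k\<^sup>2 * m\<^sup>2 / (4 * Z))) *\<^sub>R cross3 C v"
    unfolding J' J unfolding P by (simp add: cross_mult_left cross_mult_right power2_eq_square)
  also have "k\<^sup>2 * m\<^sup>2 / (4 * Z) = \<mu>\<^sup>2 * M / (a * Z)"
    unfolding k(2) m_sq using pos a Z by (simp add: power2_eq_square)
  finally have "ecc_vec \<mu> M (k *\<^sub>R mom p) (pos p) = - ((1 / (a * Z)) *\<^sub>R cross3 C v) - (1 / Z) *\<^sub>R A"
    using pos by (simp add: ecc_vec_def Q)
  also have "\<dots> = (1 / (2 * a * Z)) *\<^sub>R ((2 * r) *\<^sub>R C - (2 * Z) *\<^sub>R B - (2 * a) *\<^sub>R A)"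
    using a Z unfolding Cv by (simp add: vec_eq_iff field_simps)
  also have "(2 * r) *\<^sub>R C - (2 * Z) *\<^sub>R B - (2 * a) *\<^sub>R A = Z *\<^sub>R E"
    unfolding two_r_C twoa Z_def[symmetric] Y_def[symmetric] by (simp add: evec_def vec_eq_iff algebra_simps)
  finally have "ecc_vec \<mu> M (k *\<^sub>R mom p) (pos p) = (1 / (2 * a)) *\<^sub>R E"
    using Z by simp
  with k(1) kf a sm J J' show ?thesis
    unfolding k_def[symmetric] by (rule that)
qed

text \<open>\<open>A_in_apsidal_frame\<close> is the ellipse equation for the eccentric anomaly with this cosine and sine, and
  the two axes of the frame are independent.\<close>

lemma ecc_anomaly_eq:
  assumes "level_pair z b"
  defines "E \<equiv> evec z b" and "v \<equiv> snd (qcnj z \<odot> b)" and "a \<equiv> ((norm z)\<^sup>2 + (norm b)\<^sup>2) / 2"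
  assumes E: "E \<noteq> 0" and v: "v \<noteq> 0"
  shows "ivec z z = (a * (cos u - norm E / (2 * a))) *\<^sub>R ((1 / norm E) *\<^sub>R E)
       + (norm v * sin u) *\<^sub>R cross3 (- ((1 / norm v) *\<^sub>R v)) ((1 / norm E) *\<^sub>R E) \<longleftrightarrow>
     cos u = ((norm b)\<^sup>2 - (norm z)\<^sup>2) / norm E \<and> sin u = 2 * fst (qcnj z \<odot> b) / norm E"
proof -
  interpret level_pair z b by fact
  let ?e = "norm E"
  define X where "X = (1 / ?e) *\<^sub>R E"
  define Y where "Y = cross3 (- ((1 / norm v) *\<^sub>R v)) X"
  have e: "?e > 0" and nv: "norm v > 0" using E v by simp_all
  have "z \<noteq> 0" using v by (auto simp: v_def qcnj_def qmul_def)
  then have a: "a > 0" by (simp add: a_def add_pos_nonneg)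
  have X1: "X \<bullet> X = 1" using e by (simp add: X_def dot_square_norm power2_eq_square)
  have "E \<bullet> v = 0" unfolding E_def v_def by (rule E_dot_v)
  then have "X \<bullet> (- ((1 / norm v) *\<^sub>R v)) = 0" "(- ((1 / norm v) *\<^sub>R v)) \<bullet> (- ((1 / norm v) *\<^sub>R v)) = 1"
    using nv by (simp_all add: X_def dot_square_norm power2_eq_square)
  with unit_vector_in_plane(3,4)[OF X1 _ X1, of "- ((1 / norm v) *\<^sub>R v)"]
  have Y1: "Y \<bullet> Y = 1" "X \<bullet> Y = 0" by (simp_all add: Y_def)
  have YE: "cross3 v E = - ((norm v * ?e) *\<^sub>R Y)"
    using e nv by (simp add: Y_def X_def cross_mult_left cross_mult_right)
  have XE: "E = ?e *\<^sub>R X" using e by (simp add: X_def)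
  have "(2 * ?e\<^sup>2) *\<^sub>R A = (2 * a * ((norm b)\<^sup>2 - (norm z)\<^sup>2) - ?e\<^sup>2) *\<^sub>R E - (4 * r) *\<^sub>R cross3 v E"
    using A_in_apsidal_frame by (simp add: E_def v_def a_def)
  also have "\<dots> = ((2 * a * ((norm b)\<^sup>2 - (norm z)\<^sup>2) - ?e\<^sup>2) * ?e) *\<^sub>R X + (4 * r * norm v * ?e) *\<^sub>R Y"
    unfolding YE by (subst XE) simp
  finally have scaled: "(1 / (2 * ?e\<^sup>2)) *\<^sub>R ((2 * ?e\<^sup>2) *\<^sub>R A) = 
      (1 / (2 * ?e\<^sup>2)) *\<^sub>R (((2 * a * ((norm b)\<^sup>2 - (norm z)\<^sup>2) - ?e\<^sup>2) * ?e) *\<^sub>R X + (4 * r * norm v * ?e) *\<^sub>R Y)"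
    by simp
  have A: "A = (a * (((norm b)\<^sup>2 - (norm z)\<^sup>2) / ?e - ?e / (2 * a))) *\<^sub>R X + (norm v * (2 * r / ?e)) *\<^sub>R Y"
  proof -
    have "1 / (2 * ?e\<^sup>2) * (2 * ?e\<^sup>2) = 1"
      "1 / (2 * ?e\<^sup>2) * ((2 * a * D - ?e\<^sup>2) * ?e) = a * (D / ?e - ?e / (2 * a))"
      "1 / (2 * ?e\<^sup>2) * (4 * r * norm v * ?e) = norm v * (2 * r / ?e)" for D
      using e a by (simp_all add: power2_eq_square field_simps)
    then show ?thesis
      using scaled by (simp only: scaleR_add_right scaleR_scaleR scaleR_one)
  qed
  show ?thesis
    unfolding X_def[symmetric] Y_def[symmetric]
    unfolding A cos_sin_orthonormal[OF X1 Y1] mult_cancel_left using a nv by auto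
qed

text \<open>All definite descriptions in the definition of the LCF coordinates are evaluated here: the rescaled momentum
  by \<open>kf_mom\<close>, the angles by \<open>the_angle\<close>.\<close>

theorem LCF_elements:
  assumes "generic p" and LCF: "LCF \<mu> M f (proj p) = (L, d, G, g, H, h)"
  shows "elements p L d G g H h"
proof -
  have p: "p \<in> Sigma0" using assms(1) by (simp add: generic_def)
  interpret level_pair "fst p" "vel p" by (rule level_pair_Sigma0[OF p])
  have E: "E \<noteq> 0" and e3v: "cross3 (axis 3 1) v \<noteq> 0"
    using assms(1) by (simp_all add: generic_def)
  then have v: "v \<noteq> 0" by auto
  then have z: "fst p \<noteq> 0" by (auto simp: qcnj_def qmul_def)
  define a where "a = ((norm (fst p))\<^sup>2 + (norm (vel p))\<^sup>2) / 2"
  define J where "J = angmom (mom p) (pos p)"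
  obtain k where k: "k > 0" and kf: "kf_mom \<mu> M f (mom p) (pos p) = k *\<^sub>R mom p" and a: "a > 0"
    and sm: "semi_major \<mu> M (k *\<^sub>R mom p) (pos p) = a"
    and J: "J = - ((m / 2) *\<^sub>R v)"
    and J': "angmom (k *\<^sub>R mom p) (pos p) = k *\<^sub>R J"
    and ev: "ecc_vec \<mu> M (k *\<^sub>R mom p) (pos p) = (1 / (2 * a)) *\<^sub>R E"
    using rescaled_state[OF p z] unfolding a_def J_def by metis
  have nv: "norm v > 0" and nE: "norm E > 0" using v E by simp_all
  have ecc: "ecc \<mu> M (k *\<^sub>R mom p) (pos p) = norm E / (2 * a)"
    using a by (simp add: ecc_def ev)
  have E2: "(norm E)\<^sup>2 = 4 * (a\<^sup>2 - (norm v)\<^sup>2)"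
    unfolding norm_E' by (simp add: a_def power_divide)
  moreover have "(norm E)\<^sup>2 > 0" using nE by simp
  ultimately have "4 * (a\<^sup>2 - (norm v)\<^sup>2) > 0" by metis
  then have "(norm v)\<^sup>2 < a\<^sup>2" by simp
  then have av: "norm v < a"
    using a by (rule power2_less_imp_less[OF _ less_imp_le])
  have "1 - (norm E / (2 * a))\<^sup>2 = (norm v / a)\<^sup>2"
    using a by (simp add: power_divide E2 field_simps)
  then have root: "sqrt (1 - (norm E / (2 * a))\<^sup>2) = norm v / a"
    using a by simp
  have nJ: "norm J = m / 2 * norm v" using m_pos by (simp add: J)
  have J0: "norm J > 0" unfolding nJ using m_pos nv by simp
  have sgns: "sgn ((1 / (2 * a)) *\<^sub>R E) = (1 / norm E) *\<^sub>R E" "sgn (k *\<^sub>R J) = (1 / norm J) *\<^sub>R J"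
      "(1 / norm J) *\<^sub>R J = - ((1 / norm v) *\<^sub>R v)"
  proof -
    show "sgn ((1 / (2 * a)) *\<^sub>R E) = (1 / norm E) *\<^sub>R E" "sgn (k *\<^sub>R J) = (1 / norm J) *\<^sub>R J"
      using a k sgn_pos_scaleR[of "1 / (2 * a)" E] sgn_pos_scaleR[of k J] by simp_all
    show "(1 / norm J) *\<^sub>R J = - ((1 / norm v) *\<^sub>R v)"
      unfolding nJ unfolding J using m_pos nv by simp
  qed
  have coords: "L = sqrt (2 * f) * (Del_L \<mu> M (k *\<^sub>R mom p) (pos p))\<^sup>2 / (\<mu> powr (3/2) * M)"
    "d = ecc_anomaly \<mu> M (k *\<^sub>R mom p) (pos p)"
    "G = sqrt (2 * f) * Del_L \<mu> M (k *\<^sub>R mom p) (pos p) * Del_G \<mu> M (k *\<^sub>R mom p) (pos p) / (\<mu> powr (3/2) * M)"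
    "g = Del_g \<mu> M (k *\<^sub>R mom p) (pos p)" "H = J $ 3" "h = Del_h (mom p) (pos p)"
    using LCF by (auto simp: LCF_def PQ_proj kf Let_def J_def)
  \<comment> \<open>\<open>Del_L\<close> enters the first coordinate through its square, so the coordinate is linear in the semi major axis.\<close>
  have mh: "sqrt (2 * f) * (\<mu> * sqrt M * sqrt a)\<^sup>2 / (\<mu> powr (3/2) * M) = m / 2 * a"
  proof -
    have "(\<mu> * sqrt M * sqrt a)\<^sup>2 = \<mu>\<^sup>2 * M * a"
      using pos a by (simp add: power_mult_distrib)
    also have "\<dots> = (\<mu> * (sqrt \<mu> * sqrt \<mu>)) * M * a"
      using pos by (simp add: power2_eq_square)
    also have "\<dots> = (\<mu> powr (3/2) * M) * (sqrt \<mu> * a)"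
      unfolding powr_three_halves by (simp only: mult_ac)
    finally show ?thesis
      using pos by (simp add: m_def real_sqrt_mult)
  qed
  have L: "L = m / 2 * a"
    unfolding coords(1) Del_L_def sm by (rule mh)
  have "G = L * (norm v / a)"
    unfolding coords(1,3) Del_G_def ecc root by (simp add: power2_eq_square mult_ac)
  then have G: "G = m / 2 * norm v" using a by (simp add: L)
  have GJ: "G = norm J" by (simp add: G nJ)
  have GL: "G < L" using av m_pos by (simp add: G L)
  have e3J: "cross3 (axis 3 1) J = vector [- J $ 2, J $ 1, 0]"
    by (simp add: vec_eq_iff forall_3 cross_components axis_def vector_3)
  have e3J0: "cross3 (axis 3 1) J \<noteq> 0"
    using e3v m_pos by (simp add: J cross_mult_right)
  have e3J2: "(norm (cross3 (axis 3 1) J))\<^sup>2 = G\<^sup>2 - H\<^sup>2"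
    using norm_cross_dot[of "axis 3 1" J] by (simp add: GJ coords(5) inner_axis' norm_axis_1)
  have e3J1: "norm (cross3 (axis 3 1) J) = sqrt (G\<^sup>2 - H\<^sup>2)"
    unfolding e3J2[symmetric] by simp
  have "H\<^sup>2 < G\<^sup>2"
    using e3J0 e3J2 by (smt (verit) zero_less_power2 norm_eq_zero)
  then have HG: "\<bar>H\<bar> < G"
    using GJ by (metis abs_le_square_iff abs_norm_cancel not_le)
  have scale: "ecc_scale L G = norm E"
  proof -
    have "L\<^sup>2 - G\<^sup>2 = (m / 4 * norm E)\<^sup>2"
      unfolding power_mult_distrib E2 L G by (simp add: power2_eq_square algebra_simps)
    then show ?thesis using m_pos by (simp add: ecc_scale_def)
  qed
  \<comment> \<open>The node of the rescaled state is that of the original one, because their angular momenta are positive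
    multiples of each other.\<close>
  have node_dir: "node_dir P Q = (1 / sqrt (G\<^sup>2 - H\<^sup>2)) *\<^sub>R cross3 (axis 3 1) J"
    if "angmom P Q = c *\<^sub>R J" "c > 0" for P Q c
    unfolding node_dir_def that(1) e3J1[symmetric] cross_mult_right by (rule sgn_pos_scaleR[OF that(2)])
  have n1: "node_dir (mom p) (pos p) = (1 / sqrt (G\<^sup>2 - H\<^sup>2)) *\<^sub>R cross3 (axis 3 1) J"
    using node_dir[of "mom p" "pos p" 1] by (simp add: J_def)
  have h: "cos h = - J $ 2 / sqrt (G\<^sup>2 - H\<^sup>2) \<and> sin h = J $ 1 / sqrt (G\<^sup>2 - H\<^sup>2)"
    unfolding coords(6) Del_h_def
  proof (rule angle_in)
    have "(J $ 2)\<^sup>2 + (J $ 1)\<^sup>2 = G\<^sup>2 - H\<^sup>2"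
      unfolding e3J2[symmetric] e3J power2_norm_eq_inner 
      by (simp add: inner_vec_def sum_3 vector_3 power2_eq_square)
    moreover have "G\<^sup>2 - H\<^sup>2 > 0" using \<open>H\<^sup>2 < G\<^sup>2\<close> by simp
    ultimately show "(- J $ 2 / sqrt (G\<^sup>2 - H\<^sup>2))\<^sup>2 + (J $ 1 / sqrt (G\<^sup>2 - H\<^sup>2))\<^sup>2 = 1"
      by (simp add: power_divide flip: add_divide_distrib)
    show "node_dir (mom p) (pos p) = (- J $ 2 / sqrt (G\<^sup>2 - H\<^sup>2)) *\<^sub>R axis 1 1 + (J $ 1 / sqrt (G\<^sup>2 - H\<^sup>2)) *\<^sub>R axis 2 1"
      unfolding n1 e3J by (simp add: vec_eq_iff forall_3 axis_def vector_3)
  qed (simp_all add: inner_axis_axis)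
  then have node: "node h = node_dir (mom p) (pos p)"
    unfolding n1 e3J node_def by (simp add: vec_eq_iff forall_3 axis_def vector_3)
  have jvec: "jvec G H h = J"
    using h e3J0 \<open>H\<^sup>2 < G\<^sup>2\<close>
    by (simp add: jvec_def node_def vec_eq_iff forall_3 cross_components axis_def coords(5))
  note jn = jvec_inner(1,2)[OF HG, of h, unfolded jvec]
  have "cos g = ((1 / norm E) *\<^sub>R E) \<bullet> node h \<and> 
      sin g = ((1 / norm E) *\<^sub>R E) \<bullet> cross3 ((1 / norm J) *\<^sub>R J) (node h)"
    and "(1 / norm E) *\<^sub>R E = (((1 / norm E) *\<^sub>R E) \<bullet> node h) *\<^sub>R node h +
      (((1 / norm E) *\<^sub>R E) \<bullet> cross3 ((1 / norm J) *\<^sub>R J) (node h)) *\<^sub>R cross3 ((1 / norm J) *\<^sub>R J) (node h)"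
  proof -
    have "((1 / norm E) *\<^sub>R E) \<bullet> ((1 / norm E) *\<^sub>R E) = 1" "((1 / norm J) *\<^sub>R J) \<bullet> ((1 / norm J) *\<^sub>R J) = 1"
      using nE J0 by (simp_all add: dot_square_norm power2_eq_square)
    moreover have "node h \<bullet> ((1 / norm J) *\<^sub>R J) = 0" using jn by simp
    moreover have "((1 / norm E) *\<^sub>R E) \<bullet> ((1 / norm J) *\<^sub>R J) = 0" 
      unfolding sgns(3) using E_dot_v by simp
    ultimately have frame: "node h \<bullet> node h = 1"
      "((1 / norm J) *\<^sub>R J) \<bullet> ((1 / norm J) *\<^sub>R J) = 1" "((1 / norm E) *\<^sub>R E) \<bullet> ((1 / norm E) *\<^sub>R E) = 1"
      "node h \<bullet> ((1 / norm J) *\<^sub>R J) = 0" "((1 / norm E) *\<^sub>R E) \<bullet> ((1 / norm J) *\<^sub>R J) = 0"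
      using node_inner(1) by blast+
    note u = unit_vector_in_plane[OF frame]
    have nd: "node_dir (k *\<^sub>R mom p) (pos p) = node h"
      using node_dir[OF J' k] n1 node by simp
    show "cos g = ((1 / norm E) *\<^sub>R E) \<bullet> node h \<and> 
      sin g = ((1 / norm E) *\<^sub>R E) \<bullet> cross3 ((1 / norm J) *\<^sub>R J) (node h)"
      unfolding coords(4) Del_g_def nd J' ev sgns(1,2)
      by (rule angle_in[OF node_inner(1) u(3,4,2,1)])
    show "(1 / norm E) *\<^sub>R E = (((1 / norm E) *\<^sub>R E) \<bullet> node h) *\<^sub>R node h +
      (((1 / norm E) *\<^sub>R E) \<bullet> cross3 ((1 / norm J) *\<^sub>R J) (node h)) *\<^sub>R cross3 ((1 / norm J) *\<^sub>R J) (node h)"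
      by (rule u(1))
  qed
  then have "(1 / norm E) *\<^sub>R E = cos g *\<^sub>R node h + sin g *\<^sub>R cross3 ((1 / norm J) *\<^sub>R J) (node h)"
    by metis
  then have "(1 / norm E) *\<^sub>R E = apsis G g H h"
    unfolding apsis_def jvec unfolding GJ cross_mult_left .
  then have "norm E *\<^sub>R ((1 / norm E) *\<^sub>R E) = norm E *\<^sub>R apsis G g H h" by simp
  then have E_apsis: "E = norm E *\<^sub>R apsis G g H h" using nE by simp
  have d: "cos d = ((norm (vel p))\<^sup>2 - (norm (fst p))\<^sup>2) / norm E \<and> sin d = 2 * r / norm E"
    unfolding coords(2) ecc_anomaly_def
  proof (rule the_angle)
    show "(((norm (vel p))\<^sup>2 - (norm (fst p))\<^sup>2) / norm E)\<^sup>2 + (2 * r / norm E)\<^sup>2 = 1"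
      unfolding power_divide add_divide_distrib[symmetric] norm_E[symmetric] using nE by simp
    show "(let a = semi_major \<mu> M (k *\<^sub>R mom p) (pos p); e = ecc \<mu> M (k *\<^sub>R mom p) (pos p);
           x = sgn (ecc_vec \<mu> M (k *\<^sub>R mom p) (pos p)); y = cross3 (sgn (angmom (k *\<^sub>R mom p) (pos p))) x
       in pos p = (a * (cos u - e)) *\<^sub>R x + (a * sqrt (1 - e\<^sup>2) * sin u) *\<^sub>R y) \<longleftrightarrow>
      cos u = ((norm (vel p))\<^sup>2 - (norm (fst p))\<^sup>2) / norm E \<and> sin u = 2 * r / norm E" for u
      using ecc_anomaly_eq[OF level_pair_Sigma0[OF p] E v, of u] a
      unfolding Let_def sm ecc root J' ev sgns unfolding pos_eq a_def[symmetric] by simp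
  qed
  show ?thesis
    unfolding elements_def scale
  proof (intro conjI)
    show "(norm (fst p))\<^sup>2 + (norm (vel p))\<^sup>2 = 4 * L / m"
      using m_pos by (simp add: L a_def)
    show "v = - ((2 / m) *\<^sub>R jvec G H h)"
      using m_pos by (simp add: jvec J)
  qed (use p GL HG d nE E_apsis in \<open>simp_all\<close>)
qed

end

section \<open>A symplectic section\<close>

lemma norm_eq_1I: "(norm x)\<^sup>2 = 1 \<Longrightarrow> norm x = 1"
  by (rule power2_eq_imp_eq) simp_all

text \<open>As \<open>z \<odot> q\<close> has the position of \<open>z\<close> rotated by \<open>rot q\<close>, an orbit in standard position is oriented by
  multiplication from the right.\<close>

definition rot :: "quat \<Rightarrow> real^3 \<Rightarrow> real^3" where
  "rot q x = snd (qcnj q \<odot> (0, x) \<odot> q)"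

lemma rot_linear: "rot q (x + y) = rot q x + rot q y" "rot q (c *\<^sub>R x) = c *\<^sub>R rot q x"
proof -
  have "(0, x + y) = (0 :: real, x) + (0, y)" "(0, c *\<^sub>R x) = c *\<^sub>R (0 :: real, x)" by simp_all
  then show "rot q (x + y) = rot q x + rot q y" "rot q (c *\<^sub>R x) = c *\<^sub>R rot q x"
    unfolding rot_def by (simp_all only: qmul_linear snd_add snd_scaleR)
qed

lemma sandwich: "norm q = 1 \<Longrightarrow> qcnj q \<odot> (s, x) \<odot> q = (s, rot q x)"
proof -
  assume q: "norm q = 1"
  define X :: quat where "X = (0, x)"
  have "qcnj X = - X" by (simp add: X_def qcnj_def)
  then have "qcnj (qcnj q \<odot> X \<odot> q) = - (qcnj q \<odot> X \<odot> q)"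
    by (simp add: qcnj_qmul qmul_assoc qmul_linear)
  then have "fst (qcnj q \<odot> (0, x) \<odot> q) = 0" by (simp add: prod_eq_iff X_def)
  then have 1: "qcnj q \<odot> (0, x) \<odot> q = (0, rot q x)" by (simp add: rot_def prod_eq_iff)
  have "qcnj q \<odot> (s, 0) \<odot> q = (s, 0)"
    using q by (simp add: qmul_scalar qmul_linear qmul_qcnj)
  moreover have "(s, x) = (s, 0) + (0, x)" by simp
  ultimately show ?thesis
    by (simp only: qmul_linear 1) simp
qed

lemma rot_comp:
  assumes "norm p = 1" "norm q = 1"
  shows "rot (p \<odot> q) x = rot q (rot p x)"
proof -
  have "(0, rot (p \<odot> q) x) = qcnj q \<odot> (qcnj p \<odot> (0, x) \<odot> p) \<odot> q"
    using assms by (simp add: norm_qmul qcnj_qmul qmul_assoc flip: sandwich)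
  then show ?thesis
    using assms by (simp add: sandwich)
qed

text \<open>Rotations about the vertical and about the first axis; \<open>c\<close> and \<open>s\<close> are the cosine and the sine of half of
  the angle.\<close>

lemma rot_axis:
  "rot (c, - (s *\<^sub>R axis 3 1)) (axis 1 1) = (c\<^sup>2 - s\<^sup>2) *\<^sub>R axis 1 1 + (2 * c * s) *\<^sub>R axis 2 1"
  "rot (c, - (s *\<^sub>R axis 3 1)) (axis 2 1) = - (2 * c * s) *\<^sub>R axis 1 1 + (c\<^sup>2 - s\<^sup>2) *\<^sub>R axis 2 1"
  "rot (c, - (s *\<^sub>R axis 3 1)) (axis 3 1) = (c\<^sup>2 + s\<^sup>2) *\<^sub>R axis 3 1"
  "rot (c, - (s *\<^sub>R axis 1 1)) (axis 1 1) = (c\<^sup>2 + s\<^sup>2) *\<^sub>R axis 1 1"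
  "rot (c, - (s *\<^sub>R axis 1 1)) (axis 2 1) = (c\<^sup>2 - s\<^sup>2) *\<^sub>R axis 2 1 + (2 * c * s) *\<^sub>R axis 3 1"
  "rot (c, - (s *\<^sub>R axis 1 1)) (axis 3 1) = (c\<^sup>2 - s\<^sup>2) *\<^sub>R axis 3 1 - (2 * c * s) *\<^sub>R axis 2 1"
  by (simp_all add: rot_def qmul_def qcnj_def vec_eq_iff forall_3 cross_components axis_def inner_vec_def sum_3
      power2_eq_square algebra_simps)

text \<open>Quaternions in the span of the units 1 and k. On them the Hopf map is the complex square of the
  Levi-Civita regularization.\<close>

definition planar :: "real \<Rightarrow> real \<Rightarrow> quat" where
  "planar x y = (x, - (y *\<^sub>R axis 3 1))"

lemma planar_products:
  "qcnj (planar x y) \<odot> qi \<odot> planar x' y' = (0, (x * x' - y * y') *\<^sub>R axis 1 1 + (x * y' + y * x') *\<^sub>R axis 2 1)"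
  "qcnj (planar x y) \<odot> planar x' y' = (x * x' + y * y', (y * x' - x * y') *\<^sub>R axis 3 1)"
  by (simp_all add: planar_def qi_def qmul_def qcnj_def vec_eq_iff forall_3 cross_components axis_def inner_vec_def sum_3
      algebra_simps)

lemma norm_planar: "(norm (planar x y))\<^sup>2 = x\<^sup>2 + y\<^sup>2"
  by (simp add: planar_def norm_quat norm_axis_1)

context kepler
begin

text \<open>The Euler rotation: the argument of pericenter about the vertical, the inclination about the first axis,
  the node about the vertical. The middle factor contains cosine and sine of half of the inclination, whose
  cosine is \<open>H / G\<close>.\<close>

definition orient :: "real \<Rightarrow> real \<Rightarrow> real \<Rightarrow> real \<Rightarrow> quat" where
  "orient G g H h = planar (cos (g / 2)) (sin (g / 2)) \<odot>
     (sqrt ((G + H) / (2 * G)), - (sqrt ((G - H) / (2 * G)) *\<^sub>R axis 1 1)) \<odot>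
     planar (cos (h / 2)) (sin (h / 2))"

lemma norm_orient:
  assumes "\<bar>H\<bar> < G"
  shows "norm (orient G g H h) = 1"
proof -
  have half: "norm (planar (cos (x / 2)) (sin (x / 2))) = 1" for x
    by (rule norm_eq_1I) (simp add: norm_planar)
  have "(norm (sqrt ((G + H) / (2 * G)), - (sqrt ((G - H) / (2 * G)) *\<^sub>R (axis 1 1 :: real^3))))\<^sup>2 = 1"
    using assms by (simp add: norm_quat norm_axis_1 power_mult_distrib field_simps)
  from norm_eq_1I[OF this] show ?thesis
    using half by (simp add: orient_def norm_qmul)
qed

lemma rot_orient:
  assumes H: "\<bar>H\<bar> < G"
  shows "G *\<^sub>R rot (orient G g H h) (axis 3 1) = jvec G H h" "rot (orient G g H h) (axis 1 1) = apsis G g H h"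
proof -
  have G: "G > 0" using H by auto
  let ?c = "sqrt ((G + H) / (2 * G))" and ?s = "sqrt ((G - H) / (2 * G))"
  have half: "norm (planar (cos (x / 2)) (sin (x / 2))) = 1" for x
    by (rule norm_eq_1I) (simp add: norm_planar)
  have c2: "?c\<^sup>2 = (G + H) / (2 * G)" and s2: "?s\<^sup>2 = (G - H) / (2 * G)"
    using H by simp_all
  have cs: "?c\<^sup>2 - ?s\<^sup>2 = H / G" "?c\<^sup>2 + ?s\<^sup>2 = 1"
    unfolding c2 s2 using G by (simp_all add: field_simps)
  have sn: "2 * ?c * ?s = sqrt (G\<^sup>2 - H\<^sup>2) / G"
  proof -
    have "?c * ?s = sqrt ((G + H) * (G - H) / (2 * G)\<^sup>2)"
      by (simp add: real_sqrt_mult[symmetric] power2_eq_square)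
    also have "\<dots> = sqrt (G\<^sup>2 - H\<^sup>2) / (2 * G)"
    proof -
      have "(G + H) * (G - H) = G\<^sup>2 - H\<^sup>2" by (simp add: power2_eq_square algebra_simps)
      then show ?thesis unfolding real_sqrt_divide real_sqrt_abs using G by simp
    qed
    finally show ?thesis using G by simp
  qed
  have "norm (?c, - (?s *\<^sub>R (axis 1 1 :: real^3))) = 1"
    by (rule norm_eq_1I) (use cs(2) in \<open>simp add: norm_quat norm_axis_1 del: real_sqrt_pow2_iff real_sqrt_pow2\<close>)
  then have comp: "rot (orient G g H h) x = rot (planar (cos (h / 2)) (sin (h / 2)))
      (rot (?c, - (?s *\<^sub>R axis 1 1)) (rot (planar (cos (g / 2)) (sin (g / 2))) x))" for x
    unfolding orient_def by (simp add: rot_comp half norm_qmul)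
  have dbl: "(cos (x / 2))\<^sup>2 - (sin (x / 2))\<^sup>2 = cos x" "2 * cos (x / 2) * sin (x / 2) = sin x" for x :: real
    using cos_double[of "x/2"] sin_double[of "x/2"] by simp_all
  note rots = rot_axis[of "cos (x/2)" "sin (x/2)" for x, folded planar_def, unfolded dbl sin_cos_squared_add2]
    rot_axis(4-6)[of ?c ?s, unfolded cs sn]
  have minus: "rot q (- x) = - rot q x" "rot q (x - y) = rot q x - rot q y" for q x y
    using rot_linear(2)[of q "-1"] rot_linear(1)[of q x "-y"] by simp_all
  have vec: "cross3 (node h) (axis 3 1) = sin h *\<^sub>R axis 1 1 - cos h *\<^sub>R axis 2 1"
    by (simp add: node_def vec_eq_iff forall_3 cross_components axis_def)
  show 3: "G *\<^sub>R rot (orient G g H h) (axis 3 1) = jvec G H h"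
    unfolding comp jvec_def vec using G 
    by (simp add: rots rot_linear minus) (simp add: algebra_simps)
  have "cross3 (jvec G H h) (node h) = sqrt (G\<^sup>2 - H\<^sup>2) *\<^sub>R axis 3 1 + H *\<^sub>R (cos h *\<^sub>R axis 2 1 - sin h *\<^sub>R axis 1 1)"
  proof -
    have "cross3 (sin h *\<^sub>R axis 1 1 - cos h *\<^sub>R axis 2 1) (node h) = axis 3 1"
      "cross3 (axis 3 1) (node h) = cos h *\<^sub>R axis 2 1 - sin h *\<^sub>R axis 1 1"
      by (simp_all add: node_def vec_eq_iff forall_3 cross_components axis_def flip: power2_eq_square)
    then show ?thesis
      unfolding jvec_def vec by (simp add: cross_add_left cross_mult_left)
  qed
  then show "rot (orient G g H h) (axis 1 1) = apsis G g H h"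
    unfolding comp apsis_def using G
    by (simp add: rots rot_linear minus node_def) (simp add: algebra_simps)
qed

text \<open>In the apsidal frame of the orbital plane the oscillator \<open>z\<close> has the semi axes \<open>\<sigma> - \<tau>\<close> and \<open>\<sigma> + \<tau>\<close> and
  the phase \<open>d / 2\<close>; \<open>b\<close> is its derivative with respect to the phase.\<close>

definition lift :: "real \<Rightarrow> real \<Rightarrow> real \<Rightarrow> real \<Rightarrow> real \<Rightarrow> real \<Rightarrow> qpair" where
  "lift L d G g H h = (let \<sigma> = sqrt ((L + G) / m); \<tau> = sqrt ((L - G) / m) in
     (planar ((\<sigma> - \<tau>) * cos (d / 2)) ((\<sigma> + \<tau>) * sin (d / 2)) \<odot> orient G g H h,
      m *\<^sub>R (planar (- (\<sigma> - \<tau>) * sin (d / 2)) ((\<sigma> + \<tau>) * cos (d / 2)) \<odot> orient G g H h)))"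

lemma lift_elements:
  assumes "G < L" "\<bar>H\<bar> < G"
  shows "elements (lift L d G g H h) L d G g H h"
proof -
  define \<sigma> where "\<sigma> = sqrt ((L + G) / m)"
  define \<tau> where "\<tau> = sqrt ((L - G) / m)"
  define x where "x = (\<sigma> - \<tau>) * cos (d / 2)"
  define y where "y = (\<sigma> + \<tau>) * sin (d / 2)"
  define x' where "x' = - (\<sigma> - \<tau>) * sin (d / 2)"
  define y' where "y' = (\<sigma> + \<tau>) * cos (d / 2)"
  define q where "q = orient G g H h"
  define p where "p = lift L d G g H h"
  have G: "G > 0" using assms by auto
  have z: "fst p = planar x y \<odot> q" and b: "vel p = planar x' y' \<odot> q"
    using m_pos by (simp_all add: p_def lift_def Let_def vel_def \<sigma>_def \<tau>_def x_def y_def x'_def y'_def q_def)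
  have q: "norm q = 1" unfolding q_def by (rule norm_orient[OF assms(2)])
  have st: "\<sigma>\<^sup>2 = (L + G) / m" "\<tau>\<^sup>2 = (L - G) / m" "4 * \<sigma> * \<tau> = ecc_scale L G"
  proof -
    show "\<sigma>\<^sup>2 = (L + G) / m" "\<tau>\<^sup>2 = (L - G) / m"
      using G assms(1) m_pos by (simp_all add: \<sigma>_def \<tau>_def)
    have "\<sigma> * \<tau> = sqrt ((L\<^sup>2 - G\<^sup>2) / m\<^sup>2)"
      unfolding \<sigma>_def \<tau>_def real_sqrt_mult[symmetric] 
      by (rule arg_cong[of _ _ sqrt]) (simp add: power2_eq_square algebra_simps)
    then show "4 * \<sigma> * \<tau> = ecc_scale L G"
      using m_pos by (simp add: ecc_scale_def real_sqrt_divide)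
  qed
  have cd: "cos d = (cos (d / 2))\<^sup>2 - (sin (d / 2))\<^sup>2" and sd: "sin d = 2 * sin (d / 2) * cos (d / 2)"
    and one: "(cos (d / 2))\<^sup>2 + (sin (d / 2))\<^sup>2 = 1"
    using cos_double[of "d / 2"] sin_double[of "d / 2"] by simp_all
  have prod: "qcnj (u \<odot> q) \<odot> X \<odot> (w \<odot> q) = qcnj q \<odot> (qcnj u \<odot> X \<odot> w) \<odot> q" for u w X
    by (simp add: qcnj_qmul qmul_assoc)
  have prod': "qcnj (u \<odot> q) \<odot> (w \<odot> q) = qcnj q \<odot> (qcnj u \<odot> w) \<odot> q" for u w
    by (simp add: qcnj_qmul qmul_assoc)
  note products = prod prod' planar_products sandwich[OF q]
  have nz: "(norm (fst p))\<^sup>2 = x\<^sup>2 + y\<^sup>2" and nb: "(norm (vel p))\<^sup>2 = x'\<^sup>2 + y'\<^sup>2"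
    using q by (simp_all add: z b norm_qmul norm_planar)
  have sum: "(norm (fst p))\<^sup>2 + (norm (vel p))\<^sup>2 = 4 * L / m"
  proof -
    have "x\<^sup>2 + y\<^sup>2 + (x'\<^sup>2 + y'\<^sup>2) = 2 * \<sigma>\<^sup>2 + 2 * \<tau>\<^sup>2"
      unfolding x_def y_def x'_def y'_def using one by algebra
    also have "\<dots> = 4 * L / m"
      unfolding st by (simp add: add_divide_distrib diff_divide_distrib)
    finally show ?thesis unfolding nz nb .
  qed
  have diff: "(norm (vel p))\<^sup>2 - (norm (fst p))\<^sup>2 = ecc_scale L G * cos d"
    unfolding nz nb st(3)[symmetric] cd x_def y_def x'_def y'_def by algebra
  have rho: "qcnj (fst p) \<odot> vel p = (x * x' + y * y', rot q ((y * x' - x * y') *\<^sub>R axis 3 1))"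
    unfolding z b products ..
  have r: "2 * (x * x' + y * y') = ecc_scale L G * sin d"
    unfolding st(3)[symmetric] sd x_def y_def x'_def y'_def by algebra
  have "y * x' - x * y' = - (\<sigma>\<^sup>2 - \<tau>\<^sup>2)"
    unfolding x_def y_def x'_def y'_def using one by algebra
  also have "\<dots> = - (2 / m) * G"
    unfolding st by (simp add: add_divide_distrib diff_divide_distrib)
  finally have yx: "y * x' - x * y' = - (2 / m) * G" .
  have v: "rot q ((y * x' - x * y') *\<^sub>R axis 3 1) = - ((2 / m) *\<^sub>R jvec G H h)"
    unfolding yx rot_linear(2) rot_orient(1)[OF assms(2), of g h, symmetric] q_def by simp
  have ivecs: "ivec (fst p) (fst p) = rot q ((x * x - y * y) *\<^sub>R axis 1 1 + (x * y + y * x) *\<^sub>R axis 2 1)"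
    "ivec (vel p) (vel p) = rot q ((x' * x' - y' * y') *\<^sub>R axis 1 1 + (x' * y' + y' * x') *\<^sub>R axis 2 1)"
    unfolding ivec_def z b products by simp_all
  have E: "evec (fst p) (vel p) = ecc_scale L G *\<^sub>R apsis G g H h"
  proof -
    have 1: "(x * x - y * y) + (x' * x' - y' * y') = - (4 * \<sigma> * \<tau>)" 
      unfolding x_def y_def x'_def y'_def using one by algebra
    have 2: "x * y + x' * y' = 0"
      unfolding x_def y_def x'_def y'_def by (simp add: algebra_simps)
    have "evec (fst p) (vel p) = - (((x * x - y * y) + (x' * x' - y' * y')) *\<^sub>R rot q (axis 1 1) +
        (2 * (x * y + x' * y')) *\<^sub>R rot q (axis 2 1))"
      unfolding evec_def ivecs rot_linear by (simp add: algebra_simps)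
    then show ?thesis
      unfolding 1 2 st(3) using rot_orient(2)[OF assms(2), of g h] by (simp add: q_def)
  qed
  have "bilin p = 0"
  proof -
    have "snd p = m *\<^sub>R vel p" using m_pos by (simp add: vel_def)
    moreover have "fst (qcnj (fst p) \<odot> qi \<odot> vel p) = 0"
      unfolding z b products by simp
    ultimately show ?thesis by (simp add: bilin_eq qmul_linear)
  qed
  moreover have "p \<noteq> 0"
  proof
    assume "p = 0"
    then have "4 * L / m = 0" using sum by (simp add: vel_def)
    then show False using G assms(1) m_pos by simp
  qed
  ultimately have "p \<in> Sigma0" by (simp add: Sigma0_iff)
  with assms sum diff rho r v E show ?thesis
    unfolding p_def[symmetric] elements_def by simp
qed

end

context kepler
begin

definition element_domain :: "real6 set" where
  "element_domain = {(L, d, G, g, H, h). G < L \<and> \<bar>H\<bar> < G}"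

definition lift6 :: "real6 \<Rightarrow> qpair" where
  "lift6 = (\<lambda>(L, d, G, g, H, h). lift L d G g H h)"

lemma element_domain_iff: "c \<in> element_domain \<longleftrightarrow> fst (snd (snd c)) < fst c \<and> \<bar>fst (snd (snd (snd (snd c))))\<bar> < fst (snd (snd c))"
  by (auto simp: element_domain_def)

lemma element_domain_G_pos: "c \<in> element_domain \<Longrightarrow> fst (snd (snd c)) > 0"
  unfolding element_domain_iff by linarith

lemma open_element_domain: "open element_domain"
proof -
  have "element_domain = {c. fst (snd (snd c)) < fst c} \<inter> {c. \<bar>fst (snd (snd (snd (snd c))))\<bar> < fst (snd (snd c))}"
    by (auto simp: element_domain_iff)
  show ?thesis
    unfolding \<open>element_domain = _\<close> by (intro open_Int open_Collect_less continuous_intros)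
qed

lemma smooth_lift6: "smooth_on element_domain lift6"
proof -
  have pos: "0 < (fst c + fst (snd (snd c))) / m" "0 < (fst c - fst (snd (snd c))) / m"
    "0 < (fst (snd (snd c)) + fst (snd (snd (snd (snd c))))) / (2 * fst (snd (snd c)))"
    "0 < (fst (snd (snd c)) - fst (snd (snd (snd (snd c))))) / (2 * fst (snd (snd c)))"
    "2 * fst (snd (snd c)) \<noteq> 0" if "c \<in> element_domain" for c
    using that m_pos element_domain_G_pos[OF that] unfolding element_domain_iff by (auto intro!: divide_pos_pos)
  show ?thesis
    unfolding lift6_def split_beta lift_def Let_def orient_def planar_def
    by (intro smooth_intros open_element_domain pos) 
qed

text \<open>A linear symplectic change of coordinates: up to the factor \<open>2 m\<close>, \<open>omega\<close> is the sum of the four forms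
  \<open>dx \<and> dy\<close> with sign \<open>e\<close>, where the pairs \<open>(x e k, y e k)\<close> are indexed by \<open>e = \<plusminus>1\<close> and \<open>k = \<plusminus>1\<close>.\<close>

definition assemble :: "(real \<Rightarrow> real \<Rightarrow> real) \<Rightarrow> (real \<Rightarrow> real \<Rightarrow> real) \<Rightarrow> qpair" where
  "assemble x y =
     ((x 1 1 - x (-1) 1, (x (-1) (-1) - x 1 (-1)) *\<^sub>R axis 1 1 + (y 1 (-1) - y (-1) (-1)) *\<^sub>R axis 2 1
        + (y (-1) 1 - y 1 1) *\<^sub>R axis 3 1),
      m *\<^sub>R (- y 1 1 - y (-1) 1, (y 1 (-1) + y (-1) (-1)) *\<^sub>R axis 1 1 + (x 1 (-1) + x (-1) (-1)) *\<^sub>R axis 2 1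
        - (x 1 1 + x (-1) 1) *\<^sub>R axis 3 1))"

lemma omega_assemble:
  "omega (assemble x y) (assemble x' y') = 
    2 * m * ((x 1 1 * y' 1 1 - y 1 1 * x' 1 1) - (x (-1) 1 * y' (-1) 1 - y (-1) 1 * x' (-1) 1)
      + (x 1 (-1) * y' 1 (-1) - y 1 (-1) * x' 1 (-1)) - (x (-1) (-1) * y' (-1) (-1) - y (-1) (-1) * x' (-1) (-1)))"
  unfolding omega_inner assemble_def
  by (simp add: inner_vec_def sum_3 axis_def) (simp add: algebra_simps)

text \<open>The index \<open>e\<close> is the orientation of the oscillation in the orbital plane, that is, the sign of \<open>\<delta>\<close> in
  its phase, and \<open>k\<close> is the sign with which the node enters.\<close>

definition amp :: "real \<Rightarrow> real \<Rightarrow> real6 \<Rightarrow> real" where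
  "amp e k = (\<lambda>(L, d, G, g, H, h). sqrt ((L + e * G) / m) * sqrt ((G + k * H) / (2 * G)))"

definition phase :: "real \<Rightarrow> real \<Rightarrow> real6 \<Rightarrow> real" where
  "phase e k = (\<lambda>(L, d, G, g, H, h). (e * d + g + k * h) / 2)"

lemma lift6_assemble:
  "lift6 c = assemble (\<lambda>e k. amp e k c * cos (phase e k c)) (\<lambda>e k. amp e k c * sin (phase e k c))"
proof -
  obtain L d G g H h where c: "c = (L, d, G, g, H, h)" by (cases c)
  have add: "(d + g + h) / 2 = d / 2 + g / 2 + h / 2" "(- d + g + h) / 2 = - (d / 2) + g / 2 + h / 2"
    "(d + g - h) / 2 = d / 2 + g / 2 - h / 2" "(- d + g - h) / 2 = - (d / 2) + g / 2 - h / 2"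
    by (simp_all add: field_simps)
  show ?thesis
    unfolding c lift6_def lift_def Let_def orient_def planar_def assemble_def amp_def phase_def split mult_1 mult_minus1
      add.inverse_inverse diff_conv_add_uminus[symmetric] add cos_add sin_add cos_diff sin_diff cos_minus sin_minus
    by (simp add: qmul_def prod_eq_iff vec_eq_iff forall_3 cross_components axis_def inner_vec_def sum_3)
      (simp add: algebra_simps)
qed

lemma amp_sq:
  assumes "c \<in> element_domain" "e \<in> {1, -1}" "k \<in> {1, -1}"
  shows "amp e k c * amp e k c = 
    (fst c + e * fst (snd (snd c))) * (1 + k * (fst (snd (snd (snd (snd c)))) / fst (snd (snd c)))) / (2 * m)"
proof -
  obtain L d G g H h where c: "c = (L, d, G, g, H, h)" by (cases c)
  have *: "G < L" "\<bar>H\<bar> < G" using assms(1) by (simp_all add: c element_domain_def)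
  then have "(L + e * G) / m \<ge> 0" "(G + k * H) / (2 * G) \<ge> 0"
    using assms(2,3) m_pos by auto
  then have "amp e k c * amp e k c = (L + e * G) / m * ((G + k * H) / (2 * G))"
  proof -
    have "(sqrt a * sqrt b) * (sqrt a * sqrt b) = a * b" if "a \<ge> 0" "b \<ge> 0" for a b :: real
      using that by (metis abs_of_nonneg mult_nonneg_nonneg real_sqrt_mult real_sqrt_mult_self)
    with \<open>(L + e * G) / m \<ge> 0\<close> \<open>(G + k * H) / (2 * G) \<ge> 0\<close> show ?thesis
      unfolding amp_def c split by blast
  qed
  also have "\<dots> = (L + e * G) * (1 + k * (H / G)) / (2 * m)"
    using * m_pos by (simp add: field_simps)
  finally show ?thesis by (simp add: c)
qed

text \<open>The squared amplitude is a polynomial in \<open>L\<close>, \<open>G\<close> and \<open>H / G\<close>; \<open>K'\<close> is the differential of \<open>H / G\<close>.\<close>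

lemma amp_derivative:
  assumes c: "c \<in> element_domain" and ek: "e \<in> {1, -1}" "k \<in> {1, -1}"
  defines "K' \<equiv> \<lambda>V. (fst (snd (snd (snd (snd V)))) - fst (snd (snd (snd (snd c)))) / fst (snd (snd c)) * fst (snd (snd V))) /
      fst (snd (snd c))"
  obtains r' where "(amp e k has_derivative r') (at c)"
    "\<And>V. 4 * m * (amp e k c * r' V) = 
       (fst V + e * fst (snd (snd V))) * (1 + k * (fst (snd (snd (snd (snd c)))) / fst (snd (snd c)))) +
       (fst c + e * fst (snd (snd c))) * (k * K' V)"
proof -
  have G: "fst (snd (snd c)) > 0" using c by (auto simp: element_domain_iff)
  have pos: "0 < (fst c + e * fst (snd (snd c))) / m" 
    "0 < (fst (snd (snd c)) + k * fst (snd (snd (snd (snd c))))) / (2 * fst (snd (snd c)))"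
    "2 * fst (snd (snd c)) \<noteq> 0" if "c \<in> element_domain" for c
    using that m_pos element_domain_G_pos[OF that] ek unfolding element_domain_iff by (auto intro!: divide_pos_pos)
  have "smooth_on element_domain (amp e k)"
    unfolding amp_def split_beta by (intro smooth_intros open_element_domain pos)
  from smooth_on_has_derivative[OF open_element_domain this c]
  obtain r' where r': "(amp e k has_derivative r') (at c)" by blast
  have "((\<lambda>c. amp e k c * amp e k c) has_derivative (\<lambda>V. amp e k c * r' V + r' V * amp e k c)) (at c)"
    by (rule has_derivative_mult[OF r' r'])
  moreover have "((\<lambda>c. amp e k c * amp e k c) has_derivative
     (\<lambda>V. ((fst V + e * fst (snd (snd V))) * (1 + k * (fst (snd (snd (snd (snd c)))) / fst (snd (snd c)))) +
       (fst c + e * fst (snd (snd c))) * (k * K' V)) / (2 * m))) (at c)"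
  proof (rule has_derivative_transform_within_open[OF _ open_element_domain c])
    show "((\<lambda>c. (fst c + e * fst (snd (snd c))) * (1 + k * (fst (snd (snd (snd (snd c)))) / fst (snd (snd c)))) / (2 * m))
      has_derivative (\<lambda>V. ((fst V + e * fst (snd (snd V))) * (1 + k * (fst (snd (snd (snd (snd c)))) / fst (snd (snd c)))) +
       (fst c + e * fst (snd (snd c))) * (k * K' V)) / (2 * m))) (at c)"
      using G m_pos unfolding K'_def
      by (auto intro!: derivative_eq_intros simp: field_simps)
  qed (use amp_sq ek in auto)
  ultimately have "(\<lambda>V. amp e k c * r' V + r' V * amp e k c) =
     (\<lambda>V. ((fst V + e * fst (snd (snd V))) * (1 + k * (fst (snd (snd (snd (snd c)))) / fst (snd (snd c)))) +
       (fst c + e * fst (snd (snd c))) * (k * K' V)) / (2 * m))"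
    by (rule has_derivative_unique)
  moreover have "4 * m * (a * b) = z" if "a * b + b * a = z / (2 * m)" for a b z
    using that m_pos by (simp add: field_simps)
  ultimately have "4 * m * (amp e k c * r' V) = 
       (fst V + e * fst (snd (snd V))) * (1 + k * (fst (snd (snd (snd (snd c)))) / fst (snd (snd c)))) +
       (fst c + e * fst (snd (snd c))) * (k * K' V)" for V
    by meson
  with r' that show ?thesis by blast
qed

text \<open>In polar coordinates \<open>dx \<and> dy = d (amp\<^sup>2) \<and> d phase / 2\<close>. Summing over the four planes, the coefficients of
  \<open>d\<delta>\<close>, \<open>d\<gamma>\<close> and \<open>d\<zeta>\<close> are the differentials of \<open>m / 2\<close> times the sums of the squared amplitudes with weights \<open>1\<close>,
  \<open>e\<close> and \<open>e k\<close>, and these are \<open>L\<close>, \<open>G\<close> and \<open>G (H / G) = H\<close>.\<close>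

lemma lift6_symplectic:
  assumes c: "c \<in> element_domain" and T: "(lift6 has_derivative T) (at c)"
  shows "omega (T V) (T W) = wedge_form V W"
proof -
  define G where "G = fst (snd (snd c))"
  define K where "K = fst (snd (snd (snd (snd c)))) / G"
  define K' where "K' V = (fst (snd (snd (snd (snd V)))) - K * fst (snd (snd V))) / G" for V :: real6
  have G: "G > 0" using c by (auto simp: element_domain_iff G_def)
  have "\<exists>r'. (amp e k has_derivative r') (at c) \<and> (\<forall>V. 4 * m * (amp e k c * r' V) = 
       (fst V + e * fst (snd (snd V))) * (1 + k * K) + (fst c + e * G) * (k * K' V))"
    if "e \<in> {1, -1}" "k \<in> {1, -1}" for e k
    using amp_derivative[OF c that] unfolding G_def K_def K'_def by metis
  then obtain r' where r': "\<And>e k. e \<in> {1, -1} \<Longrightarrow> k \<in> {1, -1} \<Longrightarrow> (amp e k has_derivative r' e k) (at c)"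
    and rr': "\<And>e k V. e \<in> {1, -1} \<Longrightarrow> k \<in> {1, -1} \<Longrightarrow> 4 * m * (amp e k c * r' e k V) = 
       (fst V + e * fst (snd (snd V))) * (1 + k * K) + (fst c + e * G) * (k * K' V)"
    by metis
  have a': "(phase e k has_derivative phase e k) (at c)" for e k
    unfolding phase_def split_beta by (auto intro!: derivative_eq_intros)
  define x' where "x' V e k = r' e k V * cos (phase e k c) - amp e k c * sin (phase e k c) * phase e k V" for V e k
  define y' where "y' V e k = r' e k V * sin (phase e k c) + amp e k c * cos (phase e k c) * phase e k V" for V e k
  have dx: "((\<lambda>c. amp e k c * cos (phase e k c)) has_derivative (\<lambda>V. x' V e k)) (at c)"
    and dy: "((\<lambda>c. amp e k c * sin (phase e k c)) has_derivative (\<lambda>V. y' V e k)) (at c)" 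
    if "e \<in> {1, -1}" "k \<in> {1, -1}" for e k
    unfolding x'_def y'_def
    by (rule derivative_eq_intros r'[OF that] a' refl | simp add: algebra_simps)+
  have "(lift6 has_derivative (\<lambda>V. assemble (x' V) (y' V))) (at c)"
    unfolding lift6_assemble[abs_def] assemble_def
    by (intro derivative_intros has_derivative_Pair dx dy) auto
  then have T_eq: "T = (\<lambda>V. assemble (x' V) (y' V))"
    using T has_derivative_unique by blast
  have pair: "4 * m * (x' V e k * y' W e k - y' V e k * x' W e k) =
      ((fst V + e * fst (snd (snd V))) * (1 + k * K) + (fst c + e * G) * (k * K' V)) * phase e k W -
      ((fst W + e * fst (snd (snd W))) * (1 + k * K) + (fst c + e * G) * (k * K' W)) * phase e k V"
    if ek: "e \<in> {1, -1}" "k \<in> {1, -1}" for e k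
  proof -
    have X: "x' V e k * y' W e k - y' V e k * x' W e k = 
        ((cos (phase e k c))\<^sup>2 + (sin (phase e k c))\<^sup>2) * 
          (amp e k c * r' e k V * phase e k W - amp e k c * r' e k W * phase e k V)"
      unfolding x'_def y'_def by (simp only: power2_eq_square) algebra
    have "4 * m * (x' V e k * y' W e k - y' V e k * x' W e k) =
        (4 * m * (amp e k c * r' e k V)) * phase e k W - (4 * m * (amp e k c * r' e k W)) * phase e k V"
      unfolding X by (simp add: algebra_simps)
    then show ?thesis unfolding rr'[OF ek] .
  qed
  have K'G: "fst (snd (snd (snd (snd V)))) = K * fst (snd (snd V)) + G * K' V" for V :: real6
    using G by (simp add: K'_def)
  have "2 * omega (T V) (T W) = 
      4 * m * (x' V 1 1 * y' W 1 1 - y' V 1 1 * x' W 1 1) - 4 * m * (x' V (-1) 1 * y' W (-1) 1 - y' V (-1) 1 * x' W (-1) 1) +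
      4 * m * (x' V 1 (-1) * y' W 1 (-1) - y' V 1 (-1) * x' W 1 (-1)) -
      4 * m * (x' V (-1) (-1) * y' W (-1) (-1) - y' V (-1) (-1) * x' W (-1) (-1))"
    unfolding T_eq omega_assemble by (simp add: algebra_simps)
  also have "\<dots> = 2 * wedge_form V W"
    unfolding pair[of 1 1, simplified] pair[of "-1" 1, simplified] pair[of 1 "-1", simplified] pair[of "-1" "-1", simplified]
      wedge_form_def phase_def split_beta K'G by (simp add: field_simps)
  finally show ?thesis by simp
qed

end

section \<open>Local determinations of the coordinates\<close>

text \<open>Relative to the direction \<open>\<theta>\<^sub>0\<close> the argument of a planar vector in the open half plane around that
  direction is the arc tangent of the quotient of its components.\<close>

lemma smooth_angle:
  fixes X Y :: "'a::euclidean_space \<Rightarrow> real"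
  assumes S: "open S" and X: "smooth_on S X" and Y: "smooth_on S Y" and p: "p \<in> S"
    and eq: "X p = \<rho> * cos \<theta>0" "Y p = \<rho> * sin \<theta>0" "\<rho> > 0"
  obtains N \<theta> where "open N" "p \<in> N" "N \<subseteq> S" "smooth_on N \<theta>" "\<theta> p = \<theta>0"
    "\<And>q \<sigma> t. q \<in> N \<Longrightarrow> X q = \<sigma> * cos t \<Longrightarrow> Y q = \<sigma> * sin t \<Longrightarrow> \<sigma> > 0 \<Longrightarrow> [t = \<theta> q] (rmod (2 * pi))"
proof -
  define U where "U q = X q * cos \<theta>0 + Y q * sin \<theta>0" for q
  define V where "V q = Y q * cos \<theta>0 - X q * sin \<theta>0" for q
  define N where "N = {q \<in> S. U q \<in> {0<..}}"
  define \<theta> where "\<theta> q = \<theta>0 + arctan (V q / U q)" for q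
  have sU: "smooth_on S U" and sV: "smooth_on S V"
    unfolding U_def V_def by (intro smooth_intros S X Y)+
  have N: "open N"
    unfolding N_def using continuous_open_preimage[OF smooth_on_continuous[OF sU] S, of "{0<..}"]
    by (simp add: vimage_def Int_def conj_commute)
  have sub: "N \<subseteq> S" by (auto simp: N_def)
  have mono: "smooth_on N g" if "smooth_on S g" for g :: "'a \<Rightarrow> real"
    using smooth_on_subset[OF S N sub that] .
  have sm: "smooth_on N \<theta>"
    unfolding \<theta>_def by (intro smooth_intros N mono sU sV) (auto simp: N_def)
  have "U p = \<rho>" "V p = 0"
    unfolding U_def V_def eq using sin_cos_squared_add[of \<theta>0]
    by (simp_all add: algebra_simps flip: power2_eq_square distrib_left)
  then have pN: "p \<in> N" "\<theta> p = \<theta>0"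
    using p eq(3) by (simp_all add: N_def \<theta>_def)
  have "[t = \<theta> q] (rmod (2 * pi))"
    if q: "q \<in> N" and "X q = \<sigma> * cos t" "Y q = \<sigma> * sin t" "\<sigma> > 0" for q \<sigma> t
  proof -
    have U: "U q = \<sigma> * cos (t - \<theta>0)" and V: "V q = \<sigma> * sin (t - \<theta>0)"
      unfolding U_def V_def that(2,3) cos_diff sin_diff by (simp_all add: algebra_simps)
    have "U q > 0" using q by (simp add: N_def)
    then have c: "cos (t - \<theta>0) > 0" using \<open>\<sigma> > 0\<close> unfolding U by (simp add: zero_less_mult_iff)
    have quot: "V q / U q = tan (t - \<theta>0)"
      unfolding U V tan_def using \<open>\<sigma> > 0\<close> by simp
    have "1 + (tan (t - \<theta>0))\<^sup>2 = (inverse (cos (t - \<theta>0)))\<^sup>2"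
      using tan_sec[of "t - \<theta>0"] c by (simp add: power_inverse)
    then have root: "sqrt (1 + (tan (t - \<theta>0))\<^sup>2) = inverse (cos (t - \<theta>0))"
      using c by simp
    have "sin (t - \<theta>0) = sin (arctan (tan (t - \<theta>0)))" "cos (t - \<theta>0) = cos (arctan (tan (t - \<theta>0)))"
      unfolding sin_arctan cos_arctan root using c by (simp_all add: tan_def field_simps)
    then have "[t - \<theta>0 = arctan (tan (t - \<theta>0))] (rmod (2 * pi))"
      by (rule rcong_sin_cos)
    then have "[\<theta>0 + (t - \<theta>0) = \<theta>0 + arctan (tan (t - \<theta>0))] (rmod (2 * pi))"
      unfolding rcong_add_left_cancel .
    then show ?thesis unfolding \<theta>_def quot by simp
  qed
  from N pN(1) sub sm pN(2) this show ?thesis by (rule that)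
qed

context kepler
begin

definition elements6 :: "qpair \<Rightarrow> real6 \<Rightarrow> bool" where
  "elements6 p = (\<lambda>(L, d, G, g, H, h). elements p L d G g H h)"

lemma elements6_domain: "elements6 p c \<Longrightarrow> c \<in> element_domain"
  by (auto simp: elements6_def element_domain_def dest: elementsD)

lemma elements6_Sigma0: "elements6 p c \<Longrightarrow> p \<in> Sigma0"
  by (auto simp: elements6_def dest: elementsD)

lemma elements6_lift6: "c \<in> element_domain \<Longrightarrow> elements6 (lift6 c) c"
  by (auto simp: elements6_def element_domain_def lift6_def lift_elements)

lemma elements6_inject: "elements6 p c \<Longrightarrow> elements6 q c \<Longrightarrow> proj p = proj q"
  by (cases c, simp add: elements6_def, erule (1) elements_inject)

lemma elements6_rcong: "elements6 p c \<Longrightarrow> same_mod_2pi c c' \<Longrightarrow> elements6 p c'"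
  by (cases c, cases c', simp add: elements6_def, erule (1) elements_rcong)

lemma elements6_determined: "elements6 p c \<Longrightarrow> elements6 p c' \<Longrightarrow> same_mod_2pi c c'"
  by (cases c, cases c', simp add: elements6_def, erule (1) elements_determined)

lemma elements6_generic: "elements6 p c \<Longrightarrow> generic p"
  by (cases c, simp add: elements6_def, erule elements_generic)

lemma elements6_LCF: "generic p \<Longrightarrow> elements6 p (LCF \<mu> M f (proj p))"
  by (cases "LCF \<mu> M f (proj p)") (simp add: elements6_def LCF_elements)

lemma elements6_act: "elements6 (act \<theta> p) c \<longleftrightarrow> elements6 p c"
proof -
  have "qcnj (fst (act \<theta> p)) \<odot> vel (act \<theta> p) = qcnj (fst p) \<odot> vel p"
    by (simp add: vel_act fst_act qcnj_qmul qmul_assoc qexpi_cancel)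
  moreover have "evec (fst (act \<theta> p)) (vel (act \<theta> p)) = evec (fst p) (vel p)"
    by (simp add: evec_def vel_act fst_act ivec_act)
  moreover have "norm (fst (act \<theta> p)) = norm (fst p)" "norm (vel (act \<theta> p)) = norm (vel p)"
    by (simp_all add: vel_act fst_act norm_qmul)
  ultimately show ?thesis
    unfolding elements6_def elements_def act_Sigma0 by simp
qed

definition angmom_of :: "qpair \<Rightarrow> real^3" where
  "angmom_of p = - ((m / 2) *\<^sub>R snd (qcnj (fst p) \<odot> vel p))"

definition evec_of :: "qpair \<Rightarrow> real^3" where
  "evec_of p = evec (fst p) (vel p)"

text \<open>The coordinates as components and arguments of explicit functions of \<open>p\<close>, which are smooth on the
  ambient space.\<close>

lemma elements_formulas:
  assumes "elements p L d G g H h"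
  shows "L = m / 4 * (fst p \<bullet> fst p + vel p \<bullet> vel p)" "G = sqrt (angmom_of p \<bullet> angmom_of p)" "H = angmom_of p $ 3"
    and "vel p \<bullet> vel p - fst p \<bullet> fst p = ecc_scale L G * cos d" 
    and "2 * fst (qcnj (fst p) \<odot> vel p) = ecc_scale L G * sin d"
    and "- angmom_of p $ 2 = sqrt (G\<^sup>2 - H\<^sup>2) * cos h" "angmom_of p $ 1 = sqrt (G\<^sup>2 - H\<^sup>2) * sin h"
    and "evec_of p \<bullet> cross3 (axis 3 1) (angmom_of p) * sqrt (angmom_of p \<bullet> angmom_of p) = (ecc_scale L G * sqrt (G\<^sup>2 - H\<^sup>2) * G) * cos g"
    and "evec_of p \<bullet> cross3 (angmom_of p) (cross3 (axis 3 1) (angmom_of p)) = (ecc_scale L G * sqrt (G\<^sup>2 - H\<^sup>2) * G) * sin g"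
proof -
  note e = elementsD[OF assms]
  note H = e(3)
  have G: "G > 0" using elements_pos[OF assms] by simp
  have j: "angmom_of p = jvec G H h" using m_pos by (simp add: angmom_of_def e(7))
  note ji = jvec_inner(1-4)[OF H, of h]
  show L: "L = m / 4 * (fst p \<bullet> fst p + vel p \<bullet> vel p)" 
    using e(4) m_pos by (simp add: dot_square_norm)
  show Gj: "G = sqrt (angmom_of p \<bullet> angmom_of p)" "H = angmom_of p $ 3"
    using G by (simp_all add: j ji)
  show "vel p \<bullet> vel p - fst p \<bullet> fst p = ecc_scale L G * cos d" 
    using e(5) by (simp add: dot_square_norm)
  show "2 * fst (qcnj (fst p) \<odot> vel p) = ecc_scale L G * sin d" by (rule e(6))
  show "- angmom_of p $ 2 = sqrt (G\<^sup>2 - H\<^sup>2) * cos h" "angmom_of p $ 1 = sqrt (G\<^sup>2 - H\<^sup>2) * sin h"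
    unfolding j jvec_def node_def by (simp_all add: cross_components axis_def)
  have E: "evec_of p = ecc_scale L G *\<^sub>R apsis G g H h" by (simp add: evec_of_def e(8))
  have Gs: "sqrt (angmom_of p \<bullet> angmom_of p) = G" using Gj by simp
  show "evec_of p \<bullet> cross3 (axis 3 1) (angmom_of p) * sqrt (angmom_of p \<bullet> angmom_of p) = (ecc_scale L G * sqrt (G\<^sup>2 - H\<^sup>2) * G) * cos g"
    unfolding Gs unfolding E j ji(4) by (simp add: apsis_inner(1)[OF H])
  show "evec_of p \<bullet> cross3 (angmom_of p) (cross3 (axis 3 1) (angmom_of p)) = (ecc_scale L G * sqrt (G\<^sup>2 - H\<^sup>2) * G) * sin g"
    unfolding E j ji(4) by (simp add: apsis_inner(2)[OF H] cross_mult_right)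
qed

lemma smooth_invariants [smooth_intros]:
  assumes "open S"
  shows "smooth_on S (\<lambda>p. vel p)" "smooth_on S (\<lambda>p. qcnj (fst p))" "smooth_on S (\<lambda>p. qcnj (vel p))"
proof -
  show v: "smooth_on S (\<lambda>p. vel p)"
    unfolding vel_def by (intro smooth_intros assms)
  show "smooth_on S (\<lambda>p. qcnj (fst p))" "smooth_on S (\<lambda>p. qcnj (vel p))"
    by (intro smooth_on_bounded_linear[OF assms bounded_linear_qcnj] smooth_intros assms v)+
qed

lemma smooth_angmom_of [smooth_intros]: "open S \<Longrightarrow> smooth_on S (\<lambda>p. angmom_of p)"
  unfolding angmom_of_def by (intro smooth_intros)

lemma smooth_evec_of [smooth_intros]: "open S \<Longrightarrow> smooth_on S (\<lambda>p. evec_of p)"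
  unfolding evec_of_def evec_def ivec_def by (intro smooth_intros)

lemma generic_iff: "generic p \<longleftrightarrow> p \<in> Sigma0 \<and> evec_of p \<noteq> 0 \<and> cross3 (axis 3 1) (angmom_of p) \<noteq> 0"
  using m_pos by (simp add: generic_def evec_of_def angmom_of_def cross_mult_right)

text \<open>The actions are smooth functions of the invariants. The angles are arguments of planar vectors that depend
  smoothly on the point and do not vanish near a generic one, so \<open>smooth_angle\<close> provides a determination
  through any admissible value. On \<open>Sigma0\<close> it agrees modulo \<open>2 \<pi>\<close> with the LCF coordinates.\<close>

lemma local_determination:
  assumes c: "elements6 p c"
  obtains N \<Gamma> where "open N" "p \<in> N" "smooth_on N \<Gamma>" "\<Gamma> p = c" "\<And>q. q \<in> N \<Longrightarrow> q \<in> Sigma0 \<Longrightarrow> elements6 q (\<Gamma> q)"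
proof -
  obtain L d G g H h where c_eq: "c = (L, d, G, g, H, h)" by (cases c)
  then have el: "elements p L d G g H h" using c by (simp add: elements6_def)
  note F = elements_formulas[OF el]
  have GH: "\<bar>H\<bar> < G" using elementsD[OF el] by simp
  have pos: "ecc_scale L G > 0" "G > 0" "sqrt (G\<^sup>2 - H\<^sup>2) > 0"
    using elements_pos[OF el] jvec_inner(5)[OF GH] by simp_all
  define S where "S = {q. cross3 (axis 3 1) (angmom_of q) \<noteq> 0} \<inter> {q. evec_of q \<noteq> 0}"
  have "continuous_on UNIV angmom_of" "continuous_on UNIV evec_of"
    using smooth_on_continuous[OF smooth_angmom_of[OF open_UNIV]] smooth_on_continuous[OF smooth_evec_of[OF open_UNIV]] by simp_all
  then have S: "open S"
    unfolding S_def by (intro open_Int open_Collect_neq continuous_on_cross continuous_on_const)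
  have p: "p \<in> S"
    using elements_generic[OF el] by (simp add: S_def generic_iff)
  have jpos: "angmom_of q \<bullet> angmom_of q > 0" if "q \<in> S" for q
    using that by (auto simp: S_def)
  have smooth: "smooth_on S (\<lambda>q. vel q \<bullet> vel q - fst q \<bullet> fst q)" 
    "smooth_on S (\<lambda>q. 2 * fst (qcnj (fst q) \<odot> vel q))"
    "smooth_on S (\<lambda>q. - angmom_of q $ 2)" "smooth_on S (\<lambda>q. angmom_of q $ 1)"
    "smooth_on S (\<lambda>q. evec_of q \<bullet> cross3 (axis 3 1) (angmom_of q) * sqrt (angmom_of q \<bullet> angmom_of q))"
    "smooth_on S (\<lambda>q. evec_of q \<bullet> cross3 (angmom_of q) (cross3 (axis 3 1) (angmom_of q)))"
    by (intro smooth_intros S jpos; assumption)+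
  obtain N1 \<delta> where 1: "open N1" "p \<in> N1" "N1 \<subseteq> S" "smooth_on N1 \<delta>" "\<delta> p = d"
    "\<And>q \<sigma> t. q \<in> N1 \<Longrightarrow> vel q \<bullet> vel q - fst q \<bullet> fst q = \<sigma> * cos t \<Longrightarrow> 
       2 * fst (qcnj (fst q) \<odot> vel q) = \<sigma> * sin t \<Longrightarrow> \<sigma> > 0 \<Longrightarrow> [t = \<delta> q] (rmod (2 * pi))"
    by (rule smooth_angle[OF S smooth(1,2) p F(4,5) pos(1)]) (rule that; assumption)
  obtain N2 \<zeta> where 2: "open N2" "p \<in> N2" "N2 \<subseteq> S" "smooth_on N2 \<zeta>" "\<zeta> p = h"
    "\<And>q \<sigma> t. q \<in> N2 \<Longrightarrow> - angmom_of q $ 2 = \<sigma> * cos t \<Longrightarrow> angmom_of q $ 1 = \<sigma> * sin t \<Longrightarrow> \<sigma> > 0 \<Longrightarrow>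
       [t = \<zeta> q] (rmod (2 * pi))"
    by (rule smooth_angle[OF S smooth(3,4) p F(6,7) pos(3)]) (rule that; assumption)
  have pos': "ecc_scale L G * sqrt (G\<^sup>2 - H\<^sup>2) * G > 0" using pos by simp
  obtain N3 \<gamma> where 3: "open N3" "p \<in> N3" "N3 \<subseteq> S" "smooth_on N3 \<gamma>" "\<gamma> p = g"
    "\<And>q \<sigma> t. q \<in> N3 \<Longrightarrow> evec_of q \<bullet> cross3 (axis 3 1) (angmom_of q) * sqrt (angmom_of q \<bullet> angmom_of q) = \<sigma> * cos t \<Longrightarrow> 
       evec_of q \<bullet> cross3 (angmom_of q) (cross3 (axis 3 1) (angmom_of q)) = \<sigma> * sin t \<Longrightarrow> \<sigma> > 0 \<Longrightarrow> [t = \<gamma> q] (rmod (2 * pi))"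
    by (rule smooth_angle[OF S smooth(5,6) p F(8,9) pos']) (rule that; assumption)
  define N where "N = N1 \<inter> N2 \<inter> N3"
  define \<Gamma> where "\<Gamma> q = (m / 4 * (fst q \<bullet> fst q + vel q \<bullet> vel q), \<delta> q, sqrt (angmom_of q \<bullet> angmom_of q), \<gamma> q, angmom_of q $ 3, \<zeta> q)" for q
  have N: "open N" "N \<subseteq> S" "N \<subseteq> N1" "N \<subseteq> N2" "N \<subseteq> N3"
    using 1 2 3 by (auto simp: N_def)
  have "smooth_on N \<delta>" "smooth_on N \<zeta>" "smooth_on N \<gamma>"
    using smooth_on_subset[OF 1(1) N(1,3) 1(4)] smooth_on_subset[OF 2(1) N(1,4) 2(4)]
      smooth_on_subset[OF 3(1) N(1,5) 3(4)] by simp_all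
  then have sm: "smooth_on N \<Gamma>"
    unfolding \<Gamma>_def using N(2) by (intro smooth_intros N(1) jpos) auto
  have \<Gamma>p: "\<Gamma> p = c"
    unfolding \<Gamma>_def c_eq 1(5) 2(5) 3(5) F(1)[symmetric] F(2)[symmetric] F(3)[symmetric] ..
  have el: "elements6 q (\<Gamma> q)" if q: "q \<in> N" "q \<in> Sigma0" for q
  proof -
    have "generic q" using q N(2) by (auto simp: generic_iff S_def)
    then obtain L' d' G' g' H' h' where el': "elements q L' d' G' g' H' h'"
      using elements6_LCF[of q] by (cases "LCF \<mu> M f (proj q)") (auto simp: elements6_def)
    note F' = elements_formulas[OF el']
    have GH': "\<bar>H'\<bar> < G'" using elementsD[OF el'] by simp
    have pos: "ecc_scale L' G' > 0" "G' > 0" "sqrt (G'\<^sup>2 - H'\<^sup>2) > 0"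
      using elements_pos[OF el'] jvec_inner(5)[OF GH'] by simp_all
    then have pos': "ecc_scale L' G' * sqrt (G'\<^sup>2 - H'\<^sup>2) * G' > 0" by simp
    have "same_mod_2pi (L', d', G', g', H', h') (\<Gamma> q)"
      unfolding \<Gamma>_def same_mod_2pi_def split
    proof (intro conjI F'(1-3))
      show "[d' = \<delta> q] (rmod (2 * pi))" using 1(6)[OF _ F'(4,5) pos(1)] q(1) N(3) by blast
      show "[g' = \<gamma> q] (rmod (2 * pi))" using 3(6)[OF _ F'(8,9) pos'] q(1) N(5) by blast
      show "[h' = \<zeta> q] (rmod (2 * pi))" using 2(6)[OF _ F'(6,7) pos(3)] q(1) N(4) by blast
    qed
    then show ?thesis
      using el' elements6_rcong[of q "(L', d', G', g', H', h')" "\<Gamma> q"] by (simp add: elements6_def)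
  qed
  have "p \<in> N" using 1(2) 2(2) 3(2) by (simp add: N_def)
  from N(1) this sm \<Gamma>p el show ?thesis by (rule that)
qed

end

section \<open>Charts\<close>

context kepler
begin

text \<open>Angles in this set differ by less than \<open>\<pi>\<close>, so congruent elements of it are equal and the section is
  injective modulo the circle action.\<close>

definition angle_box :: "real6 \<Rightarrow> real6 set" where
  "angle_box c0 = element_domain \<inter> {c. \<bar>fst (snd c) - fst (snd c0)\<bar> < pi / 2} \<inter>
     {c. \<bar>fst (snd (snd (snd c))) - fst (snd (snd (snd c0)))\<bar> < pi / 2} \<inter>
     {c. \<bar>snd (snd (snd (snd (snd c)))) - snd (snd (snd (snd (snd c0))))\<bar> < pi / 2}"

lemma open_angle_box: "open (angle_box c0)"
  unfolding angle_box_def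
  by (intro open_Int open_element_domain open_Collect_less continuous_intros)

lemma angle_box_unique:
  assumes "c \<in> angle_box c0" "c' \<in> angle_box c0" "same_mod_2pi c c'"
  shows "c = c'"
proof -
  have eq: "a = b" if "[a = b] (rmod (2 * pi))" "\<bar>a - x\<bar> < pi / 2" "\<bar>b - x\<bar> < pi / 2" for a b x :: real
  proof (rule rcong_imp_eq[OF that(1)])
    show "\<bar>a - b\<bar> < \<bar>2 * pi\<bar>" using that(2,3) pi_gt_zero by linarith
  qed
  show ?thesis
    using assms eq by (cases c, cases c') (auto simp: angle_box_def same_mod_2pi_def)
qed

definition chart_dom :: "real6 \<Rightarrow> vpoint set" where
  "chart_dom c0 = (\<lambda>c. proj (lift6 c)) ` angle_box c0"

definition chart :: "real6 \<Rightarrow> vpoint \<Rightarrow> real6" where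
  "chart c0 = inv_into (angle_box c0) (\<lambda>c. proj (lift6 c))"

lemma inj_on_proj_lift6: "inj_on (\<lambda>c. proj (lift6 c)) (angle_box c0)"
proof (rule inj_onI)
  fix c c' assume c: "c \<in> angle_box c0" "c' \<in> angle_box c0" and "proj (lift6 c) = proj (lift6 c')"
  then obtain \<theta> where \<theta>: "lift6 c' = act \<theta> (lift6 c)"
    by (auto simp: proj_eq_iff)
  have "c \<in> element_domain" "c' \<in> element_domain" using c by (auto simp: angle_box_def)
  then have "elements6 (lift6 c) c" "elements6 (lift6 c) c'"
    using elements6_lift6[of c] elements6_lift6[of c'] elements6_act[of \<theta> "lift6 c" c'] by (simp_all add: \<theta>)
  then show "c = c'"
    using c angle_box_unique elements6_determined by blast
qed

text \<open>In the box the relation \<open>elements6\<close> is the graph of the chart, since \<open>lift6 c\<close> has the elements \<open>c\<close> and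
  points with the same elements lie on the same circle orbit.\<close>

lemma chart_iff:
  assumes c: "c \<in> angle_box c0"
  shows "elements6 p c \<longleftrightarrow> p \<in> Sigma0 \<and> proj p \<in> chart_dom c0 \<and> chart c0 (proj p) = c"
proof
  have el: "elements6 (lift6 c) c" using c elements6_lift6 by (simp add: angle_box_def)
  have inv: "chart c0 (proj (lift6 c)) = c"
    unfolding chart_def using inv_into_f_f[OF inj_on_proj_lift6 c] .
  assume p: "elements6 p c"
  then have "proj p = proj (lift6 c)" using el elements6_inject by blast
  then show "p \<in> Sigma0 \<and> proj p \<in> chart_dom c0 \<and> chart c0 (proj p) = c"
    using inv c elements6_Sigma0[OF p] by (auto simp: chart_dom_def)
next
  assume *: "p \<in> Sigma0 \<and> proj p \<in> chart_dom c0 \<and> chart c0 (proj p) = c"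
  then have "proj (lift6 c) = proj p"
    unfolding chart_def chart_dom_def using f_inv_into_f by metis
  then obtain \<theta> where "p = act \<theta> (lift6 c)" unfolding proj_eq_iff by blast
  then show "elements6 p c"
    using c elements6_act elements6_lift6 by (simp add: angle_box_def)
qed

lemma chart_in_box: "x \<in> chart_dom c0 \<Longrightarrow> chart c0 x \<in> angle_box c0"
  unfolding chart_def chart_dom_def by (rule inv_into_into)

lemma chart_elements: "p \<in> Sigma0 \<Longrightarrow> proj p \<in> chart_dom c0 \<Longrightarrow> elements6 p (chart c0 (proj p))"
  using chart_iff[OF chart_in_box] by simp

lemma chart_image: "chart c0 ` chart_dom c0 = angle_box c0"
  unfolding chart_def chart_dom_def image_image
  using inv_into_f_f[OF inj_on_proj_lift6] by simp

text \<open>A smooth determination through the value of the chart stays in the box near the point, so it represents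
  the chart there. This gives at once that the chart domain is open and that the chart is smooth.\<close>

lemma chart_local:
  assumes p: "p \<in> Sigma0" "proj p \<in> chart_dom c0"
  obtains N \<Gamma> where "open N" "p \<in> N" "smooth_on N \<Gamma>"
    "\<And>q. q \<in> N \<Longrightarrow> q \<in> Sigma0 \<Longrightarrow> proj q \<in> chart_dom c0 \<and> chart c0 (proj q) = \<Gamma> q"
proof -
  obtain N \<Gamma> where N: "open N" "p \<in> N" "smooth_on N \<Gamma>" "\<Gamma> p = chart c0 (proj p)"
    and el: "\<And>q. q \<in> N \<Longrightarrow> q \<in> Sigma0 \<Longrightarrow> elements6 q (\<Gamma> q)"
    using local_determination[OF chart_elements[OF p]] by metis
  define N' where "N' = N \<inter> \<Gamma> -` angle_box c0"
  have "open N'"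
    unfolding N'_def using continuous_open_preimage[OF smooth_on_continuous[OF N(3)] N(1) open_angle_box] .
  moreover have "p \<in> N'"
    using N(2,4) chart_in_box[OF p(2)] by (simp add: N'_def)
  moreover have "smooth_on N' \<Gamma>"
    using smooth_on_subset[OF N(1) \<open>open N'\<close> _ N(3)] by (simp add: N'_def)
  moreover have "proj q \<in> chart_dom c0 \<and> chart c0 (proj q) = \<Gamma> q" if "q \<in> N'" "q \<in> Sigma0" for q
    using el[of q] that chart_iff[of "\<Gamma> q" c0 q] by (simp add: N'_def)
  ultimately show ?thesis by (rule that)
qed

lemma V0_open_chart_dom: "V0_open (chart_dom c0)"
  unfolding V0_open_def
proof
  have "lift6 c \<in> Sigma0" if "c \<in> angle_box c0" for c
    using that elements6_Sigma0[OF elements6_lift6] by (simp add: angle_box_def)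
  then show "chart_dom c0 \<subseteq> V0"
    by (auto simp: chart_dom_def V0_def)
  define T where "T = \<Union> {N. open N \<and> (\<forall>q\<in>N \<inter> Sigma0. proj q \<in> chart_dom c0)}"
  have "open T" unfolding T_def by auto
  moreover have "{p \<in> Sigma0. proj p \<in> chart_dom c0} = Sigma0 \<inter> T"
  proof (intro set_eqI iffI)
    fix p assume "p \<in> {p \<in> Sigma0. proj p \<in> chart_dom c0}"
    then have p: "p \<in> Sigma0" "proj p \<in> chart_dom c0" by auto
    then obtain N \<Gamma> where "open N" "p \<in> N"
      "\<And>q. q \<in> N \<Longrightarrow> q \<in> Sigma0 \<Longrightarrow> proj q \<in> chart_dom c0 \<and> chart c0 (proj q) = \<Gamma> q"
      by (rule chart_local) (rule that; assumption)
    then show "p \<in> Sigma0 \<inter> T" using p(1) by (auto simp: T_def)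
  qed (auto simp: T_def)
  ultimately show "openin (top_of_set Sigma0) {p \<in> Sigma0. proj p \<in> chart_dom c0}"
    unfolding openin_open by blast
qed

lemma V0_chart_chart: "V0_chart (chart_dom c0) (chart c0)"
  unfolding V0_chart_def chart_image
proof (intro conjI V0_open_chart_dom open_angle_box ballI)
  show "V0_smooth_on (chart_dom c0) (chart c0)"
    unfolding V0_smooth_on_def
  proof (intro ballI impI)
    fix p assume "p \<in> Sigma0" "proj p \<in> chart_dom c0"
    then obtain N \<Gamma> where "open N" "p \<in> N" "smooth_on N \<Gamma>"
      "\<And>q. q \<in> N \<Longrightarrow> q \<in> Sigma0 \<Longrightarrow> proj q \<in> chart_dom c0 \<and> chart c0 (proj q) = \<Gamma> q"
      by (rule chart_local) (rule that; assumption)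
    then show "\<exists>N g. open N \<and> p \<in> N \<and> smooth_on N g \<and>
        (\<forall>q\<in>N \<inter> Sigma0. proj q \<in> chart_dom c0 \<longrightarrow> chart c0 (proj q) = g q)"
      by (intro exI[of _ N] exI[of _ \<Gamma>]) auto
  qed
  show "inj_on (chart c0) (chart_dom c0)"
    unfolding chart_def chart_dom_def by (rule inj_on_inv_into) simp
  fix c assume c: "c \<in> angle_box c0"
  have smooth: "smooth_on (angle_box c0) lift6"
    by (rule smooth_on_subset[OF open_element_domain open_angle_box _ smooth_lift6]) (auto simp: angle_box_def)
  have "lift6 c' \<in> Sigma0 \<and> proj (lift6 c') \<in> chart_dom c0 \<and> chart c0 (proj (lift6 c')) = c'"
    if c': "c' \<in> angle_box c0" for c'
    using chart_iff[OF c', of "lift6 c'"] elements6_lift6[of c'] c' by (simp add: angle_box_def)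
  then show "\<exists>W s. open W \<and> c \<in> W \<and> W \<subseteq> angle_box c0 \<and> smooth_on W s \<and>
      (\<forall>c'\<in>W. s c' \<in> Sigma0 \<and> proj (s c') \<in> chart_dom c0 \<and> chart c0 (proj (s c')) = c')"
    using c smooth open_angle_box by (intro exI[of _ "angle_box c0"] exI[of _ lift6]) simp
qed

text \<open>In the chart the reduced form is the standard form, because \<open>lift6\<close> is symplectic: the differential of
  the chart inverts that of the rotated section and kills the vertical direction.\<close>

lemma chart_symplectic:
  assumes p: "p \<in> Sigma0" "proj p \<in> chart_dom c0"
  obtains D where "((chart c0 \<circ> proj) has_derivative D) (at p within Sigma0)"
    "\<And>X Y. X \<in> tangent p \<Longrightarrow> Y \<in> tangent p \<Longrightarrow> omega1 (dproj p X) (dproj p Y) = wedge_form (D X) (D Y)"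
proof -
  obtain N \<Gamma> where N: "open N" "p \<in> N" "smooth_on N \<Gamma>"
    and \<Gamma>: "\<And>q. q \<in> N \<Longrightarrow> q \<in> Sigma0 \<Longrightarrow> proj q \<in> chart_dom c0 \<and> chart c0 (proj q) = \<Gamma> q"
    by (rule chart_local[OF p]) (rule that; assumption)
  define c where "c = chart c0 (proj p)"
  define D where "D = frechet_derivative \<Gamma> (at p)"
  have D: "(\<Gamma> has_derivative D) (at p)"
    unfolding D_def by (rule smooth_on_has_derivative[OF N(1,3,2)])
  obtain \<epsilon> where \<epsilon>: "\<epsilon> > 0" "ball p \<epsilon> \<subseteq> N"
    using N(1,2) openE by blast
  have D_chart: "((chart c0 \<circ> proj) has_derivative D) (at p within Sigma0)"
    by (rule has_derivative_transform_within[OF has_derivative_at_withinI[OF D] \<epsilon>(1) p(1)])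
      (use \<Gamma> \<epsilon>(2) in \<open>auto simp: subset_iff dist_commute\<close>)
  have c: "c \<in> angle_box c0" "c \<in> element_domain"
    using chart_in_box[OF p(2)] by (auto simp: c_def angle_box_def)
  have "elements6 p c" unfolding c_def by (rule chart_elements[OF p])
  then have "proj (lift6 c) = proj p" using elements6_inject elements6_lift6 c(2) by blast
  then obtain \<theta> where \<theta>: "p = act \<theta> (lift6 c)" unfolding proj_eq_iff by blast
  define S where "S = frechet_derivative lift6 (at c)"
  have S: "(lift6 has_derivative S) (at c)"
    unfolding S_def by (rule smooth_on_has_derivative[OF open_element_domain smooth_lift6 c(2)])
  define T where "T V = act \<theta> (S V)" for V
  have T: "((\<lambda>c. act \<theta> (lift6 c)) has_derivative T) (at c)"
    unfolding T_def by (rule bounded_linear.has_derivative[OF bounded_linear_act S])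
  have form: "omega (T V) (T W) = wedge_form V W" for V W
    unfolding T_def omega_act by (rule lift6_symplectic[OF c(2) S])
  have section_Sigma0: "act \<theta> (lift6 c') \<in> Sigma0" if "c' \<in> element_domain" for c'
    using elements6_Sigma0[OF elements6_lift6[OF that]] by (simp add: act_Sigma0)
  have tan: "T V \<in> tangent p" for V
  proof -
    have "(bilin \<circ> (\<lambda>c. act \<theta> (lift6 c)) has_derivative (\<lambda>X. - omega X (vert p)) \<circ> T) (at c)"
      by (rule diff_chain_at[OF T]) (simp add: bilin_has_derivative flip: \<theta>)
    moreover have "(bilin \<circ> (\<lambda>c. act \<theta> (lift6 c)) has_derivative (\<lambda>V. 0)) (at c)"
      by (rule has_derivative_transform_within_open[OF has_derivative_const[of 0] open_element_domain c(2)])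
        (use section_Sigma0 in \<open>simp add: Sigma0_iff\<close>)
    ultimately have "(\<lambda>X. - omega X (vert p)) \<circ> T = (\<lambda>V. 0)"
      by (rule has_derivative_unique)
    then show ?thesis
      by (metis comp_apply neg_equal_0_iff_equal tangent_iff)
  qed
  have DT: "D (T V) = V" for V
  proof -
    have "(\<Gamma> \<circ> (\<lambda>c. act \<theta> (lift6 c)) has_derivative D \<circ> T) (at c)"
      by (rule diff_chain_at[OF T]) (simp add: D flip: \<theta>)
    moreover have "(\<Gamma> \<circ> (\<lambda>c. act \<theta> (lift6 c)) has_derivative (\<lambda>V. V)) (at c)"
    proof -
      define W where "W = angle_box c0 \<inter> (\<lambda>c. act \<theta> (lift6 c)) -` N"
      have "continuous_on element_domain lift6" by (rule smooth_on_continuous[OF smooth_lift6])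
      then have "continuous_on (angle_box c0) lift6"
        by (rule continuous_on_subset) (auto simp: angle_box_def)
      then have "continuous_on (angle_box c0) (\<lambda>c. act \<theta> (lift6 c))"
        by (rule bounded_linear.continuous_on[OF bounded_linear_act])
      from continuous_open_preimage[OF this open_angle_box N(1)]
      have W: "open W" by (simp add: W_def)
      have cW: "c \<in> W" using c(1) N(2) \<theta> by (simp add: W_def)
      have "\<Gamma> (act \<theta> (lift6 c')) = c'" if "c' \<in> W" for c'
      proof -
        have c': "c' \<in> angle_box c0" "act \<theta> (lift6 c') \<in> N" "c' \<in> element_domain"
          using that by (auto simp: W_def angle_box_def)
        have "elements6 (act \<theta> (lift6 c')) c'"
          using elements6_lift6[OF c'(3)] by (simp add: elements6_act)
        then have "chart c0 (proj (act \<theta> (lift6 c'))) = c'"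
          using chart_iff[OF c'(1)] by blast
        then show ?thesis
          using \<Gamma>[OF c'(2) section_Sigma0[OF c'(3)]] by simp
      qed
      then show ?thesis
        by (intro has_derivative_transform_within_open[OF has_derivative_ident W cW]) simp
    qed
    ultimately have "D \<circ> T = (\<lambda>V. V)"
      by (rule has_derivative_unique)
    then show ?thesis by (metis comp_apply)
  qed
  have Dvert: "D (vert p) = 0"
  proof -
    have vd: "((\<lambda>t. act t p) has_derivative (\<lambda>s. s *\<^sub>R vert p)) (at 0)"
      using act_has_derivative[of p] by (simp add: has_vector_derivative_def)
    have "(\<Gamma> \<circ> (\<lambda>t. act t p) has_derivative D \<circ> (\<lambda>s. s *\<^sub>R vert p)) (at 0)"
      by (rule diff_chain_at[OF vd]) (simp add: D)
    moreover have "(\<Gamma> \<circ> (\<lambda>t. act t p) has_derivative (\<lambda>s. 0)) (at 0)"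
    proof -
      have "continuous_on UNIV (\<lambda>t. act t p)"
        unfolding act_def split_beta qexpi_def
        by (intro continuous_intros bounded_bilinear.continuous_on[OF bounded_bilinear_qmul])
      from continuous_open_preimage[OF this open_UNIV N(1)]
      have W: "open ((\<lambda>t. act t p) -` N)" by simp
      have "\<Gamma> (act t p) = c" if "act t p \<in> N" for t
        using \<Gamma>[OF that] p(1) by (simp add: act_Sigma0 proj_act c_def)
      then show ?thesis
        using N(2) by (intro has_derivative_transform_within_open[OF has_derivative_const[of c] W]) simp_all
    qed
    ultimately have "D \<circ> (\<lambda>s. s *\<^sub>R vert p) = (\<lambda>s. 0)"
      by (rule has_derivative_unique)
    then have "D (1 *\<^sub>R vert p) = 0" by (metis comp_apply)
    then show ?thesis by simp
  qed
  have linD: "linear D" and linT: "linear T"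
    using D T by (simp_all add: has_derivative_linear)
  have p0: "p \<noteq> 0" using p(1) by (simp add: Sigma0_iff)
  have "omega1 (dproj p X) (dproj p Y) = wedge_form (D X) (D Y)"
    if X: "X \<in> tangent p" and Y: "Y \<in> tangent p" for X Y
  proof -
    obtain V s where V: "X = T V + s *\<^sub>R vert p"
      using tangent_decomposition[OF p0 linT tan form X] .
    obtain W t where W: "Y = T W + t *\<^sub>R vert p"
      using tangent_decomposition[OF p0 linT tan form Y] .
    have "D X = V" "D Y = W"
      unfolding V W using linD by (simp_all add: linear_add linear_scale DT Dvert)
    moreover have "omega (T Z) (vert p) = 0" "omega (vert p) (T Z) = 0" "omega (vert p) (vert p) = 0" for Z
      using tan[of Z] vert_tangent[of p] omega_skew[of "vert p" "T Z"] by (simp_all add: tangent_iff)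
    then have "omega X Y = wedge_form V W"
      unfolding V W by (simp add: omega_linear form)
    ultimately show ?thesis
      using omega1_dproj[OF p(1) X Y] by simp
  qed
  with D_chart show ?thesis by (rule that)
qed

end

theorem proposition4p1:
  fixes \<mu>\<^sub>0 M\<^sub>0 f :: real
  assumes "\<mu>\<^sub>0 > 0" and "M\<^sub>0 > 0" and "f > 0"
  shows "Darboux_coordinates_on (V1tilde \<mu>\<^sub>0 M\<^sub>0 f) (LCF \<mu>\<^sub>0 M\<^sub>0 f)"
proof -
  interpret kepler \<mu>\<^sub>0 M\<^sub>0 f by unfold_locales (use assms in auto)
  have rep: "\<exists>p. p \<in> Sigma0 \<and> x = proj p \<and> elements6 p (LCF \<mu>\<^sub>0 M\<^sub>0 f x)" if x: "x \<in> V1tilde \<mu>\<^sub>0 M\<^sub>0 f" for x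
  proof -
    obtain p where p: "p \<in> Sigma0" "x = proj p"
      using x by (auto simp: V1tilde_def V0_def)
    with x have "generic p" using V1tilde_iff by blast
    with p show ?thesis using elements6_LCF by blast
  qed
  show ?thesis
    unfolding Darboux_coordinates_on_def
  proof (intro conjI ballI impI)
    fix x y assume x: "x \<in> V1tilde \<mu>\<^sub>0 M\<^sub>0 f" and y: "y \<in> V1tilde \<mu>\<^sub>0 M\<^sub>0 f"
      and same: "same_mod_2pi (LCF \<mu>\<^sub>0 M\<^sub>0 f x) (LCF \<mu>\<^sub>0 M\<^sub>0 f y)"
    obtain p q where p: "x = proj p" "elements6 p (LCF \<mu>\<^sub>0 M\<^sub>0 f x)" and q: "y = proj q" "elements6 q (LCF \<mu>\<^sub>0 M\<^sub>0 f y)"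
      using rep[OF x] rep[OF y] by blast
    then show "x = y"
      using elements6_inject[OF elements6_rcong[OF p(2) same] q(2)] by simp
  next
    fix x assume "x \<in> V1tilde \<mu>\<^sub>0 M\<^sub>0 f"
    then obtain p where p: "p \<in> Sigma0" "x = proj p" "elements6 p (LCF \<mu>\<^sub>0 M\<^sub>0 f x)"
      using rep by blast
    define c0 where "c0 = LCF \<mu>\<^sub>0 M\<^sub>0 f x"
    have "c0 \<in> angle_box c0"
      using elements6_domain[OF p(3)] by (simp add: angle_box_def c0_def)
    then have "x \<in> chart_dom c0"
      using chart_iff[of c0 c0 p] p by (simp add: c0_def)
    moreover have chart_rep: "\<exists>q. q \<in> Sigma0 \<and> y = proj q \<and> elements6 q (chart c0 y)" if y: "y \<in> chart_dom c0" for y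
    proof -
      have "y \<in> V0"
        using y V0_open_chart_dom[of c0] unfolding V0_open_def by blast
      then obtain q where "q \<in> Sigma0" "y = proj q"
        unfolding V0_def by blast
      then show ?thesis using chart_elements y by blast
    qed
    have "chart_dom c0 \<subseteq> V1tilde \<mu>\<^sub>0 M\<^sub>0 f"
      using chart_rep elements6_generic V1tilde_iff by blast
    moreover have "same_mod_2pi (chart c0 y) (LCF \<mu>\<^sub>0 M\<^sub>0 f y)" if y: "y \<in> chart_dom c0" for y
    proof -
      obtain q where q: "y = proj q" "elements6 q (chart c0 y)" using chart_rep[OF y] by blast
      then have "elements6 q (LCF \<mu>\<^sub>0 M\<^sub>0 f y)" using elements6_LCF elements6_generic by blast
      with q(2) show ?thesis by (rule elements6_determined)
    qed
    moreover have "\<exists>D. ((chart c0 \<circ> proj) has_derivative D) (at p within Sigma0) \<and>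
        (\<forall>X\<in>tangent p. \<forall>Y\<in>tangent p. omega1 (dproj p X) (dproj p Y) = wedge_form (D X) (D Y))"
      if "p \<in> Sigma0" "proj p \<in> chart_dom c0" for p
      using chart_symplectic[OF that] by metis
    ultimately show "\<exists>N \<phi>. x \<in> N \<and> N \<subseteq> V1tilde \<mu>\<^sub>0 M\<^sub>0 f \<and> V0_chart N \<phi> \<and>
        (\<forall>y\<in>N. same_mod_2pi (\<phi> y) (LCF \<mu>\<^sub>0 M\<^sub>0 f y)) \<and>
        (\<forall>p\<in>Sigma0. proj p \<in> N \<longrightarrow>
           (\<exists>D. ((\<phi> \<circ> proj) has_derivative D) (at p within Sigma0) \<and>
              (\<forall>X\<in>tangent p. \<forall>Y\<in>tangent p.
                 omega1 (dproj p X) (dproj p Y) = wedge_form (D X) (D Y))))"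
      using V0_chart_chart[of c0] by (intro exI[of _ "chart_dom c0"] exI[of _ "chart c0"]) simp
  qed
qed

end
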